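(* The Hessian map $h_{3,3}:\Sigma(3,3)\dashrightarrow\Sigma(4,3)$, from cubic surfaces to quartic surfaces in $\mathbb P^3$, is birational onto its image. Hence the general cubic surface $F$ is uniquely determined by its Hessian $\operatorname{Hess}(F)$.
   Context: Work over an algebraically closed field $k$ of characteristic zero. $\Sigma(d,3)$ is the projective space of nonzero homogeneous polynomials of degree $d$ in $x_0,\dots,x_3$ up to scalars. If $F$ is the surface $f=0$, then $\operatorname{hess}(f)=\det(\partial^2 f/\partial x_i\partial x_j)_{0\le i,j\le 3}$ and $\operatorname{Hess}(F)$ is the surface $\operatorname{hess}(f)=0$. The Hessian map is the rational map $h_{3,3}:[f]\mapsto[\operatorname{hess}(f)]$. *)

theory Defs
  imports "HOL-Analysis.Analysis" "HOL-Library.Poly_Mapping"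
begin

text \<open>
  The polynomial ring \<open>k[x\<^sub>v | v \<in> 'v]\<close> is the type \<open>('v, 'k) mpoly\<close> of finitely supported
  functions from monomials (exponent vectors) to coefficients.
\<close>

type_synonym 'v monomial = "'v \<Rightarrow>\<^sub>0 nat"
type_synonym ('v, 'k) mpoly = "'v monomial \<Rightarrow>\<^sub>0 'k"

definition mdegree :: "'v monomial \<Rightarrow> nat" where
  "mdegree m = (\<Sum>v\<in>Poly_Mapping.keys m. Poly_Mapping.lookup m v)"

definition monomials :: "'v set \<Rightarrow> nat \<Rightarrow> 'v monomial set" where
  "monomials I d = {m. Poly_Mapping.keys m \<subseteq> I \<and> mdegree m = d}"

text \<open>Homogeneous polynomials of degree \<open>d\<close> in the variables \<open>x\<^sub>i\<close>, \<open>i \<in> I\<close> (zero included).\<close>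

definition forms :: "'v set \<Rightarrow> nat \<Rightarrow> ('v, 'k::zero) mpoly set" where
  "forms I d = {f. Poly_Mapping.keys f \<subseteq> monomials I d}"

definition eval :: "('v, 'k::comm_semiring_1) mpoly \<Rightarrow> ('v \<Rightarrow> 'k) \<Rightarrow> 'k" where
  "eval f x = (\<Sum>m\<in>Poly_Mapping.keys f. Poly_Mapping.lookup f m *
     (\<Prod>v\<in>Poly_Mapping.keys m. x v ^ Poly_Mapping.lookup m v))"

text \<open>Where the exponent of \<open>x\<^sub>v\<close> is \<open>0\<close>, the truncated subtraction is harmless: the coefficient vanishes.\<close>

definition pdiff :: "'v \<Rightarrow> ('v, 'k::comm_semiring_1) mpoly \<Rightarrow> ('v, 'k) mpoly" where
  "pdiff v f = (\<Sum>m\<in>Poly_Mapping.keys f. Poly_Mapping.single (m - Poly_Mapping.single v 1)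
     (of_nat (Poly_Mapping.lookup m v) * Poly_Mapping.lookup f m))"

definition hess :: "('n::finite, 'k::comm_ring_1) mpoly \<Rightarrow> ('n, 'k) mpoly" where
  "hess f = det (\<chi> i j. pdiff i (pdiff j f))"


section \<open>Projective spaces and the Zariski topology\<close>

text \<open>
  A vector with coordinates indexed by \<open>J\<close> is an \<open>a :: 'i \<Rightarrow>\<^sub>0 'k\<close> supported in \<open>J\<close>, and a point of
  the projective space on these coordinates is the set of nonzero multiples of a nonzero vector.
  A form of degree \<open>d\<close> is itself such a vector, its coordinates being its coefficients.
\<close>

type_synonym ('i, 'k) point = "('i \<Rightarrow>\<^sub>0 'k) set"

definition proj :: "('i \<Rightarrow>\<^sub>0 'k::field) \<Rightarrow> ('i, 'k) point" where
  "proj a = {Poly_Mapping.map ((*) c) a | c. c \<noteq> 0}"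

definition nzvecs :: "'i set \<Rightarrow> ('i \<Rightarrow>\<^sub>0 'k::field) set" where
  "nzvecs J = {a. a \<noteq> 0 \<and> Poly_Mapping.keys a \<subseteq> J}"

definition proj_space :: "'i set \<Rightarrow> ('i, 'k::field) point set" where
  "proj_space J = proj ` nzvecs J"

definition basic_open :: "'i set \<Rightarrow> ('i, 'k::field) mpoly \<Rightarrow> ('i, 'k) point set" where
  "basic_open J P = {proj a | a. a \<in> nzvecs J \<and> eval P (Poly_Mapping.lookup a) \<noteq> 0}"

text \<open>The sets \<open>basic_open J P\<close>, for \<open>P\<close> homogeneous, are a basis of the Zariski topology.\<close>

definition zariski :: "'i set \<Rightarrow> ('i, 'k::field) point topology" where
  "zariski J = topology_generated_by {basic_open J P | P d. P \<in> forms J d}"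

definition irreducible_in :: "'a topology \<Rightarrow> 'a set \<Rightarrow> bool" where
  "irreducible_in T X \<longleftrightarrow> X \<subseteq> topspace T \<and> X \<noteq> {} \<and>
     (\<forall>A B. closedin T A \<longrightarrow> closedin T B \<longrightarrow> X \<subseteq> A \<union> B \<longrightarrow> X \<subseteq> A \<or> X \<subseteq> B)"

definition proj_variety :: "'i set \<Rightarrow> ('i, 'k::field) point set \<Rightarrow> bool" where
  "proj_variety J X \<longleftrightarrow> closedin (zariski J) X \<and> irreducible_in (zariski J) X"


section \<open>Rational and birational maps\<close>

text \<open>
  A morphism on \<open>U\<close> is locally of the form \<open>[a] \<mapsto> [G\<^sub>j(a)]\<^sub>j\<close> with forms \<open>G\<^sub>j\<close> of a common degree
  that do not vanish simultaneously.
\<close>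

definition morphism_on ::
    "'i set \<Rightarrow> 'j set \<Rightarrow> ('i, 'k::field) point set \<Rightarrow> (('i, 'k) point \<Rightarrow> ('j, 'k) point) \<Rightarrow> bool" where
  "morphism_on I J U \<phi> \<longleftrightarrow>
     (\<forall>p\<in>U. \<exists>W e G. openin (zariski I) W \<and> p \<in> W \<and> (\<forall>j\<in>J. G j \<in> forms I e) \<and>
        (\<forall>a\<in>nzvecs I. proj a \<in> U \<inter> W \<longrightarrow>
           (\<exists>b\<in>nzvecs J. (\<forall>j\<in>J. Poly_Mapping.lookup b j = eval (G j) (Poly_Mapping.lookup a)) \<and>
              \<phi> (proj a) = proj b)))"

text \<open>
  A rational map from \<open>X\<close> to \<open>Y\<close> is given by a representative, that is, a morphism \<open>\<phi>\<close> on a nonempty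
  (hence dense) open subset \<open>U\<close> of \<open>X\<close>; the values of \<open>\<phi>\<close> outside \<open>U\<close> are irrelevant.
\<close>

definition rational_map ::
    "'i set \<Rightarrow> ('i, 'k::field) point set \<Rightarrow> 'j set \<Rightarrow> ('j, 'k) point set \<Rightarrow>
     ('i, 'k) point set \<Rightarrow> (('i, 'k) point \<Rightarrow> ('j, 'k) point) \<Rightarrow> bool" where
  "rational_map I X J Y U \<phi> \<longleftrightarrow>
     proj_variety I X \<and> proj_variety J Y \<and>
     openin (subtopology (zariski I) X) U \<and> U \<noteq> {} \<and>
     morphism_on I J U \<phi> \<and> \<phi> ` U \<subseteq> Y"

text \<open>\<open>\<psi> \<circ> \<phi>\<close> is defined on, and is the identity on, some nonempty open subset of \<open>X\<close>.\<close>

definition rational_left_inverse ::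
    "'i set \<Rightarrow> ('i, 'k::field) point set \<Rightarrow>
     ('i, 'k) point set \<Rightarrow> (('i, 'k) point \<Rightarrow> ('j, 'k) point) \<Rightarrow>
     ('j, 'k) point set \<Rightarrow> (('j, 'k) point \<Rightarrow> ('i, 'k) point) \<Rightarrow> bool" where
  "rational_left_inverse I X U \<phi> V \<psi> \<longleftrightarrow>
     (\<exists>W. openin (subtopology (zariski I) X) W \<and> W \<noteq> {} \<and> W \<subseteq> U \<and> \<phi> ` W \<subseteq> V \<and>
        (\<forall>p\<in>W. \<psi> (\<phi> p) = p))"

definition birational_map ::
    "'i set \<Rightarrow> ('i, 'k::field) point set \<Rightarrow> 'j set \<Rightarrow> ('j, 'k) point set \<Rightarrow>
     ('i, 'k) point set \<Rightarrow> (('i, 'k) point \<Rightarrow> ('j, 'k) point) \<Rightarrow> bool" where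
  "birational_map I X J Y U \<phi> \<longleftrightarrow>
     rational_map I X J Y U \<phi> \<and>
     (\<exists>V \<psi>. rational_map J Y I X V \<psi> \<and>
        rational_left_inverse I X U \<phi> V \<psi> \<and> rational_left_inverse J Y V \<psi> U \<phi>)"

text \<open>The image of a rational map is the closure of the image of its domain.\<close>

definition birational_onto_image ::
    "'i set \<Rightarrow> ('i, 'k::field) point set \<Rightarrow> 'j set \<Rightarrow>
     ('i, 'k) point set \<Rightarrow> (('i, 'k) point \<Rightarrow> ('j, 'k) point) \<Rightarrow> bool" where
  "birational_onto_image I X J U \<phi> \<longleftrightarrow>
     birational_map I X J (zariski J closure_of (\<phi> ` U)) U \<phi>"


section \<open>Hypersurfaces and the Hessian map\<close>

text \<open>\<open>\<Sigma>(d,r)\<close>, where \<open>CARD('n) = r + 1\<close>: the hypersurfaces of degree \<open>d\<close> in projective \<open>r\<close>-space.\<close>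

definition hypersurfaces :: "nat \<Rightarrow> ('n::finite monomial, 'k::field) point set" where
  "hypersurfaces d = proj_space (monomials UNIV d)"

text \<open>\<open>Hess\<close> does not depend on the choice of equation, see \<open>Hess_proj\<close> below.\<close>

definition Hess :: "('n::finite monomial, 'k::field) point \<Rightarrow> ('n monomial, 'k) point" where
  "Hess F = (\<Union>f\<in>F. proj (hess f))"

definition hess_domain :: "nat \<Rightarrow> ('n::finite monomial, 'k::field) point set" where
  "hess_domain d = {proj f | f. f \<in> nzvecs (monomials UNIV d) \<and> hess f \<noteq> 0}"

lemma pdiff_scale:
  assumes "c \<noteq> (0 :: 'k::field)"
  shows "pdiff v (Poly_Mapping.map ((*) c) f) = Poly_Mapping.map ((*) c) (pdiff v f)"
proof -
  have *: "Poly_Mapping.keys (Poly_Mapping.map ((*) c) f) = Poly_Mapping.keys f"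
    using assms by (auto simp: in_keys_iff Poly_Mapping.map.rep_eq when_def)
  have **: "Poly_Mapping.lookup (Poly_Mapping.map ((*) c) f) m = c * Poly_Mapping.lookup f m" for m
    by (simp add: Poly_Mapping.map.rep_eq when_def)
  show ?thesis
    unfolding mult_map_scale_conv_mult[of c "pdiff v f"]
    unfolding pdiff_def * ** sum_distrib_left
    by (intro sum.cong refl) (simp add: mult_single mult_ac)
qed

lemma hess_scale:
  fixes f :: "('n::finite, 'k::field) mpoly"
  assumes "c \<noteq> 0"
  shows "hess (Poly_Mapping.map ((*) c) f) = Poly_Mapping.map ((*) (c ^ CARD('n))) (hess f)"
proof -
  have pow: "Poly_Mapping.single 0 c ^ k = (Poly_Mapping.single 0 (c ^ k) :: ('n, 'k) mpoly)" for k
    by (induction k) (simp_all add: mult_single)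
  have entry: "pdiff i (pdiff j (Poly_Mapping.map ((*) c) f)) = Poly_Mapping.single 0 c * pdiff i (pdiff j f)"
    for i j
    by (simp only: pdiff_scale[OF assms] mult_map_scale_conv_mult[of c "pdiff i (pdiff j f)"])
  have "hess (Poly_Mapping.map ((*) c) f) =
      det (\<chi> i. Poly_Mapping.single 0 c *s (\<chi> j. pdiff i (pdiff j f)))"
    unfolding hess_def entry by (rule arg_cong[where f = det]) (simp add: vec_eq_iff)
  also have "\<dots> = Poly_Mapping.single 0 (c ^ CARD('n)) * hess f"
    by (subst det_rows_mul) (simp add: hess_def pow)
  finally show ?thesis by (simp add: mult_map_scale_conv_mult)
qed

lemma proj_scale:
  assumes "c \<noteq> (0 :: 'k::field)"
  shows "proj (Poly_Mapping.map ((*) c) a) = proj a"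
proof -
  have comp: "Poly_Mapping.map ((*) x) (Poly_Mapping.map ((*) y) a) = Poly_Mapping.map ((*) (x * y)) a"
    for x y by (intro poly_mapping_eqI) (auto simp: Poly_Mapping.map.rep_eq when_def mult_ac)
  show ?thesis
  proof (intro equalityI subsetI)
    fix b assume "b \<in> proj (Poly_Mapping.map ((*) c) a)"
    then show "b \<in> proj a" using assms by (auto simp: proj_def comp)
  next
    fix b assume "b \<in> proj a"
    then obtain x where "b = Poly_Mapping.map ((*) x) a" "x \<noteq> 0" by (auto simp: proj_def)
    then show "b \<in> proj (Poly_Mapping.map ((*) c) a)"
      using assms by (auto simp: proj_def comp intro!: exI[of _ "x / c"])
  qed
qed

lemma Hess_proj: "Hess (proj f) = proj (hess f)"
proof -
  have "proj (hess g) = proj (hess f)" if "g \<in> proj f" for g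
    using that by (auto simp: proj_def[of f] hess_scale proj_scale)
  moreover have "proj f \<noteq> {}" by (auto simp: proj_def intro: exI[of _ 1])
  ultimately show ?thesis by (auto simp: Hess_def)
qed

lemma topspace_zariski: "topspace (zariski J) = proj_space J"
proof -
  have "(1 :: ('a, 'b) mpoly) \<in> forms J 0"
    by (simp add: forms_def monomials_def mdegree_def)
  moreover have "basic_open J 1 = proj_space J"
    by (auto simp: basic_open_def proj_space_def eval_def)
  moreover have "basic_open J P \<subseteq> proj_space J" for P
    by (auto simp: basic_open_def proj_space_def)
  ultimately show ?thesis
    unfolding zariski_def topology_generated_by_topspace by blast
qed

end

theory Submission
  imports Defs "HOL-Computational_Algebra.Polynomial_Factorial"
begin

text \<open>
  A general cubic is a Sylvester cubic \<open>f = \<Sum> l\<^sub>i\<^sup>3\<close> with five linear forms. If \<open>\<Sum> b\<^sub>i l\<^sub>i = 0\<close> is their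
  relation, then \<open>hess f\<close> is, up to a constant, \<open>\<Sum> b\<^sub>i\<^sup>2 \<Prod>\<^sub>j\<^sub>\<noteq>\<^sub>i l\<^sub>j\<close>. For general \<open>b\<close> the singular points of
  this quartic are exactly the ten vertices of the pentahedron of the \<open>l\<^sub>i\<close>, and the faces of the
  pentahedron are the planes that contain six of them. So the Hessian determines the \<open>l\<^sub>i\<close> up to order
  and factors, and then it determines \<open>f\<close> up to a factor.

  Let \<open>K\<close> be the function field of the space of quintuples of linear forms, let \<open>L\<close> be the subfield
  generated by the coefficients of the Hessian, and let \<open>t\<close> be a ratio of coefficients of the generic
  \<open>f\<close>. If \<open>1 \<otimes> t - t \<otimes> 1\<close> were not nilpotent in \<open>K \<otimes>\<^sub>L K\<close>, a residue field of this ring would contain two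
  Sylvester cubics with the same Hessian that are not proportional. It is therefore nilpotent, and
  since \<open>K\<close> has characteristic zero, \<open>t\<close> lies in \<open>L\<close>. Hence the coefficients of \<open>f\<close> are rational functions
  of those of \<open>hess f\<close>; this is an identity of polynomials, which extends from Sylvester cubics, a dense
  set, to all cubics.
\<close>

section \<open>Polynomials\<close>

\<comment> \<open>The two cubics that are compared are the generic one over \<open>K\<close> and one
  with indeterminate data modulo a prime. Their common field is beyond control, so uniqueness of the
  pentahedron is proved over every field of characteristic zero. The tensor square itself is not
  built: polynomials over \<open>K\<close> are taken modulo those killed by functionals obtained
  from one \<open>L\<close>-linear retraction of \<open>K\<close> onto \<open>L\<close>.

  For \<open>b\<close> to be general has a concrete meaning. A singular point off all faces
  satisfies \<open>(b_m v_m)^2 = s b_m^3\<close> with a common \<open>s\<close>, so the relation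
  becomes a vanishing signed sum of square roots of the \<open>b_m^3\<close>. Finitely many sign
  patterns have to be excluded, and the generic point avoids them because the sums are odd integers
  when all \<open>b_m\<close> are \<open>1\<close>.

  The pentahedron alone leaves a free factor for each of the five forms. Comparing the Hessians on
  the faces shows that the cubes of these factors agree, which is what makes the cubic unique up to
  one factor. Only ratios of coefficients descend, hence the fixed denominator
  \<open>cube1\<close>.\<close>
alias lookup = Poly_Mapping.lookup
alias keys = Poly_Mapping.keys
alias single = Poly_Mapping.single

definition ring_hom :: "('a::comm_ring_1 \<Rightarrow> 'b::comm_ring_1) \<Rightarrow> bool" where
  "ring_hom h \<longleftrightarrow> h 1 = 1 \<and> (\<forall>x y. h (x + y) = h x + h y) \<and> (\<forall>x y. h (x * y) = h x * h y)"

lemma ring_hom_add: "ring_hom h \<Longrightarrow> h (x + y) = h x + h y"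
  and ring_hom_mult: "ring_hom h \<Longrightarrow> h (x * y) = h x * h y"
  and ring_hom_1: "ring_hom h \<Longrightarrow> h 1 = 1"
  by (simp_all add: ring_hom_def)

lemma ring_hom_0:
  assumes "ring_hom h" shows "h 0 = 0"
  using ring_hom_add[OF assms, of 0 0] by simp

lemma ring_hom_uminus:
  assumes "ring_hom h" shows "h (- x) = - h x"
  using ring_hom_add[OF assms, of x "- x"] ring_hom_0[OF assms] by (simp add: eq_neg_iff_add_eq_0 add.commute)

lemma ring_hom_diff: "ring_hom h \<Longrightarrow> h (x - y) = h x - h y"
  using ring_hom_add[of h x "- y"] ring_hom_uminus[of h y] by simp

lemma ring_hom_sum: "ring_hom h \<Longrightarrow> h (sum f A) = (\<Sum>a\<in>A. h (f a))"
  by (induction A rule: infinite_finite_induct) (simp_all add: ring_hom_0 ring_hom_add)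

lemma ring_hom_prod: "ring_hom h \<Longrightarrow> h (prod f A) = (\<Prod>a\<in>A. h (f a))"
  by (induction A rule: infinite_finite_induct) (simp_all add: ring_hom_1 ring_hom_mult)

lemma ring_hom_power: "ring_hom h \<Longrightarrow> h (x ^ n) = h x ^ n"
  by (induction n) (simp_all add: ring_hom_1 ring_hom_mult)

lemma ring_hom_of_nat: "ring_hom h \<Longrightarrow> h (of_nat n) = of_nat n"
  by (induction n) (simp_all add: ring_hom_0 ring_hom_1 ring_hom_add)

lemma ring_hom_of_int: "ring_hom h \<Longrightarrow> h (of_int n) = of_int n"
  by (cases n rule: int_diff_cases) (simp add: ring_hom_diff ring_hom_of_nat)

lemma ring_hom_numeral: "ring_hom h \<Longrightarrow> h (numeral n) = numeral n"
  using ring_hom_of_nat[of h "numeral n"] by simp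

lemmas ring_hom_simps = ring_hom_add ring_hom_mult ring_hom_1 ring_hom_0 ring_hom_uminus ring_hom_diff
  ring_hom_sum ring_hom_prod ring_hom_power ring_hom_of_nat ring_hom_of_int ring_hom_numeral

lemma ring_hom_id: "ring_hom (\<lambda>x. x)"
  by (simp add: ring_hom_def)

lemma ring_hom_comp: "ring_hom g \<Longrightarrow> ring_hom h \<Longrightarrow> ring_hom (\<lambda>x. g (h x))"
  by (simp add: ring_hom_def)

lemma ring_hom_det:
  assumes "ring_hom h"
  shows "h (det A) = det (\<chi> i j. h (A $ i $ j))"
  by (simp add: det_def ring_hom_simps[OF assms])

abbreviation (input) Const :: "'a::zero \<Rightarrow> ('v, 'a) mpoly" where
  "Const c \<equiv> single 0 c"

abbreviation (input) Var :: "'v \<Rightarrow> ('v, 'a::comm_ring_1) mpoly" where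
  "Var v \<equiv> single (single v 1) 1"

lemma ring_hom_Const: "ring_hom (Const :: 'a::comm_ring_1 \<Rightarrow> ('v, 'a) mpoly)"
  by (simp add: ring_hom_def single_add mult_single)

lemma poly_mapping_sum_singles:
  fixes p :: "'m \<Rightarrow>\<^sub>0 'a::comm_monoid_add"
  shows "p = (\<Sum>m\<in>keys p. single m (lookup p m))"
  by (rule poly_mapping_eqI)
    (simp add: lookup_sum lookup_single when_def sum.delta in_keys_iff)

lemma poly_mapping_single_induct [case_names zero single]:
  fixes p :: "'m \<Rightarrow>\<^sub>0 'a::comm_monoid_add"
  assumes "P 0" "\<And>m a p. P p \<Longrightarrow> P (single m a + p)"
  shows "P p"
proof -
  have "P (\<Sum>m\<in>A. single m (lookup p m))" if "finite A" for A
    using that by induction (auto intro: assms)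
  from this[of "keys p"] show ?thesis using poly_mapping_sum_singles[of p] by simp
qed

section \<open>Evaluation along a homomorphism of coefficient rings\<close>

definition monom_eval :: "'v monomial \<Rightarrow> ('v \<Rightarrow> 'a::comm_semiring_1) \<Rightarrow> 'a" where
  "monom_eval m x = (\<Prod>v\<in>keys m. x v ^ lookup m v)"

lemma monom_eval_superset:
  assumes "finite A" "keys m \<subseteq> A"
  shows "monom_eval m x = (\<Prod>v\<in>A. x v ^ lookup m v)"
  unfolding monom_eval_def using assms by (intro prod.mono_neutral_left) (auto simp: in_keys_iff)

lemma monom_eval_0 [simp]: "monom_eval 0 x = 1"
  by (simp add: monom_eval_def)

lemma monom_eval_single [simp]: "monom_eval (single v k) x = x v ^ k"
  by (simp add: monom_eval_def)

lemma monom_eval_add: "monom_eval (m + n) x = monom_eval m x * monom_eval n x"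
proof -
  let ?A = "keys m \<union> keys n"
  have "monom_eval (m + n) x = (\<Prod>v\<in>?A. x v ^ lookup (m + n) v)"
    by (rule monom_eval_superset) (auto simp: Poly_Mapping.keys_add)
  then show ?thesis
    by (simp add: monom_eval_superset[of ?A m] monom_eval_superset[of ?A n] lookup_add power_add prod.distrib)
qed

text \<open>Coefficients are moved along \<open>h\<close> before values are inserted. One notion
  thus serves for ordinary evaluation, for substitution of polynomials (\<open>h = Const\<close>)
  and for restriction to a parametrised curve (\<open>h c = [:c:]\<close>).\<close>

definition evalh :: "('a \<Rightarrow> 'b::comm_semiring_1) \<Rightarrow> ('v, 'a::zero) mpoly \<Rightarrow> ('v \<Rightarrow> 'b) \<Rightarrow> 'b" where
  "evalh h p x = (\<Sum>m\<in>keys p. h (lookup p m) * monom_eval m x)"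

lemma eval_eq_evalh: "eval p x = evalh (\<lambda>c. c) p x"
  by (simp add: eval_def evalh_def monom_eval_def)

lemma evalh_superset:
  assumes "finite A" "keys p \<subseteq> A" "h 0 = 0"
  shows "evalh h p x = (\<Sum>m\<in>A. h (lookup p m) * monom_eval m x)"
  unfolding evalh_def using assms by (intro sum.mono_neutral_left) (auto simp: in_keys_iff)

context
  fixes h :: "'a::comm_ring_1 \<Rightarrow> 'b::comm_ring_1"
  assumes h: "ring_hom h"
begin

lemma evalh_add: "evalh h (p + q) x = evalh h p x + evalh h q x"
proof -
  let ?A = "keys p \<union> keys q"
  have "evalh h (p + q) x = (\<Sum>m\<in>?A. h (lookup (p + q) m) * monom_eval m x)"
    by (rule evalh_superset) (auto simp: Poly_Mapping.keys_add ring_hom_0[OF h])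
  then show ?thesis
    by (simp add: evalh_superset[of ?A p] evalh_superset[of ?A q] lookup_add ring_hom_simps[OF h]
      distrib_right sum.distrib)
qed

lemma evalh_single: "evalh h (single m a) x = h a * monom_eval m x"
  using evalh_superset[of "{m}" "single m a" h x] by (simp add: ring_hom_0[OF h])

lemma evalh_Const: "evalh h (Const a) x = h a"
  by (simp add: evalh_single)

lemma evalh_Var: "evalh h (Var v) x = x v"
  by (simp add: evalh_single ring_hom_1[OF h])

lemma ring_hom_evalh: "ring_hom (\<lambda>p. evalh h p x)"
proof -
  have *: "evalh h (single m a * q) x = evalh h (single m a) x * evalh h q x"
    for m a and q :: "('c, 'a) mpoly"
    by (induction q rule: poly_mapping_single_induct)
      (simp_all add: evalh_add evalh_single mult_single monom_eval_add ring_hom_simps[OF h] algebra_simps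
        evalh_def[of h 0])
  have "evalh h (p * q) x = evalh h p x * evalh h q x" for p q
    by (induction p rule: poly_mapping_single_induct)
      (simp_all add: evalh_add distrib_right * evalh_def[of h 0])
  moreover have "evalh h 1 x = 1"
    using evalh_Const[of 1 x] by (simp add: ring_hom_1[OF h])
  ultimately show ?thesis by (simp add: ring_hom_def evalh_add)
qed

lemmas evalh_simps = ring_hom_simps[OF ring_hom_evalh] evalh_single

end

lemma ring_hom_eval: "ring_hom (\<lambda>p. eval p x)"
  unfolding eval_eq_evalh by (rule ring_hom_evalh[OF ring_hom_id])

lemma eval_single: "eval (single m a) x = (a::'a::comm_ring_1) * monom_eval m x"
  unfolding eval_eq_evalh by (rule evalh_single[OF ring_hom_id])

lemma eval_Var: "eval (Var v) x = x v"
  by (simp add: eval_single)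

lemma eval_Const: "eval (Const c) x = (c::'a::comm_ring_1)"
  by (simp add: eval_single)

lemmas eval_simps = ring_hom_simps[OF ring_hom_eval] eval_single

lemma ring_hom_monom_eval:
  "ring_hom h \<Longrightarrow> h (monom_eval m x) = monom_eval m (\<lambda>v. h (x v))"
  by (simp add: monom_eval_def ring_hom_simps)

lemma ring_hom_of_evalh:
  "ring_hom g \<Longrightarrow> g (evalh h p x) = evalh (\<lambda>c. g (h c)) p (\<lambda>v. g (x v))"
  by (simp add: evalh_def ring_hom_simps ring_hom_monom_eval)

section \<open>Change of coefficients\<close>

definition map_coeffs :: "('a::zero \<Rightarrow> 'b::zero) \<Rightarrow> ('v, 'a) mpoly \<Rightarrow> ('v, 'b) mpoly" where
  "map_coeffs h = Poly_Mapping.map h"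

lemma lookup_map_coeffs:
  "h 0 = 0 \<Longrightarrow> lookup (map_coeffs h p) m = h (lookup p m)"
  by (simp add: map_coeffs_def Poly_Mapping.map.rep_eq when_def)

lemma map_coeffs_single: "h 0 = 0 \<Longrightarrow> map_coeffs h (single m a) = single m (h a)"
  by (rule poly_mapping_eqI) (simp add: lookup_map_coeffs lookup_single when_def)

lemma ring_hom_map_coeffs:
  assumes h: "ring_hom h"
  shows "ring_hom (map_coeffs h)"
proof -
  note 0 = ring_hom_0[OF h]
  have add: "map_coeffs h (p + q) = map_coeffs h p + map_coeffs h q" for p q :: "('v, 'a) mpoly"
    by (rule poly_mapping_eqI) (simp add: lookup_map_coeffs[of h, OF 0] lookup_add ring_hom_add[OF h])
  have z: "map_coeffs h 0 = 0"
    by (rule poly_mapping_eqI) (simp add: lookup_map_coeffs[of h, OF 0] 0)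
  have *: "map_coeffs h (single m a * q) = map_coeffs h (single m a) * map_coeffs h q"
    for m a and q :: "('v, 'a) mpoly"
    by (induction q rule: poly_mapping_single_induct)
      (simp_all add: add z map_coeffs_single[of h, OF 0] mult_single ring_hom_mult[OF h] distrib_left)
  have "map_coeffs h (p * q) = map_coeffs h p * map_coeffs h q" for p q :: "('v, 'a) mpoly"
    by (induction p rule: poly_mapping_single_induct) (simp_all add: add z distrib_right *)
  moreover have "map_coeffs h 1 = 1"
    using map_coeffs_single[of h 0 1, OF 0] by (simp add: ring_hom_1[OF h])
  ultimately show ?thesis unfolding ring_hom_def using add by blast
qed

subsection \<open>Partial derivatives\<close>

lemma lookup_pdiff:
  "lookup (pdiff v f) m =
     of_nat (lookup m v + 1) * lookup f (m + single v 1)"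
proof -
  let ?e = "single v (1::nat)"
  \<comment> \<open>A monomial without \<open>v\<close> is fixed by the truncated subtraction, so
    \<open>n = m\<close> could be a second solution; the condition on \<open>lookup n v\<close>
    excludes it.\<close>
  have *: "n - ?e = m \<and> lookup n v \<noteq> 0 \<longleftrightarrow> n = m + ?e" for n
    by (auto simp: poly_mapping_eq_iff fun_eq_iff lookup_add lookup_minus lookup_single when_def split:
        if_splits)
  have "lookup (pdiff v f) m = (\<Sum>n\<in>keys f.
      if n = m + ?e then of_nat (lookup n v) * lookup f n else 0)"
    unfolding pdiff_def lookup_sum
  proof (intro sum.cong refl)
    fix n
    show "lookup (single (n - ?e) (of_nat (lookup n v) * lookup f n)) m =
      (if n = m + ?e then of_nat (lookup n v) * lookup f n else 0)"
      using *[of n] by (cases "lookup n v = 0"; cases "n - ?e = m") (simp_all add: lookup_single)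
  qed
  also have "\<dots> = of_nat (lookup m v + 1) * lookup f (m + ?e)"
    by (simp add: sum.delta in_keys_iff lookup_add)
  finally show ?thesis .
qed

lemma pdiff_add: "pdiff v (f + g) = pdiff v f + pdiff v g"
  by (rule poly_mapping_eqI) (simp add: lookup_pdiff lookup_add algebra_simps)

lemma pdiff_0: "pdiff v 0 = 0"
  by (rule poly_mapping_eqI) (simp add: lookup_pdiff)

lemma pdiff_sum: "pdiff v (sum f A) = (\<Sum>a\<in>A. pdiff v (f a))"
  by (induction A rule: infinite_finite_induct) (simp_all add: pdiff_0 pdiff_add)

lemma pdiff_single:
  "pdiff v (single m a) =
     single (m - single v 1) (of_nat (lookup m v) * a)"
  by (simp add: pdiff_def)

lemma pdiff_mult:
  fixes f g :: "('v, 'a::comm_ring_1) mpoly"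
  shows "pdiff v (f * g) = pdiff v f * g + f * pdiff v g"
proof -
  let ?e = "single v (1::nat)"
  have e: "m - ?e + n = m + n - ?e" if "lookup m v \<noteq> 0" for m n :: "'v monomial"
    using that by (intro poly_mapping_eqI) (auto simp: lookup_add lookup_minus lookup_single when_def)
  have s: "pdiff v (single m a * single n b) =
      pdiff v (single m a) * single n b +
      single m a * pdiff v (single n b)" for m n and a b :: 'a
  proof (cases "lookup m v = 0")
    case True
    have "m + (n - ?e) = m + n - ?e" if "lookup n v \<noteq> 0"
      using e[OF that, of m] by (simp add: add.commute)
    with True show ?thesis
      by (cases "lookup n v = 0") (simp_all add: pdiff_single mult_single lookup_add mult.left_commute)
  next
    case False
    have "m + (n - ?e) = m + n - ?e" if "lookup n v \<noteq> 0"
      using e[OF that, of m] by (simp add: add.commute)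
    with e[OF False, of n] show ?thesis
      by (cases "lookup n v = 0")
        (simp_all add: pdiff_single mult_single lookup_add single_add[symmetric] algebra_simps)
  qed
  have *: "pdiff v (single m a * q) =
      pdiff v (single m a) * q + single m a * pdiff v q"
    for m a and q :: "('v, 'a) mpoly"
    by (induction q rule: poly_mapping_single_induct) (simp_all add: pdiff_0 pdiff_add s algebra_simps)
  show ?thesis
    by (induction f rule: poly_mapping_single_induct) (simp_all add: pdiff_0 pdiff_add * distrib_left
        distrib_right add_ac)
qed

lemma map_coeffs_pdiff:
  assumes "ring_hom h"
  shows "map_coeffs h (pdiff v f) = pdiff v (map_coeffs h f)"
  by (rule poly_mapping_eqI)
    (simp add: lookup_map_coeffs[of h, OF ring_hom_0[OF assms]] lookup_pdiff ring_hom_simps[OF assms]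
        del: of_nat_Suc)

text \<open>Derivatives and determinants are polynomial expressions with integer coefficients, so
  they commute with base change. This lets the Hessian of generic data specialise to every field and
  residue ring in use.\<close>

lemma map_coeffs_hess:
  assumes "ring_hom h"
  shows "map_coeffs h (hess f) = hess (map_coeffs h f)"
  unfolding hess_def
  by (simp add: ring_hom_det[OF ring_hom_map_coeffs[OF assms]] map_coeffs_pdiff[OF assms])

subsection \<open>Homogeneous polynomials\<close>

lemma mdegree_superset:
  assumes "finite A" "keys m \<subseteq> A"
  shows "mdegree m = (\<Sum>v\<in>A. lookup m v)"
  unfolding mdegree_def using assms by (intro sum.mono_neutral_left) (auto simp: in_keys_iff)

lemma mdegree_add: "mdegree (m + n) = mdegree m + mdegree n"
proof -
  let ?A = "keys m \<union> keys n"
  have "mdegree (m + n) = (\<Sum>v\<in>?A. lookup (m + n) v)"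
    by (rule mdegree_superset) (auto simp: Poly_Mapping.keys_add)
  then show ?thesis
    by (simp add: mdegree_superset[of ?A m] mdegree_superset[of ?A n] lookup_add sum.distrib)
qed

lemma mdegree_single [simp]: "mdegree (single v k) = k"
  by (simp add: mdegree_def)

lemma mdegree_0 [simp]: "mdegree 0 = 0"
  by (simp add: mdegree_def)

lemma mdegree_UNIV: "mdegree (m :: 'v::finite monomial) = (\<Sum>v\<in>UNIV. lookup m v)"
  by (rule mdegree_superset) auto

lemma finite_monomials: "finite (monomials (UNIV :: 'v::finite set) d)"
proof (rule finite_imageD)
  have "lookup ` monomials (UNIV :: 'v set) d \<subseteq> Pi\<^sub>E UNIV (\<lambda>_. {..d})"
  proof safe
    fix m :: "'v monomial" and v assume "m \<in> monomials UNIV d"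
    then have "(\<Sum>v\<in>UNIV. lookup m v) = d" by (simp add: monomials_def mdegree_UNIV)
    then show "lookup m v \<le> d" using member_le_sum[of v UNIV "lookup m"] by simp
  qed auto
  moreover have "finite (Pi\<^sub>E (UNIV :: 'v set) (\<lambda>_. {..d}))" by (rule finite_PiE) auto
  ultimately show "finite (lookup ` monomials (UNIV :: 'v set) d)" by (rule finite_subset)
qed (simp add: inj_on_def poly_mapping.lookup_inject)

lemma formsD: "f \<in> forms J d \<Longrightarrow> lookup f m \<noteq> 0 \<Longrightarrow> m \<in> monomials J d"
  and formsI: "(\<And>m. lookup f m \<noteq> 0 \<Longrightarrow> m \<in> monomials J d) \<Longrightarrow> f \<in> forms J d"
  by (auto simp: forms_def in_keys_iff)

lemma forms_0 [simp]: "0 \<in> forms J d"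
  by (simp add: forms_def)

lemma forms_add: "f \<in> forms J d \<Longrightarrow> g \<in> forms J d \<Longrightarrow> f + g \<in> forms J d"
  using Poly_Mapping.keys_add[of f g] by (auto simp: forms_def)

lemma forms_uminus: "f \<in> forms J d \<Longrightarrow> - f \<in> forms J (d::nat)" for f :: "('v, 'a::comm_ring_1) mpoly"
  by (auto intro!: formsI dest: formsD)

lemma forms_diff: "f \<in> forms J d \<Longrightarrow> g \<in> forms J d \<Longrightarrow> f - g \<in> forms J d" for f :: "('v, 'a::comm_ring_1) mpoly"
  using forms_add[of f J d "- g"] forms_uminus[of g] by simp

lemma forms_sum: "(\<And>a. a \<in> A \<Longrightarrow> f a \<in> forms J d) \<Longrightarrow> sum f A \<in> forms J d"
  by (induction A rule: infinite_finite_induct) (simp_all add: forms_add)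

lemma monomials_add: "m \<in> monomials J d \<Longrightarrow> n \<in> monomials J e \<Longrightarrow> m + n \<in> monomials J (d + e)"
  using Poly_Mapping.keys_add[of m n] by (auto simp: monomials_def mdegree_add)

lemma forms_mult: "f \<in> forms J d \<Longrightarrow> g \<in> forms J e \<Longrightarrow> f * g \<in> forms J (d + e)"
  using Poly_Mapping.keys_mult[of f g] monomials_add[of _ J d _ e] by (fastforce simp: forms_def)

lemma forms_single: "m \<in> monomials J d \<Longrightarrow> single m a \<in> forms J d"
  by (simp add: forms_def)

lemma forms_Const: "Const c \<in> forms J 0"
  by (simp add: forms_single monomials_def)

lemma forms_1: "(1 :: ('v, 'a::comm_ring_1) mpoly) \<in> forms J 0"
  using forms_Const[of "1::'a" J] by simp

lemma forms_Var: "v \<in> J \<Longrightarrow> Var v \<in> forms J 1"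
  by (simp add: forms_single monomials_def)

lemma forms_power: "(f :: ('v, 'a::comm_ring_1) mpoly) \<in> forms J d \<Longrightarrow> f ^ n \<in> forms J (n * d)"
  by (induction n) (simp_all add: forms_1 forms_mult)

lemma forms_prod:
  fixes f :: "'i \<Rightarrow> ('v, 'a::comm_ring_1) mpoly"
  shows "finite A \<Longrightarrow> (\<And>a. a \<in> A \<Longrightarrow> f a \<in> forms J (d a)) \<Longrightarrow> prod f A \<in> forms J (sum d A)"
  by (induction A rule: finite_induct) (simp_all add: forms_1 forms_mult)

lemma forms_of_nat_mult: "f \<in> forms J d \<Longrightarrow> of_nat n * f \<in> forms J d"
  using forms_mult[OF forms_Const, of f J d "of_nat n"] by simp

lemma forms_pdiff: "f \<in> forms J (Suc d) \<Longrightarrow> pdiff v f \<in> forms J d"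
proof (rule formsI)
  fix m assume f: "f \<in> forms J (Suc d)" and "lookup (pdiff v f) m \<noteq> 0"
  then have "lookup f (m + single v 1) \<noteq> 0" by (auto simp: lookup_pdiff)
  with f have "m + single v 1 \<in> monomials J (Suc d)" by (rule formsD)
  then show "m \<in> monomials J d"
    by (auto simp: monomials_def mdegree_add in_keys_iff subset_iff lookup_add)
qed

lemma forms_det:
  fixes A :: "('v, 'a::comm_ring_1) mpoly ^ 'n ^ 'n"
  assumes "\<And>i j. A $ i $ j \<in> forms J d"
  shows "det A \<in> forms J (CARD('n) * d)"
  unfolding det_def
proof (rule forms_sum)
  fix p assume "p \<in> {p. p permutes (UNIV :: 'n set)}"
  have 1: "(\<Prod>i\<in>UNIV. A $ i $ p i) \<in> forms J (CARD('n) * d)"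
    using forms_prod[of UNIV "\<lambda>i. A $ i $ p i" J "\<lambda>_. d"] assms by simp
  have "(of_int (sign p) :: ('v, 'a) mpoly) \<in> forms J 0"
    using forms_Const[of "of_int (sign p) :: 'a" J] by simp
  from forms_mult[OF this 1] show "of_int (sign p) * (\<Prod>i\<in>UNIV. A $ i $ p i) \<in> forms J (CARD('n) * d)"
    by simp
qed

lemma forms_hess:
  fixes f :: "('n::finite, 'k::comm_ring_1) mpoly"
  assumes "f \<in> forms UNIV (d + 2)"
  shows "hess f \<in> forms UNIV (CARD('n) * d)"
  unfolding hess_def by (rule forms_det) (use assms in \<open>simp add: forms_pdiff\<close>)

lemma monom_eval_scale:
  "m \<in> monomials J d \<Longrightarrow> monom_eval m (\<lambda>v. c * x v) = c ^ d * monom_eval m x"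
  by (simp add: monom_eval_def power_mult_distrib prod.distrib monomials_def mdegree_def flip: power_sum)

lemma evalh_scale:
  assumes "p \<in> forms J d"
  shows "evalh h p (\<lambda>v. c * x v) = c ^ d * evalh h p x"
  unfolding evalh_def sum_distrib_left
  by (intro sum.cong refl)
    (use assms in \<open>auto simp: in_keys_iff mult_ac monom_eval_scale dest!: formsD\<close>)

lemma eval_scale: "p \<in> forms J d \<Longrightarrow> eval p (\<lambda>v. c * x v) = c ^ d * eval p x"
  unfolding eval_eq_evalh by (rule evalh_scale)

lemma evalh_cong:
  assumes "\<And>v. v \<in> J \<Longrightarrow> x v = y v" "p \<in> forms J d"
  shows "evalh h p x = evalh h p y"
  unfolding evalh_def monom_eval_def
  by (intro sum.cong refl arg_cong2[where f = "(*)"] prod.cong arg_cong2[where f = "(^)"])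
    (use assms in \<open>auto simp: forms_def monomials_def\<close>)

section \<open>Sylvester pentahedra\<close>

lemma card_2_other:
  fixes a c :: "'i::finite"
  assumes "CARD('i) = 5"
  shows "card (UNIV - {a, c}) = (if a = c then 4 else 3)"
  using assms by (simp add: card_Diff_subset)

lemma exists_other:
  fixes a c :: "'i::finite"
  assumes "CARD('i) = 5"
  obtains k where "k \<noteq> a" "k \<noteq> c"
proof -
  have "UNIV - {a, c} \<noteq> {}"
    using card_2_other[OF assms, of a c] by (metis card.empty zero_neq_numeral)
  then show ?thesis using that by blast
qed

text \<open>
  The complete multipartite graph of a partition of five points has four edges only if the
  partition is of type \<open>4 + 1\<close>.
\<close>

lemma partition_4_1:
  fixes r :: "'i::finite \<Rightarrow> 'a"
  assumes 5: "CARD('i) = 5"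
    and E: "E = {{m, n} | m n. r m \<noteq> r n}" "card E \<le> 4" "E \<noteq> {}"
  obtains c \<rho> where "\<And>m. m \<noteq> c \<Longrightarrow> r m = \<rho>"
proof -
  from E(1,3) obtain a b where ab: "r a \<noteq> r b" by auto
  define Z where "Z = UNIV - {a, b}"
  have Z3: "card Z = 3" using card_2_other[OF 5, of a b] ab unfolding Z_def by auto
  \<comment> \<open>Every further point differs in \<open>r\<close> from \<open>a\<close> or from
    \<open>b\<close>. Together with the edge joining \<open>a\<close> and \<open>b\<close> this
    gives four edges, so there are no others; in particular the three further points share one
    value.\<close>
  define f where "f k = (if r k \<noteq> r a then {k, a} else {k, b})" for k
  define F where "F = insert {a, b} (f ` Z)"
  have "inj_on f Z"
    by (auto simp: inj_on_def f_def Z_def doubleton_eq_iff split: if_splits)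
  moreover have "{a, b} \<notin> f ` Z"
    by (auto simp: f_def Z_def doubleton_eq_iff split: if_splits)
  ultimately have "card F = 4"
    unfolding F_def using Z3 by (simp add: card_image)
  moreover have "F \<subseteq> E"
    using ab unfolding F_def E(1) f_def by auto (metis insert_commute)+
  ultimately have EF: "E = F"
    using E(2) by (intro card_seteq[symmetric]) auto
  have const: "r k = r k'" if "k \<in> Z" "k' \<in> Z" for k k'
  proof (rule ccontr)
    assume "r k \<noteq> r k'"
    then have "{k, k'} \<in> F" using EF E(1) by auto
    with that show False by (auto simp: F_def f_def Z_def doubleton_eq_iff split: if_splits)
  qed
  obtain k where k: "k \<in> Z" using exists_other[OF 5, of a b] unfolding Z_def by auto
  show ?thesis
  proof (cases "r k = r a")
    case True
    then show ?thesis using const[OF _ k] by (intro that[of b "r a"]) (metis DiffI UNIV_I Z_def insertE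
        singletonD)
  next
    case False
    have "r k = r b"
    proof (rule ccontr)
      assume "r k \<noteq> r b"
      then have "{k, b} \<in> F" using EF E(1) by auto
      with False k ab show False
        by (auto simp: F_def f_def Z_def doubleton_eq_iff split: if_splits)
    qed
    then show ?thesis using const[OF _ k] by (intro that[of a "r b"]) (metis DiffI UNIV_I Z_def insertE
        singletonD)
  qed
qed

text \<open>
  With five linear forms subject to the one relation \<open>\<Sum> b\<^sub>i v\<^sub>i = 0\<close> as coordinates on a
  four-dimensional space, \<open>syl b\<close> is the Hessian of \<open>\<Sum> v\<^sub>i\<^sup>3\<close> up to a constant factor.
\<close>

definition hyp :: "('i::finite \<Rightarrow> 'a::field) \<Rightarrow> ('i \<Rightarrow> 'a) \<Rightarrow> bool" where
  "hyp b v \<longleftrightarrow> (\<Sum>i\<in>UNIV. b i * v i) = 0"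

definition syl :: "('i::finite \<Rightarrow> 'a::comm_ring_1) \<Rightarrow> ('i \<Rightarrow> 'a) \<Rightarrow> 'a" where
  "syl b v = (\<Sum>m\<in>UNIV. (b m)\<^sup>2 * (\<Prod>n\<in>UNIV - {m}. v n))"

text \<open>The derivative of \<open>syl b\<close> at \<open>v\<close> in direction
  \<open>x\<close>, in closed form by the product rule.\<close>

definition dsyl :: "('i::finite \<Rightarrow> 'a::comm_ring_1) \<Rightarrow> ('i \<Rightarrow> 'a) \<Rightarrow> ('i \<Rightarrow> 'a) \<Rightarrow> 'a" where
  "dsyl b v x = (\<Sum>m\<in>UNIV. (b m)\<^sup>2 * (\<Sum>i\<in>UNIV - {m}. x i * (\<Prod>n\<in>UNIV - {m} - {i}. v n)))"

text \<open>Restriction to a line turns the directional derivative into an ordinary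
  \<open>pderiv\<close>; an identity between two functions \<open>syl\<close> can then be
  differentiated as an identity of univariate polynomials.\<close>

lemma syl_line:
  fixes v x b :: "'i::finite \<Rightarrow> 'a::field"
  obtains p where "\<And>s. poly p s = syl b (\<lambda>n. v n + s * x n)" "poly (pderiv p) 0 = dsyl b v x"
proof
  let ?p = "\<Sum>m\<in>UNIV. Polynomial.smult ((b m)\<^sup>2) (\<Prod>n\<in>UNIV - {m}. [:v n, x n:])"
  show "poly ?p s = syl b (\<lambda>n. v n + s * x n)" for s
    by (simp add: syl_def poly_sum poly_prod)
  have "poly (pderiv (\<Prod>n\<in>UNIV - {m}. [:v n, x n:])) 0 =
      (\<Sum>i\<in>UNIV - {m}. x i * (\<Prod>n\<in>UNIV - {m} - {i}. v n))" for m
    by (simp add: pderiv_prod poly_sum poly_prod pderiv_pCons mult.commute)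
  then show "poly (pderiv ?p) 0 = dsyl b v x"
    by (simp add: dsyl_def higher_pderiv_sum[of 1, simplified] pderiv_smult poly_sum)
qed

lemma syl_eq_0:
  assumes "card {n. v n = 0} \<ge> 2" shows "syl b v = 0"
  unfolding syl_def
proof (intro sum.neutral ballI)
  fix m
  have "card ({n. v n = 0} - {m}) \<ge> 1"
    using assms diff_card_le_card_Diff[of "{m}" "{n. v n = 0}"] by simp
  then have "{n. v n = 0} - {m} \<noteq> {}" by fastforce
  then have "(\<Prod>n\<in>UNIV - {m}. v n) = 0" by (intro prod_zero) auto
  then show "(b m)\<^sup>2 * (\<Prod>n\<in>UNIV - {m}. v n) = 0" by simp
qed

text \<open>Every term omits only two coordinates, hence keeps one of three zeros. So the points at
  which three faces meet are singular.\<close>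

lemma dsyl_eq_0:
  assumes "card {n. v n = 0} \<ge> 3" shows "dsyl b v x = 0"
  unfolding dsyl_def
proof (intro sum.neutral ballI)
  fix m
  have "(\<Sum>i\<in>UNIV - {m}. x i * (\<Prod>n\<in>UNIV - {m} - {i}. v n)) = 0"
  proof (intro sum.neutral ballI)
    fix i
    have "card ({n. v n = 0} - {m} - {i}) \<ge> 1"
      using assms diff_card_le_card_Diff[of "{m}" "{n. v n = 0}"]
        diff_card_le_card_Diff[of "{i}" "{n. v n = 0} - {m}"] by simp
    then have "{n. v n = 0} - {m} - {i} \<noteq> {}" by fastforce
    then have "(\<Prod>n\<in>UNIV - {m} - {i}. v n) = 0" by (intro prod_zero) auto
    then show "x i * (\<Prod>n\<in>UNIV - {m} - {i}. v n) = 0" by simp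
  qed
  then show "(b m)\<^sup>2 * (\<Sum>i\<in>UNIV - {m}. x i * (\<Prod>n\<in>UNIV - {m} - {i}. v n)) = 0" by simp
qed

lemma sum_supported_2:
  fixes g :: "'i::finite \<Rightarrow> 'a::comm_ring_1"
  assumes "m \<noteq> n" "\<And>k. k \<noteq> m \<Longrightarrow> k \<noteq> n \<Longrightarrow> g k = 0"
  shows "sum g UNIV = g m + g n"
proof -
  have "sum g UNIV = sum g {m, n}" by (rule sum.mono_neutral_right) (use assms in auto)
  then show ?thesis using assms(1) by simp
qed

text \<open>For nonzero \<open>b\<close>, the vertex of the pentahedron that lies on all faces
  except \<open>m\<close> and \<open>n\<close>. Up to a factor the relation leaves no other choice
  for the two nonzero coordinates.\<close>

definition node :: "('i \<Rightarrow> 'a::field) \<Rightarrow> 'i \<Rightarrow> 'i \<Rightarrow> 'i \<Rightarrow> 'a" where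
  "node b m n = (\<lambda>k. if k = m then b n else if k = n then - b m else 0)"

lemma hyp_node: "m \<noteq> n \<Longrightarrow> hyp b (node b m n)"
  unfolding hyp_def by (subst sum_supported_2[of m n]) (auto simp: node_def)

text \<open>The gradient must be proportional to \<open>b\<close>, as with a Lagrange multiplier.
  Without a zero coordinate this makes \<open>(b m * v m)\<^sup>2\<close> a fixed multiple of
  \<open>b m ^ 3\<close>, and \<open>general\<close> contradicts the relation. With one zero a
  single term of \<open>syl b v\<close> survives; with two zeros the gradient vanishes at one index
  but not at another; four or more zeros contradict the relation. Three zeros remain.\<close>

lemma singular_points:
  fixes b v :: "'i::finite \<Rightarrow> 'a::field"
  assumes 5: "CARD('i) = 5" and b: "\<And>i. b i \<noteq> 0"
    and general: "\<forall>u s. s \<noteq> 0 \<longrightarrow> (\<forall>m. (u m)\<^sup>2 = s * b m ^ 3) \<longrightarrow> sum u UNIV \<noteq> 0"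
    and v: "hyp b v" "v k \<noteq> 0"
    and sing: "syl b v = 0" "\<And>x. hyp b x \<Longrightarrow> dsyl b v x = 0"
  shows "card {n. v n \<noteq> 0} = 2"
proof -
  \<comment> \<open>\<open>G m\<close> is the partial derivative of \<open>syl b\<close> by the
    coordinate \<open>m\<close>.\<close>
  define G where "G m = (\<Sum>i\<in>UNIV - {m}. (b i)\<^sup>2 * (\<Prod>n\<in>UNIV - {m, i}. v n))" for m
  have dG: "dsyl b v x = (\<Sum>m\<in>UNIV. x m * G m)" for x
  proof -
    have "dsyl b v x = (\<Sum>m\<in>UNIV. \<Sum>i | i \<noteq> m. (b m)\<^sup>2 * (x i * (\<Prod>n\<in>UNIV - {m} - {i}. v n)))"
      unfolding dsyl_def sum_distrib_left by (intro sum.cong refl) auto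
    also have "\<dots> = (\<Sum>i\<in>UNIV. \<Sum>m | i \<noteq> m. (b m)\<^sup>2 * (x i * (\<Prod>n\<in>UNIV - {m} - {i}. v n)))"
      using sum.swap_restrict[of UNIV UNIV "\<lambda>m i. (b m)\<^sup>2 * (x i * (\<Prod>n\<in>UNIV - {m} - {i}. v n))" "\<lambda>m i. i \<noteq> m"]
      by simp
    also have "\<dots> = (\<Sum>m\<in>UNIV. x m * G m)"
      unfolding G_def sum_distrib_left
    proof (intro sum.cong refl)
      fix i m :: 'i assume "m \<in> UNIV - {i}"
      have "UNIV - {m} - {i} = UNIV - {i, m}" by auto
      then show "(b m)\<^sup>2 * (x i * (\<Prod>n\<in>UNIV - {m} - {i}. v n)) = x i * ((b m)\<^sup>2 * (\<Prod>n\<in>UNIV - {i, m}. v n))"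
        by (simp add: mult_ac)
    qed auto
    finally show ?thesis .
  qed
  have G: "G m * b n = G n * b m" if "m \<noteq> n" for m n
  proof -
    \<comment> \<open>A vertex, used as a tangent direction, isolates two components of the
      gradient.\<close>
    have "0 = (\<Sum>k\<in>UNIV. node b m n k * G k)" using sing(2)[OF hyp_node[OF that]] by (simp add: dG)
    also have "\<dots> = b n * G m - b m * G n"
      using that by (subst sum_supported_2[of m n]) (auto simp: node_def)
    finally show ?thesis by (simp add: mult.commute)
  qed
  define Z where "Z = {n. v n = 0}"
  have nz: "{n. v n \<noteq> 0} = UNIV - Z" by (auto simp: Z_def)
  then have cardnz: "card {n. v n \<noteq> 0} = 5 - card Z"
    using 5 by (simp add: card_Diff_subset)
  have "card Z \<noteq> 0"
  proof
    assume "card Z = 0"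
    then have v0: "v n \<noteq> 0" for n by (auto simp: Z_def)
    define Q where "Q = (\<Prod>n\<in>UNIV. v n)"
    have Q: "Q \<noteq> 0" using v0 by (simp add: Q_def)
    have Qm: "(\<Prod>n\<in>UNIV - {m}. v n) = Q / v m" for m
      using prod.remove[of UNIV m v] v0[of m] by (simp add: Q_def)
    have Qmi: "(\<Prod>n\<in>UNIV - {m, i}. v n) * v m = Q / v i" if "i \<noteq> m" for m i
    proof -
      have "Q / v i = v m * (\<Prod>n\<in>UNIV - {i} - {m}. v n)"
        using prod.remove[of "UNIV - {i}" m v] that Qm[of i] by simp
      moreover have "UNIV - {i} - {m} = UNIV - {m, i}" by auto
      ultimately show ?thesis by simp
    qed
    have S: "(\<Sum>i\<in>UNIV. (b i)\<^sup>2 * (Q / v i)) = 0" using sing(1) by (simp add: syl_def Qm)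
    have Gm: "G m = - (b m)\<^sup>2 * Q / (v m)\<^sup>2" for m
    proof -
      have "G m * v m = (\<Sum>i\<in>UNIV - {m}. (b i)\<^sup>2 * (Q / v i))"
        unfolding G_def sum_distrib_right by (intro sum.cong refl) (simp add: Qmi mult.assoc)
      \<comment> \<open>The sum over all \<open>i\<close> vanishes because
        \<open>syl b v = 0\<close>, so the sum without \<open>m\<close> is minus the term at
        \<open>m\<close>.\<close>
      also have "\<dots> = - ((b m)\<^sup>2 * (Q / v m))"
        using sum.remove[of UNIV m "\<lambda>i. (b i)\<^sup>2 * (Q / v i)"] S by (simp add: eq_neg_iff_add_eq_0 add.commute)
      finally show ?thesis using v0[of m] by (simp add: field_simps power2_eq_square)
    qed
    have "b m * (v n)\<^sup>2 = b n * (v m)\<^sup>2" for m n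
    proof (cases "m = n")
      case False
      from G[OF False] show ?thesis
        using v0[of m] v0[of n] b[of m] b[of n] Q by (simp add: Gm field_simps power2_eq_square)
    qed simp
    then have "(b m * v m)\<^sup>2 = (v k)\<^sup>2 / b k * b m ^ 3" for m
      using b[of k] by (simp add: field_simps power2_eq_square power3_eq_cube)
    moreover have "(v k)\<^sup>2 / b k \<noteq> 0" using v0[of k] b[of k] by simp
    ultimately have "(\<Sum>m\<in>UNIV. b m * v m) \<noteq> 0"
      using general[rule_format, of "(v k)\<^sup>2 / b k" "\<lambda>m. b m * v m"] by simp
    with v(1) show False by (simp add: hyp_def)
  qed
  moreover have "card Z \<noteq> 1"
  proof
    assume "card Z = 1"
    then obtain a where a: "Z = {a}" by (auto simp: card_1_singleton_iff)
    have "syl b v = (\<Sum>m\<in>{a}. (b m)\<^sup>2 * (\<Prod>n\<in>UNIV - {m}. v n))"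
      unfolding syl_def using a by (intro sum.mono_neutral_right) (auto simp: Z_def intro!: prod_zero)
    moreover have "(\<Prod>n\<in>UNIV - {a}. v n) \<noteq> 0" using a by (auto simp: Z_def)
    ultimately show False using sing(1) b by simp
  qed
  moreover have "card Z \<noteq> 2"
  proof
    assume "card Z = 2"
    then obtain a c where ac: "Z = {a, c}" "a \<noteq> c" by (auto simp: card_2_iff)
    obtain m where m: "m \<noteq> a" "m \<noteq> c" using exists_other[OF 5] .
    have "G a = (\<Sum>i\<in>{c}. (b i)\<^sup>2 * (\<Prod>n\<in>UNIV - {a, i}. v n))"
      unfolding G_def using ac by (intro sum.mono_neutral_right) (auto simp: Z_def intro!: prod_zero)
    moreover have "(\<Prod>n\<in>UNIV - {a, c}. v n) \<noteq> 0" using ac by (auto simp: Z_def)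
    ultimately have "G a \<noteq> 0" using b by simp
    moreover have "G m = 0"
      unfolding G_def
    proof (intro sum.neutral ballI)
      fix i
      have "\<exists>n\<in>UNIV - {m, i}. v n = 0"
        using ac m by (cases "i = a") (auto simp: Z_def)
      then show "(b i)\<^sup>2 * (\<Prod>n\<in>UNIV - {m, i}. v n) = 0" by (auto intro!: prod_zero)
    qed
    ultimately show False using G[of a m] m b by simp
  qed
  moreover have "card Z < 4"
  proof (rule ccontr)
    assume "\<not> card Z < 4"
    then have "card {n. v n \<noteq> 0} \<le> 1" using cardnz by simp
    then have "\<And>n. v n \<noteq> 0 \<Longrightarrow> n = k"
      using v(2) card_le_Suc0_iff_eq[of "{n. v n \<noteq> 0}"] by auto
    then have "(\<Sum>i\<in>UNIV. b i * v i) = (\<Sum>i\<in>{k}. b i * v i)"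
      by (intro sum.mono_neutral_right) auto
    with v b show False by (simp add: hyp_def)
  qed
  ultimately have "card Z = 3" by linarith
  with cardnz show ?thesis by simp
qed

text \<open>The identity carries singular points to singular points, so the preimages of vertices
  are vertices, and the ten pairs of indices on both sides are matched bijectively. The form
  \<open>L i\<close> is nonzero at only four of the ten vertices, which forces it to be a multiple
  of one coordinate on the hyperplane. The relation and the values on the faces then control the
  factors.\<close>

theorem pentahedron_unique:
  fixes b b' :: "'i::finite \<Rightarrow> 'a::field_char_0" and a :: "'i \<Rightarrow> 'i \<Rightarrow> 'a"
  assumes 5: "CARD('i) = 5" and b: "\<And>i. b i \<noteq> 0" and b': "\<And>i. b' i \<noteq> 0"
    and C: "C \<noteq> 0" and C': "C' \<noteq> 0"
    and general: "\<forall>u s. s \<noteq> 0 \<longrightarrow> (\<forall>m. (u m)\<^sup>2 = s * b m ^ 3) \<longrightarrow> sum u UNIV \<noteq> 0"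
    and L: "\<And>i v. L i v = (\<Sum>m\<in>UNIV. a i m * v m)"
    and hyp': "\<And>v. hyp b v \<Longrightarrow> hyp b' (\<lambda>i. L i v)"
    and surj: "\<And>w. hyp b' w \<Longrightarrow> \<exists>v. hyp b v \<and> (\<forall>i. L i v = w i)"
    and eq: "\<And>v. hyp b v \<Longrightarrow> C * syl b v = C' * syl b' (\<lambda>i. L i v)"
  obtains \<pi> \<mu> \<theta> where "bij \<pi>" "\<And>i v. hyp b v \<Longrightarrow> L i v = \<mu> i * v (\<pi> i)" "\<And>i. \<mu> i ^ 3 = \<theta>"
proof -
  have Llin: "L i (\<lambda>n. v n + s * x n) = L i v + s * L i x" for i v s x
    by (simp add: L distrib_left sum.distrib sum_distrib_left mult_ac)
  have deq: "C * dsyl b v x = C' * dsyl b' (\<lambda>i. L i v) (\<lambda>i. L i x)" if "hyp b v" "hyp b x" for v x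
  proof -
    obtain p where p: "\<And>s. poly p s = syl b (\<lambda>n. v n + s * x n)" "poly (pderiv p) 0 = dsyl b v x"
      by (rule syl_line[of b v x]) (rule that)
    obtain q where q: "\<And>s. poly q s = syl b' (\<lambda>i. L i v + s * L i x)"
      "poly (pderiv q) 0 = dsyl b' (\<lambda>i. L i v) (\<lambda>i. L i x)"
      by (rule syl_line[of b' "\<lambda>i. L i v" "\<lambda>i. L i x"]) (rule that)
    have "hyp b (\<lambda>n. v n + s * x n)" for s
    proof -
      have "(\<Sum>i\<in>UNIV. b i * (v i + s * x i)) = (\<Sum>i\<in>UNIV. b i * v i) + s * (\<Sum>i\<in>UNIV. b i * x i)"
        by (simp add: distrib_left sum.distrib sum_distrib_left mult_ac)
      with that show ?thesis by (simp add: hyp_def)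
    qed
    from eq[OF this] have "poly (Polynomial.smult C p) s = poly (Polynomial.smult C' q) s" for s
      by (simp add: p q Llin)
    then have "Polynomial.smult C p = Polynomial.smult C' q"
      by (simp add: poly_eq_poly_eq_iff[symmetric] fun_eq_iff)
    then have "poly (pderiv (Polynomial.smult C p)) 0 = poly (pderiv (Polynomial.smult C' q)) 0" by simp
    then show ?thesis by (simp add: pderiv_smult p q)
  qed
  have node_point: "card {n. v n \<noteq> 0} = 2"
    if v: "hyp b v" and w: "\<And>i. L i v = node b' p q i" and pq: "p \<noteq> q" for v p q
  proof (rule ccontr)
    assume ne: "card {n. v n \<noteq> 0} \<noteq> 2"
    have Lv: "(\<lambda>i. L i v) = node b' p q" using w by blast
    have "{n. node b' p q n = 0} = UNIV - {p, q}" using b' by (auto simp: node_def)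
    then have z: "card {n. node b' p q n = 0} = 3" using card_2_other[OF 5, of p q] pq by simp
    have "L p v \<noteq> 0" using w[of p] b' by (simp add: node_def)
    have "\<exists>k. v k \<noteq> 0"
    proof (rule ccontr)
      assume "\<nexists>k. v k \<noteq> 0"
      then have "L p v = 0" by (simp add: L)
      with \<open>L p v \<noteq> 0\<close> show False by simp
    qed
    then obtain k where k: "v k \<noteq> 0" by blast
    have "syl b v = 0" using eq[OF v] syl_eq_0[of "node b' p q" b'] z C by (simp add: Lv)
    moreover have "dsyl b v x = 0" if "hyp b x" for x
      using deq[OF v that] dsyl_eq_0[of "node b' p q" b'] z C by (simp add: Lv)
    ultimately have "card {n. v n \<noteq> 0} = 2" by (rule singular_points[OF 5 b general v k])
    with ne show False by simp
  qed
  define P where "P = {X :: 'i set. card X = 2}"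
  have "\<exists>v. hyp b v \<and> card {n. v n \<noteq> 0} = 2 \<and> (\<forall>i. L i v \<noteq> 0 \<longleftrightarrow> i \<in> X)" if "X \<in> P" for X
  proof -
    from that obtain p q where X: "X = {p, q}" "p \<noteq> q" by (auto simp: P_def card_2_iff)
    from surj[OF hyp_node[OF X(2)]] obtain v where v: "hyp b v" "\<And>i. L i v = node b' p q i" by blast
    have "\<forall>i. L i v \<noteq> 0 \<longleftrightarrow> i \<in> X" using b' X by (auto simp: v(2) node_def)
    with v node_point[OF v X(2)] show ?thesis by blast
  qed
  then obtain pt where pt: "\<And>X. X \<in> P \<Longrightarrow> hyp b (pt X)" "\<And>X. X \<in> P \<Longrightarrow> card {n. pt X n \<noteq> 0} = 2"
    "\<And>X i. X \<in> P \<Longrightarrow> L i (pt X) \<noteq> 0 \<longleftrightarrow> i \<in> X" by metis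
  \<comment> \<open>\<open>pt X\<close> is the point sent to the vertex \<open>X\<close> of the
    second pentahedron, and \<open>\<tau> X\<close> names it as a vertex of the first.\<close>
  define \<tau> where "\<tau> X = {n. pt X n \<noteq> 0}" for X
  \<comment> \<open>In the coordinates \<open>b m * v m\<close>, which add up to zero on the
    hyperplane, only differences of the coefficients \<open>r i m\<close> matter. At the vertex
    supported on \<open>m\<close> and \<open>n\<close> the form \<open>L i\<close> vanishes exactly
    if \<open>r i m = r i n\<close>.\<close>
  define r where "r i m = a i m / b m" for i m
  have Lr: "L i v = (\<Sum>m\<in>UNIV. r i m * (b m * v m))" for i v
    unfolding L r_def using b by (intro sum.cong refl) simp
  have \<tau>: "m \<noteq> n \<Longrightarrow> i \<in> X \<longleftrightarrow> r i m \<noteq> r i n" if "X \<in> P" "\<tau> X = {m, n}" for X i m n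
  proof -
    assume mn: "m \<noteq> n"
    have nz: "pt X m \<noteq> 0" "pt X n \<noteq> 0" and z: "\<And>k. k \<noteq> m \<Longrightarrow> k \<noteq> n \<Longrightarrow> pt X k = 0"
      using that(2) unfolding \<tau>_def by auto
    have "b m * pt X m + b n * pt X n = 0"
      using pt(1)[OF that(1)] sum_supported_2[OF mn, of "\<lambda>i. b i * pt X i"] z by (simp add: hyp_def)
    then have "b n * pt X n = - (b m * pt X m)" by (simp add: eq_neg_iff_add_eq_0 add.commute)
    moreover have "L i (pt X) = r i m * (b m * pt X m) + r i n * (b n * pt X n)"
      unfolding Lr using sum_supported_2[OF mn, of "\<lambda>m. r i m * (b m * pt X m)"] z by simp
    ultimately have "L i (pt X) = (r i m - r i n) * (b m * pt X m)" by (simp add: algebra_simps)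
    with nz b pt(3)[OF that(1), of i] show ?thesis by simp
  qed
  have \<tau>P: "\<tau> ` P \<subseteq> P" using pt(2) by (auto simp: P_def \<tau>_def)
  have "inj_on \<tau> P"
  proof
    fix X Y assume XY: "X \<in> P" "Y \<in> P" "\<tau> X = \<tau> Y"
    from \<tau>P XY(1) have "\<tau> X \<in> P" by blast
    then obtain m n where mn: "\<tau> X = {m, n}" "m \<noteq> n" by (auto simp: P_def card_2_iff)
    \<comment> \<open>\<open>X\<close> is recovered from \<open>{m, n}\<close> as the set of all
      \<open>i\<close> with \<open>r i m \<noteq> r i n\<close>.\<close>
    from \<tau>[OF XY(1) mn] \<tau>[OF XY(2) mn(1)[unfolded XY(3)] mn(2)] show "X = Y" by blast
  qed
  with \<tau>P have \<tau>_surj: "\<tau> ` P = P" by (intro endo_inj_surj) (auto simp: P_def)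
  have "\<exists>c \<rho>. \<forall>m. m \<noteq> c \<longrightarrow> r i m = \<rho>" for i
  proof -
    \<comment> \<open>The index \<open>i\<close> lies in four of the ten pairs, so
      \<open>r i\<close> separates at most four pairs of indices.\<close>
    define E where "E = {{m, n} | m n. r i m \<noteq> r i n}"
    have E: "E = \<tau> ` {X \<in> P. i \<in> X}"
    proof (intro equalityI subsetI)
      fix Y assume "Y \<in> E"
      then obtain m n where mn: "Y = {m, n}" "r i m \<noteq> r i n" "m \<noteq> n" by (auto simp: E_def)
      then have "Y \<in> \<tau> ` P" using \<tau>_surj by (auto simp: P_def)
      then obtain X where X: "X \<in> P" "Y = \<tau> X" by blast
      with \<tau>[OF X(1), of m n i] mn show "Y \<in> \<tau> ` {X \<in> P. i \<in> X}" by auto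
    next
      fix Y assume "Y \<in> \<tau> ` {X \<in> P. i \<in> X}"
      then obtain X where X: "X \<in> P" "i \<in> X" "Y = \<tau> X" by blast
      with \<tau>P have "Y \<in> P" by blast
      then obtain m n where mn: "Y = {m, n}" "m \<noteq> n" by (auto simp: P_def card_2_iff)
      with \<tau>[OF X(1), of m n i] X show "Y \<in> E" by (auto simp: E_def)
    qed
    have X: "{X \<in> P. i \<in> X} = (\<lambda>j. {i, j}) ` (UNIV - {i})"
    proof (intro equalityI subsetI)
      fix X assume "X \<in> {X \<in> P. i \<in> X}"
      then obtain j where "X = {i, j}" "j \<noteq> i" unfolding P_def by (auto simp: card_2_iff)
      then show "X \<in> (\<lambda>j. {i, j}) ` (UNIV - {i})" by blast
    qed (auto simp: P_def)
    have "card E \<le> 4"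
      unfolding E X using card_2_other[OF 5, of i i]
      by (metis (no_types, lifting) card_image_le finite finite_imageI insert_absorb2 le_trans)
    moreover have "E \<noteq> {}"
      unfolding E X using exists_other[OF 5, of i i] by auto
    ultimately show ?thesis using partition_4_1[OF 5 E_def] by metis
  qed
  then obtain \<pi> \<rho> where \<pi>: "\<And>i m. m \<noteq> \<pi> i \<Longrightarrow> r i m = \<rho> i" by metis
  define \<mu> where "\<mu> i = (r i (\<pi> i) - \<rho> i) * b (\<pi> i)" for i
  have \<mu>: "L i v = \<mu> i * v (\<pi> i)" if "hyp b v" for i v
  proof -
    have "L i v = (\<Sum>m\<in>UNIV. \<rho> i * (b m * v m) + (if m = \<pi> i then \<mu> i * v (\<pi> i) else 0))"
      unfolding Lr using \<pi>[of _ i] by (intro sum.cong refl) (auto simp: \<mu>_def algebra_simps)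
    then show ?thesis using that by (simp add: sum.distrib hyp_def flip: sum_distrib_left)
  qed
  have \<mu>0: "\<mu> i \<noteq> 0" for i
  proof -
    obtain j where "j \<noteq> i" using exists_other[OF 5, of i i] by blast
    from surj[OF hyp_node[OF this]] obtain v where "hyp b v" "\<And>k. L k v = node b' j i k" by blast
    with \<mu>[of v i] b' \<open>j \<noteq> i\<close> show ?thesis by (auto simp: node_def)
  qed
  have inj: "inj \<pi>"
  proof (rule injI, rule ccontr)
    fix i j assume ij: "\<pi> i = \<pi> j" "i \<noteq> j"
    obtain k where k: "k \<noteq> i" "k \<noteq> j" using exists_other[OF 5] .
    from surj[OF hyp_node[OF k(2)[symmetric]]] obtain v where v: "hyp b v" "\<And>n. L n v = node b' j k n"
        by blast
    from \<mu>[OF v(1), of i] \<mu>[OF v(1), of j] ij k \<mu>0[of i] b' show False by (simp add: v(2) node_def)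
  qed
  then have bij: "bij \<pi>" by (simp add: bij_def finite_UNIV_inj_surj)
  \<comment> \<open>The relation of the second pentahedron, pulled back, holds on all of
    \<open>hyp b\<close>; evaluated at a vertex it shows that its coefficients are proportional to
    those of \<open>b\<close>.\<close>
  have rel: "b' i * \<mu> i * b (\<pi> j) = b' j * \<mu> j * b (\<pi> i)" for i j
  proof (cases "i = j")
    case False
    then have n: "\<pi> i \<noteq> \<pi> j" using inj by (auto dest: injD)
    let ?v = "node b (\<pi> i) (\<pi> j)"
    have "0 = (\<Sum>k\<in>UNIV. b' k * (\<mu> k * ?v (\<pi> k)))"
      using hyp'[OF hyp_node[OF n]] by (simp add: hyp_def \<mu>[OF hyp_node[OF n]])
    also have "\<dots> = b' i * (\<mu> i * b (\<pi> j)) - b' j * (\<mu> j * b (\<pi> i))"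
      using n injD[OF inj] by (subst sum_supported_2[OF False]) (auto simp: node_def)
    finally show ?thesis by (simp add: mult.assoc)
  qed simp
  obtain i0 :: 'i where True by simp
  define \<kappa> where "\<kappa> = b' i0 * \<mu> i0 / b (\<pi> i0)"
  have \<kappa>: "b' i * \<mu> i = \<kappa> * b (\<pi> i)" for i
    using rel[of i i0] b by (simp add: \<kappa>_def field_simps)
  have "\<mu> i ^ 3 = C' * \<kappa>\<^sup>2 * (\<Prod>j\<in>UNIV. \<mu> j) / C" for i
  proof -
    let ?c = "\<pi> i"
    obtain d where d: "d \<noteq> ?c" using exists_other[OF 5, of ?c ?c] by blast
    \<comment> \<open>A point on the face \<open>?c\<close> and on no other: three coordinates are
      \<open>1 / b n\<close>, and \<open>- 3 / b d\<close> balances them in the relation. At such a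
      point just one term of each \<open>syl\<close> survives.\<close>
    define v where "v n = (if n = ?c then 0 else if n = d then - 3 / b d else 1 / b n)" for n
    have "(\<Sum>n\<in>UNIV. b n * v n) = (\<Sum>n\<in>UNIV - {?c}. b n * v n)"
      by (rule sum.mono_neutral_right) (auto simp: v_def)
    also have "\<dots> = b d * v d + (\<Sum>n\<in>UNIV - {?c} - {d}. b n * v n)"
      using d by (intro sum.remove) auto
    also have "(\<Sum>n\<in>UNIV - {?c} - {d}. b n * v n) = (\<Sum>n\<in>UNIV - {?c, d}. 1)"
      using b by (intro sum.cong) (auto simp: v_def)
    also have "b d * v d + \<dots> = 0"
      using d b card_2_other[OF 5, of ?c d] by (simp add: v_def)
    finally have v: "hyp b v" by (simp add: hyp_def)
    define T where "T = (\<Prod>n\<in>UNIV - {?c}. v n)"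
    have T: "T \<noteq> 0" using b by (auto simp: T_def v_def)
    have "syl b v = (\<Sum>m\<in>{?c}. (b m)\<^sup>2 * (\<Prod>n\<in>UNIV - {m}. v n))"
      unfolding syl_def by (intro sum.mono_neutral_right) (auto simp: v_def intro!: prod_zero)
    then have 1: "syl b v = (b ?c)\<^sup>2 * T" by (simp add: T_def)
    have "syl b' (\<lambda>j. L j v) = (\<Sum>m\<in>{i}. (b' m)\<^sup>2 * (\<Prod>n\<in>UNIV - {m}. L n v))"
      unfolding syl_def by (intro sum.mono_neutral_right) (auto simp: v_def \<mu>[OF v] intro!: prod_zero)
    also have "\<dots> = (b' i)\<^sup>2 * (\<Prod>n\<in>UNIV - {i}. L n v)" by simp
    also have "(\<Prod>n\<in>UNIV - {i}. L n v) = (\<Prod>n\<in>UNIV - {i}. \<mu> n) * (\<Prod>n\<in>UNIV - {i}. v (\<pi> n))"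
      by (simp add: \<mu>[OF v] prod.distrib)
    also have "(\<Prod>n\<in>UNIV - {i}. v (\<pi> n)) = T"
      unfolding T_def using bij bij_betw_DiffI[of \<pi> UNIV UNIV "{i}" "{?c}"]
      by (intro prod.reindex_bij_betw) auto
    finally have "C * ((b ?c)\<^sup>2 * T) = C' * ((b' i)\<^sup>2 * ((\<Prod>n\<in>UNIV - {i}. \<mu> n) * T))"
      using eq[OF v] 1 by simp
    then have "C * (b ?c)\<^sup>2 = C' * (b' i)\<^sup>2 * (\<Prod>n\<in>UNIV - {i}. \<mu> n)" using T by simp
    \<comment> \<open>The factor \<open>\<mu> i ^ 3\<close> completes the product over
      \<open>n \<noteq> i\<close> and, by \<open>\<kappa>\<close>, lets \<open>b ?c\<close> cancel;
      what remains on the right does not depend on \<open>i\<close>.\<close>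
    then have "C * (b ?c)\<^sup>2 * \<mu> i ^ 3 = C' * (b' i * \<mu> i)\<^sup>2 * (\<mu> i * (\<Prod>n\<in>UNIV - {i}. \<mu> n))"
      by (simp add: power2_eq_square power3_eq_cube mult_ac)
    also have "\<mu> i * (\<Prod>n\<in>UNIV - {i}. \<mu> n) = (\<Prod>j\<in>UNIV. \<mu> j)"
      by (rule prod.remove[symmetric]) auto
    finally show ?thesis
      using b[of ?c] C unfolding \<kappa> by (simp add: field_simps power2_eq_square)
  qed
  with bij \<mu> show ?thesis using that by blast
qed

section \<open>Sylvester cubics\<close>

lemma det_4:
  "det (A::'a::comm_ring_1^4^4) =
    A$1$1 * A$2$2 * A$3$3 * A$4$4 - A$1$1 * A$2$2 * A$3$4 * A$4$3
  - A$1$1 * A$2$3 * A$3$2 * A$4$4 + A$1$1 * A$2$3 * A$3$4 * A$4$2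
  + A$1$1 * A$2$4 * A$3$2 * A$4$3 - A$1$1 * A$2$4 * A$3$3 * A$4$2
  - A$1$2 * A$2$1 * A$3$3 * A$4$4 + A$1$2 * A$2$1 * A$3$4 * A$4$3
  + A$1$2 * A$2$3 * A$3$1 * A$4$4 - A$1$2 * A$2$3 * A$3$4 * A$4$1
  - A$1$2 * A$2$4 * A$3$1 * A$4$3 + A$1$2 * A$2$4 * A$3$3 * A$4$1
  + A$1$3 * A$2$1 * A$3$2 * A$4$4 - A$1$3 * A$2$1 * A$3$4 * A$4$2
  - A$1$3 * A$2$2 * A$3$1 * A$4$4 + A$1$3 * A$2$2 * A$3$4 * A$4$1
  + A$1$3 * A$2$4 * A$3$1 * A$4$2 - A$1$3 * A$2$4 * A$3$2 * A$4$1
  - A$1$4 * A$2$1 * A$3$2 * A$4$3 + A$1$4 * A$2$1 * A$3$3 * A$4$2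
  + A$1$4 * A$2$2 * A$3$1 * A$4$3 - A$1$4 * A$2$2 * A$3$3 * A$4$1
  - A$1$4 * A$2$3 * A$3$1 * A$4$2 + A$1$4 * A$2$3 * A$3$2 * A$4$1"
proof -
  have f1234: "finite {2::4, 3, 4}" "1 \<notin> {2::4, 3, 4}"
    by auto
  have f234: "finite {3::4, 4}" "2 \<notin> {3::4, 4}"
    by auto
  have f34: "finite {4::4}" "3 \<notin> {4::4}"
    by auto
  show ?thesis
    unfolding det_def UNIV_4
    unfolding sum_over_permutations_insert[OF f1234]
    unfolding sum_over_permutations_insert[OF f234]
    unfolding sum_over_permutations_insert[OF f34]
    unfolding permutes_sing
    by (simp add: sign_swap_id permutation_swap_id permutation_compose sign_compose sign_id swap_id_eq)
qed

text \<open>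
  The rows \<open>Some i\<close> of \<open>z\<close> are four linear forms \<open>l\<^sub>i\<close>, and the row \<open>None\<close> is a vector \<open>\<eta>\<close> defining
  the fifth form \<open>- \<Sum> \<eta>\<^sub>i\<^sup>2 l\<^sub>i\<close>. The coefficients are chosen to be squares because the condition
  for additional singular points of the Hessian involves their square roots.
\<close>

fun coef :: "(4 option \<Rightarrow> 4 \<Rightarrow> 'a::comm_ring_1) \<Rightarrow> 4 option \<Rightarrow> 4 \<Rightarrow> 'a" where
  "coef z (Some i) v = z (Some i) v"
| "coef z None v = - (\<Sum>i\<in>UNIV. (z None i)\<^sup>2 * z (Some i) v)"

fun relc :: "(4 option \<Rightarrow> 4 \<Rightarrow> 'a::comm_ring_1) \<Rightarrow> 4 option \<Rightarrow> 'a" where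
  "relc z (Some i) = (z None i)\<^sup>2"
| "relc z None = 1"

definition linear_form :: "(4 \<Rightarrow> 'a::comm_ring_1) \<Rightarrow> (4, 'a) mpoly" where
  "linear_form a = (\<Sum>v\<in>UNIV. Const (a v) * Var v)"

definition sylvester :: "(4 option \<Rightarrow> 4 \<Rightarrow> 'a::comm_ring_1) \<Rightarrow> (4, 'a) mpoly" where
  "sylvester z = (\<Sum>m\<in>UNIV. linear_form (coef z m) ^ 3)"

definition zdet :: "(4 option \<Rightarrow> 4 \<Rightarrow> 'a::comm_ring_1) \<Rightarrow> 'a" where
  "zdet z = det (\<chi> i v. z (Some i) v)"

definition lvals :: "(4 option \<Rightarrow> 4 \<Rightarrow> 'a::comm_ring_1) \<Rightarrow> (4 \<Rightarrow> 'a) \<Rightarrow> 4 option \<Rightarrow> 'a" where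
  "lvals z x m = (\<Sum>v\<in>UNIV. coef z m v * x v)"

lemma sum_option: "(\<Sum>m\<in>UNIV. f m) = f None + (\<Sum>i\<in>UNIV. f (Some i))"
  for f :: "'i::finite option \<Rightarrow> 'a::comm_monoid_add"
  by (simp add: UNIV_option_conv sum.reindex)

lemma coef_hom: "ring_hom h \<Longrightarrow> h (coef z m v) = coef (\<lambda>m v. h (z m v)) m v"
  by (cases m) (simp_all add: ring_hom_simps)

lemma zdet_hom: "ring_hom h \<Longrightarrow> h (zdet z) = zdet (\<lambda>m v. h (z m v))"
  by (simp add: zdet_def ring_hom_det)

lemma sylvester_hom:
  assumes "ring_hom h"
  shows "map_coeffs h (sylvester z) = sylvester (\<lambda>m v. h (z m v))"
  by (simp add: sylvester_def linear_form_def ring_hom_simps[OF ring_hom_map_coeffs[OF assms]]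
    map_coeffs_single[of h, OF ring_hom_0[OF assms]] ring_hom_1[OF assms] coef_hom[OF assms])

lemma relc_coef: "(\<Sum>m\<in>UNIV. relc z m * coef z m v) = 0"
  by (simp add: sum_option)

lemma relc_lvals: "(\<Sum>m\<in>UNIV. relc z m * lvals z x m) = 0"
proof -
  have "(\<Sum>m\<in>UNIV. relc z m * lvals z x m) = (\<Sum>v\<in>UNIV. (\<Sum>m\<in>UNIV. relc z m * coef z m v) * x v)"
    unfolding lvals_def sum_distrib_left sum_distrib_right by (subst sum.swap) (simp add: mult.assoc)
  then show ?thesis by (simp only: relc_coef) simp
qed

lemma linear_form_forms: "linear_form a \<in> forms UNIV 1"
  unfolding linear_form_def
proof (rule forms_sum)
  fix v
  show "Const (a v) * Var v \<in> forms UNIV 1"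
    using forms_mult[OF forms_Const forms_Var, of v UNIV "a v"] by simp
qed

lemma sylvester_forms: "sylvester z \<in> forms UNIV 3"
  unfolding sylvester_def
proof (rule forms_sum)
  fix m
  show "linear_form (coef z m) ^ 3 \<in> forms UNIV 3"
    using forms_power[OF linear_form_forms, of "coef z m" 3] by simp
qed

lemma eval_linear_form: "eval (linear_form a) x = (\<Sum>v\<in>UNIV. a v * x v)"
  by (simp add: linear_form_def eval_simps)

lemma pdiff_linear_form: "pdiff v (linear_form a) = Const (a v)"
proof -
  have *: "pdiff v (Const (a w) * Var w) = (if w = v then Const (a v) else 0)" for w
    by (simp add: mult_single pdiff_single lookup_single when_def)
  show ?thesis by (simp only: linear_form_def pdiff_sum *) simp
qed

lemma pdiff_Const: "pdiff v (Const c) = 0"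
  by (simp add: pdiff_single)

lemma pdiff_numeral: "pdiff v (numeral n) = (0 :: ('v, 'a::comm_ring_1) mpoly)"
  using pdiff_Const[of v "numeral n :: 'a"] by simp

lemma pdiff2_cube:
  "pdiff i (pdiff j (linear_form a ^ 3)) = Const (6 * a i * a j) * linear_form a"
proof -
  have "Const (6 * a i * a j) = (6 :: (4, 'a) mpoly) * Const (a i) * Const (a j)"
    by (simp only: single_numeral[symmetric] mult_single) simp
  then show ?thesis
    by (simp add: power3_eq_cube pdiff_mult pdiff_add pdiff_linear_form pdiff_Const pdiff_numeral
        algebra_simps)
qed

text \<open>The Hessian matrix is \<open>6\<close> times the sum of the rank one matrices of the
  five coefficient vectors, weighted by the values \<open>y m\<close>. With the fifth vector
  expressed by the other four it becomes \<open>6\<close> times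
  \<open>transpose L ** (N ** L)\<close>, where \<open>N\<close> is diagonal plus a matrix of rank
  one. The determinant of \<open>N\<close> is linear in the factor \<open>y None\<close> of the rank
  one part, and this linear expression is \<open>syl\<close>.\<close>

lemma eval_hess_sylvester:
  "eval (hess (sylvester z)) x = 6 ^ 4 * (zdet z)\<^sup>2 * syl (relc z) (lvals z x)"
proof -
  define y where "y = lvals z x"
  define b where "b i = (z None i)\<^sup>2" for i
  define L where "L = (\<chi> i v. z (Some i) v)"
  define N where "N = (\<chi> p q. (if p = q then y (Some p) else 0) + y None * b p * b q)"
  have NN: "(transpose L ** (N ** L)) $ i $ j =
      (\<Sum>p\<in>UNIV. \<Sum>q\<in>UNIV. L $ p $ i * (N $ p $ q * L $ q $ j))" for i j
    by (simp add: matrix_matrix_mult_def transpose_def sum_distrib_left)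
  have "eval (pdiff i (pdiff j (sylvester z))) x = (6 *s (transpose L ** (N ** L)) $ i) $ j" for i j
  proof -
    have "eval (pdiff i (pdiff j (sylvester z))) x = (\<Sum>m\<in>UNIV. 6 * coef z m i * coef z m j * y m)"
      by (simp add: sylvester_def pdiff_sum pdiff2_cube eval_simps eval_linear_form y_def lvals_def)
    also have "\<dots> = 6 * ((\<Sum>p\<in>UNIV. L $ p $ i * (y (Some p) * L $ p $ j)) +
        y None * ((\<Sum>p\<in>UNIV. b p * L $ p $ i) * (\<Sum>q\<in>UNIV. b q * L $ q $ j)))"
      by (simp add: sum_option L_def b_def distrib_left sum_distrib_left mult_ac)
    also have "(\<Sum>p\<in>UNIV. L $ p $ i * (y (Some p) * L $ p $ j)) +
        y None * ((\<Sum>p\<in>UNIV. b p * L $ p $ i) * (\<Sum>q\<in>UNIV. b q * L $ q $ j)) =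
        (transpose L ** (N ** L)) $ i $ j"
      unfolding NN unfolding N_def
      by (simp add: sum_product sum_distrib_left distrib_left distrib_right sum.distrib mult_ac
        if_distrib[of "\<lambda>x. _ * x"] cong: if_cong, subst sum.swap, simp add: mult_ac)
    finally show ?thesis by simp
  qed
  then have "eval (hess (sylvester z)) x = det (\<chi> i. 6 *s (transpose L ** (N ** L)) $ i)"
    unfolding hess_def ring_hom_det[OF ring_hom_eval] by (intro arg_cong[where f = det]) (simp add:
        vec_eq_iff)
  also have "\<dots> = 6 ^ 4 * det (transpose L ** (N ** L))"
    unfolding det_rows_mul by (simp add: vec_lambda_eta)
  also have "\<dots> = 6 ^ 4 * (zdet z)\<^sup>2 * det N"
    by (simp add: det_mul zdet_def L_def power2_eq_square mult_ac)
  also have "det N = syl (relc z) y"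
  proof -
    have syl: "syl (relc z) y = (\<Prod>p\<in>UNIV. y (Some p)) +
        y None * (\<Sum>i\<in>UNIV. (b i)\<^sup>2 * (\<Prod>p\<in>UNIV - {i}. y (Some p)))"
    proof -
      have 1: "UNIV - {None} = range (Some :: 4 \<Rightarrow> _)" and
        2: "UNIV - {Some i} = insert None (Some ` (UNIV - {i}))" for i :: 4
        by (auto simp: UNIV_option_conv)
      show ?thesis
        by (simp add: syl_def sum_option 1 2 prod.reindex b_def sum_distrib_left mult_ac)
    qed
    have s: "UNIV - {1} = {2,3,4::4}" "UNIV - {2} = {1,3,4::4}" "UNIV - {3} = {1,2,4::4}" "UNIV - {4} =
        {1,2,3::4}"
      unfolding UNIV_4 by (simp_all add: insert_Diff_if)
    have p: "(\<Prod>p\<in>UNIV. f p) = f 1 * f 2 * f 3 * f 4" for f :: "4 \<Rightarrow> 'a"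
      unfolding UNIV_4 by (simp add: mult_ac)
    have "syl (relc z) y = y (Some 1) * y (Some 2) * y (Some 3) * y (Some 4) +
        y None * ((b 1)\<^sup>2 * (y (Some 2) * y (Some 3) * y (Some 4)) + (b 2)\<^sup>2 * (y (Some 1) * y (Some 3)
            * y (Some 4)) +
        (b 3)\<^sup>2 * (y (Some 1) * y (Some 2) * y (Some 4)) + (b 4)\<^sup>2 * (y (Some 1) * y (Some 2) * y (Some 3)))"
      unfolding syl p sum_4 s by (simp add: mult_ac)
    moreover have "det N = \<dots>"
      unfolding det_4 N_def by (simp add: algebra_simps power2_eq_square)
    ultimately show ?thesis by simp
  qed
  finally show ?thesis by (simp add: y_def)
qed

text \<open>Since the first four forms are independent, \<open>lvals\<close> identifies the points
  \<open>x\<close> with the hyperplane of the relation. So \<open>pentahedron_unique\<close> applies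
  to the map from the values of \<open>z\<close> to those of \<open>z'\<close>, and the common cube
  of the factors becomes \<open>\<theta>\<close>.\<close>

theorem sylvester_unique:
  fixes z z' :: "4 option \<Rightarrow> 4 \<Rightarrow> 'a::field_char_0"
  assumes det: "zdet z \<noteq> 0" "zdet z' \<noteq> 0" and nz: "\<And>i. z None i \<noteq> 0" "\<And>i. z' None i \<noteq> 0"
    and general: "\<And>\<epsilon>. (\<And>i. \<epsilon> i = 1 \<or> \<epsilon> i = - 1) \<Longrightarrow> 1 + (\<Sum>i\<in>UNIV. of_int (\<epsilon> i) * z None i ^ 3) \<noteq> 0"
    and hess: "hess (sylvester z') = hess (sylvester z)"
  shows "\<exists>\<theta>. sylvester z' = Const \<theta> * sylvester z"
proof -
  have hyp_lvals: "hyp (relc y) (lvals y x)" for y :: "4 option \<Rightarrow> 4 \<Rightarrow> 'a" and x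
    by (simp add: hyp_def relc_lvals)
  have hyp_eqI: "v = v'" if "hyp (relc y) v" "hyp (relc y) v'" "\<And>i. v (Some i) = v' (Some i)"
    for y :: "4 option \<Rightarrow> 4 \<Rightarrow> 'a" and v v'
  proof
    fix m
    show "v m = v' m"
    proof (cases m)
      case None
      have "v None + (\<Sum>i\<in>UNIV. (y None i)\<^sup>2 * v (Some i)) = v' None + (\<Sum>i\<in>UNIV. (y None i)\<^sup>2 * v' (Some i))"
        using that(1,2) by (simp add: hyp_def sum_option)
      with that(3) None show ?thesis by simp
    qed (use that(3) in simp)
  qed
  have inverse: "\<exists>B. (\<forall>v. hyp (relc y) v \<longrightarrow> lvals y (\<lambda>w. \<Sum>p\<in>UNIV. B w p * v (Some p)) = v) \<and>
      (\<forall>x. (\<lambda>w. \<Sum>p\<in>UNIV. B w p * lvals y x (Some p)) = x)"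
    if y: "zdet y \<noteq> 0" for y :: "4 option \<Rightarrow> 4 \<Rightarrow> 'a"
  proof -
    define A where "A = (\<chi> i v. y (Some i) v)"
    from y have "invertible A" by (simp add: zdet_def invertible_det_nz A_def)
    then obtain B where AB: "A ** B = mat 1" "B ** A = mat 1" by (auto simp: invertible_def)
    have AB': "(\<Sum>w\<in>UNIV. y (Some i) w * B $ w $ p) = (if i = p then 1 else 0)" for i p
      using arg_cong[OF AB(1), of "\<lambda>M. M $ i $ p"] by (simp add: matrix_matrix_mult_def A_def mat_def)
    have BA': "(\<Sum>p\<in>UNIV. B $ w $ p * y (Some p) v) = (if w = v then 1 else 0)" for w v
      using arg_cong[OF AB(2), of "\<lambda>M. M $ w $ v"] by (simp add: matrix_matrix_mult_def A_def mat_def)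
    have "lvals y (\<lambda>w. \<Sum>p\<in>UNIV. B $ w $ p * v (Some p)) = v" if v: "hyp (relc y) v" for v
    proof (rule hyp_eqI[OF hyp_lvals v])
      fix i
      have "lvals y (\<lambda>w. \<Sum>p\<in>UNIV. B $ w $ p * v (Some p)) (Some i) =
          (\<Sum>p\<in>UNIV. (\<Sum>w\<in>UNIV. y (Some i) w * B $ w $ p) * v (Some p))"
        unfolding lvals_def coef.simps sum_distrib_left sum_distrib_right by (subst sum.swap) (simp add:
            mult.assoc)
      also have "\<dots> = v (Some i)" unfolding AB' by (simp add: if_distrib[of "\<lambda>x. x * _"] cong: if_cong)
      finally show "lvals y (\<lambda>w. \<Sum>p\<in>UNIV. B $ w $ p * v (Some p)) (Some i) = v (Some i)" .
    qed
    moreover have "(\<lambda>w. \<Sum>p\<in>UNIV. B $ w $ p * lvals y x (Some p)) = x" for x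
    proof
      fix w
      have "(\<Sum>p\<in>UNIV. B $ w $ p * lvals y x (Some p)) = (\<Sum>v\<in>UNIV. (\<Sum>p\<in>UNIV. B $ w $ p * y (Some p) v) * x v)"
        unfolding lvals_def coef.simps sum_distrib_left sum_distrib_right by (subst sum.swap) (simp add:
            mult.assoc)
      also have "\<dots> = x w" unfolding BA' by (simp add: if_distrib[of "\<lambda>x. x * _"] cong: if_cong)
      finally show "(\<Sum>p\<in>UNIV. B $ w $ p * lvals y x (Some p)) = x w" .
    qed
    ultimately show ?thesis by (intro exI[of _ "\<lambda>w p. B $ w $ p"]) blast
  qed
  from inverse[OF det(1)] obtain B where
    B: "\<And>v. hyp (relc z) v \<Longrightarrow> lvals z (\<lambda>w. \<Sum>p\<in>UNIV. B w p * v (Some p)) = v"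
      "\<And>x. (\<lambda>w. \<Sum>p\<in>UNIV. B w p * lvals z x (Some p)) = x" by blast
  from inverse[OF det(2)] obtain B' where
    B': "\<And>v. hyp (relc z') v \<Longrightarrow> lvals z' (\<lambda>w. \<Sum>p\<in>UNIV. B' w p * v (Some p)) = v" by blast
  define L where "L i v = lvals z' (\<lambda>w. \<Sum>p\<in>UNIV. B w p * v (Some p)) i" for i v
  \<comment> \<open>The inverse \<open>B\<close> reads only the coordinates \<open>Some p\<close>,
    so the coefficient at \<open>None\<close> is \<open>0\<close>.\<close>
  define a where "a i m = (case m of None \<Rightarrow> 0 | Some p \<Rightarrow> \<Sum>w\<in>UNIV. coef z' i w * B w p)" for i m
  have L: "L i v = (\<Sum>m\<in>UNIV. a i m * v m)" for i v
    unfolding L_def lvals_def a_def sum_option option.simps sum_distrib_left sum_distrib_right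
    by (subst sum.swap) (simp add: mult.assoc)
  have LB: "L i (lvals z x) = lvals z' x i" for i x
    by (simp add: L_def B(2))
  have relc0: "relc z i \<noteq> 0" "relc z' i \<noteq> 0" for i
    using nz by (cases i; simp)+
  have gen: "\<forall>u s. s \<noteq> 0 \<longrightarrow> (\<forall>m. (u m)\<^sup>2 = s * relc z m ^ 3) \<longrightarrow> sum u UNIV \<noteq> 0"
  proof (intro allI impI)
    fix u :: "4 option \<Rightarrow> 'a" and s assume s: "s \<noteq> 0" and u: "\<forall>m. (u m)\<^sup>2 = s * relc z m ^ 3"
    \<comment> \<open>Here the squares in \<open>relc\<close> pay off: \<open>u None\<close> is a
      square root of \<open>s\<close>, and it determines every other \<open>u (Some i)\<close> up to
      a sign.\<close>
    have N: "(u None)\<^sup>2 = s" using u[rule_format, of None] by simp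
    then have N0: "u None \<noteq> 0" using s by auto
    have "\<exists>e::int. (e = 1 \<or> e = - 1) \<and> u (Some i) = u None * (of_int e * z None i ^ 3)" for i
    proof -
      have "(u (Some i))\<^sup>2 = (u None * z None i ^ 3)\<^sup>2"
        using u[rule_format, of "Some i"] N by (simp add: power_mult_distrib flip: power_mult)
      then have "u (Some i) = u None * z None i ^ 3 \<or> u (Some i) = - (u None * z None i ^ 3)"
        by (simp add: power2_eq_iff)
      then show ?thesis
      proof
        assume "u (Some i) = u None * z None i ^ 3"
        then show ?thesis by (intro exI[of _ 1]) simp
      next
        assume "u (Some i) = - (u None * z None i ^ 3)"
        then show ?thesis by (intro exI[of _ "- 1"]) simp
      qed
    qed
    then obtain e where e: "\<And>i. e i = (1::int) \<or> e i = - 1"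
      "\<And>i. u (Some i) = u None * (of_int (e i) * z None i ^ 3)" by metis
    have "sum u UNIV = u None * (1 + (\<Sum>i\<in>UNIV. of_int (e i) * z None i ^ 3))"
      by (simp add: sum_option e(2) distrib_left sum_distrib_left)
    with general[OF e(1)] N0 show "sum u UNIV \<noteq> 0" by simp
  qed
  have card: "CARD(4 option) = 5" by (simp add: UNIV_option_conv card_image)
  have hyp': "hyp (relc z') (\<lambda>i. L i v)" for v
    unfolding L_def by (rule hyp_lvals)
  have surj: "\<exists>v. hyp (relc z) v \<and> (\<forall>i. L i v = w i)" if w: "hyp (relc z') w" for w
  proof (intro exI conjI allI)
    let ?x = "\<lambda>v. \<Sum>p\<in>UNIV. B' v p * w (Some p)"
    show "hyp (relc z) (lvals z ?x)" by (rule hyp_lvals)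
    show "L i (lvals z ?x) = w i" for i by (simp add: LB B'[OF w])
  qed
  have eq: "6 ^ 4 * (zdet z)\<^sup>2 * syl (relc z) v = 6 ^ 4 * (zdet z')\<^sup>2 * syl (relc z') (\<lambda>i. L i v)"
    if v: "hyp (relc z) v" for v
  proof -
    let ?x = "\<lambda>w. \<Sum>p\<in>UNIV. B w p * v (Some p)"
    have "eval (hess (sylvester z)) ?x = eval (hess (sylvester z')) ?x" by (simp add: hess)
    moreover have "(\<lambda>i. L i v) = lvals z' ?x" by (simp add: L_def)
    ultimately show ?thesis by (simp add: eval_hess_sylvester B(1)[OF v])
  qed
  obtain \<pi> \<mu> \<theta> where \<pi>: "bij \<pi>" "\<And>i v. hyp (relc z) v \<Longrightarrow> L i v = \<mu> i * v (\<pi> i)" "\<And>i. \<mu> i ^ 3 = \<theta>"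
    by (rule pentahedron_unique[where b = "relc z" and b' = "relc z'" and C = "6 ^ 4 * (zdet z)\<^sup>2"
        and C' = "6 ^ 4 * (zdet z')\<^sup>2" and a = a and L = L],
        rule card, rule relc0, rule relc0, simp add: det, simp add: det, rule gen, rule L, rule hyp',
            erule surj,
        erule eq, blast)
  have "coef z' i w = \<mu> i * coef z (\<pi> i) w" for i w
  proof -
    \<comment> \<open>Evaluation at a unit vector reads off a coefficient.\<close>
    let ?e = "\<lambda>v. if v = w then 1 else 0"
    have e: "lvals y ?e m = coef y m w" for y :: "4 option \<Rightarrow> 4 \<Rightarrow> 'a" and m by (simp add: lvals_def
        if_distrib cong: if_cong)
    show ?thesis using \<pi>(2)[OF hyp_lvals[of z ?e], of i] by (simp add: LB e)
  qed
  then have "linear_form (coef z' m) = Const (\<mu> m) * linear_form (coef z (\<pi> m))" for m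
    by (simp add: linear_form_def sum_distrib_left mult_single mult.assoc)
  then have "sylvester z' = (\<Sum>m\<in>UNIV. Const \<theta> * linear_form (coef z (\<pi> m)) ^ 3)"
    by (simp add: sylvester_def power_mult_distrib \<pi>(3) flip: ring_hom_power[OF ring_hom_Const])
  also have "\<dots> = (\<Sum>m\<in>UNIV. Const \<theta> * linear_form (coef z m) ^ 3)"
    by (rule sum.reindex_bij_betw[OF \<pi>(1)])
  finally show ?thesis by (auto simp: sylvester_def sum_distrib_left)
qed

section \<open>Prime ideals and residue fields\<close>

definition ring_ideal :: "'a::comm_ring_1 set \<Rightarrow> bool" where
  "ring_ideal I \<longleftrightarrow> 0 \<in> I \<and> (\<forall>x\<in>I. \<forall>y\<in>I. x + y \<in> I) \<and> (\<forall>x\<in>I. \<forall>r. r * x \<in> I)"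

definition prime_ideal :: "'a::comm_ring_1 set \<Rightarrow> bool" where
  "prime_ideal P \<longleftrightarrow> ring_ideal P \<and> 1 \<notin> P \<and> (\<forall>x y. x * y \<in> P \<longrightarrow> x \<in> P \<or> y \<in> P)"

lemma ring_idealD:
  assumes "ring_ideal I"
  shows "0 \<in> I" "x \<in> I \<Longrightarrow> y \<in> I \<Longrightarrow> x + y \<in> I" "x \<in> I \<Longrightarrow> r * x \<in> I" "x \<in> I \<Longrightarrow> - x \<in> I"
    "x \<in> I \<Longrightarrow> y \<in> I \<Longrightarrow> x - y \<in> I"
proof -
  show *: "0 \<in> I" "x \<in> I \<Longrightarrow> y \<in> I \<Longrightarrow> x + y \<in> I" "x \<in> I \<Longrightarrow> r * x \<in> I" for x y r
    using assms by (auto simp: ring_ideal_def)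
  show **: "x \<in> I \<Longrightarrow> - x \<in> I" for x
    using *(3)[of x "- 1"] by simp
  show "x \<in> I \<Longrightarrow> y \<in> I \<Longrightarrow> x - y \<in> I"
    using *(2)[of x "- y"] **[of y] by simp
qed

text \<open>An ideal that is maximal among those containing \<open>J\<close> and no power of
  \<open>g\<close> is prime: if it contains neither \<open>a\<close> nor \<open>b\<close>, enlarging
  it by either one captures a power of \<open>g\<close>, and multiplying these two powers would
  bring a power of \<open>g\<close> into the ideal as soon as \<open>a * b\<close> lies in
  it.\<close>

lemma exists_prime_ideal:
  fixes g :: "'a::comm_ring_1"
  assumes J: "ring_ideal J" and g: "\<And>n. g ^ n \<notin> J"
  obtains P where "prime_ideal P" "J \<subseteq> P" "g \<notin> P"
proof -
  define A where "A = {I. ring_ideal I \<and> J \<subseteq> I \<and> (\<forall>n. g ^ n \<notin> I)}"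
  have "\<exists>M\<in>A. \<forall>X\<in>A. M \<subseteq> X \<longrightarrow> X = M"
  proof (rule subset_Zorn_nonempty)
    show "A \<noteq> {}" using J g by (auto simp: A_def)
  next
    fix C assume C: "C \<noteq> {}" "subset.chain A C"
    then have CA: "\<And>I. I \<in> C \<Longrightarrow> I \<in> A" and lin: "\<And>I I'. I \<in> C \<Longrightarrow> I' \<in> C \<Longrightarrow> I \<subseteq> I' \<or> I' \<subseteq> I"
      by (auto simp: subset.chain_def subset_chain_def)
    have "ring_ideal (\<Union>C)"
      unfolding ring_ideal_def
    proof (intro conjI ballI allI)
      show "0 \<in> \<Union>C" using C(1) CA by (auto simp: A_def ring_ideal_def)
    next
      fix x y assume "x \<in> \<Union>C" "y \<in> \<Union>C"
      then obtain I I' where "I \<in> C" "x \<in> I" "I' \<in> C" "y \<in> I'" by blast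
      with lin[of I I'] CA[of I] CA[of I'] show "x + y \<in> \<Union>C"
        unfolding A_def ring_ideal_def by blast
    next
      fix x r assume "x \<in> \<Union>C"
      then show "r * x \<in> \<Union>C" using CA unfolding A_def ring_ideal_def by blast
    qed
    then show "\<Union>C \<in> A" using C(1) CA unfolding A_def by blast
  qed
  then obtain M where M: "M \<in> A" and max: "\<And>X. X \<in> A \<Longrightarrow> M \<subseteq> X \<Longrightarrow> X = M" by blast
  have id: "ring_ideal M" and JM: "J \<subseteq> M" and gM: "\<And>n. g ^ n \<notin> M" using M by (auto simp: A_def)
  have ext: "\<exists>n r. \<exists>x\<in>M. g ^ n = x + r * a" if a: "a \<notin> M" for a
  proof -
    define X where "X = {x + r * a | x r. x \<in> M}"
    have "ring_ideal X"
      unfolding ring_ideal_def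
    proof (intro conjI ballI allI)
      show "0 \<in> X" unfolding X_def using ring_idealD(1)[OF id] by (auto intro!: exI[of _ 0])
    next
      fix u v assume "u \<in> X" "v \<in> X"
      then obtain x r y s where "u = x + r * a" "v = y + s * a" "x \<in> M" "y \<in> M" by (auto simp: X_def)
      then have "u + v = (x + y) + (r + s) * a" "x + y \<in> M"
        using ring_idealD(2)[OF id, of x y] by (simp_all add: algebra_simps)
      then show "u + v \<in> X" unfolding X_def by blast
    next
      fix u s assume "u \<in> X"
      then obtain x r where "u = x + r * a" "x \<in> M" by (auto simp: X_def)
      then have "s * u = s * x + (s * r) * a" "s * x \<in> M"
        using ring_idealD(3)[OF id, of x s] by (simp_all add: algebra_simps)
      then show "s * u \<in> X" unfolding X_def by blast
    qed
    moreover have "M \<subseteq> X"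
    proof
      fix x assume "x \<in> M"
      moreover have "x = x + 0 * a" by simp
      ultimately show "x \<in> X" unfolding X_def by blast
    qed
    moreover have "a = 0 + 1 * a" by simp
    then have "a \<in> X" unfolding X_def using ring_idealD(1)[OF id] by blast
    ultimately have "X \<notin> A" using max[of X] a by blast
    with \<open>ring_ideal X\<close> \<open>M \<subseteq> X\<close> JM obtain n where "g ^ n \<in> X" unfolding A_def by blast
    then show ?thesis unfolding X_def by blast
  qed
  have "prime_ideal M"
    unfolding prime_ideal_def
  proof (intro conjI allI impI id)
    show "1 \<notin> M" using gM[of 0] by simp
  next
    fix a b assume ab: "a * b \<in> M"
    show "a \<in> M \<or> b \<in> M"
    proof (rule ccontr)
      assume "\<not> (a \<in> M \<or> b \<in> M)"
      then obtain n r x m s y where x: "x \<in> M" "g ^ n = x + r * a" and y: "y \<in> M" "g ^ m = y + s * b"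
        using ext by meson
      have "g ^ (n + m) = (y + s * b) * x + (r * a) * y + (r * s) * (a * b)"
        unfolding power_add x(2) y(2) by (simp add: algebra_simps)
      also have "\<dots> \<in> M" by (intro ring_idealD(2,3)[OF id] x y ab)
      finally show False using gM by blast
    qed
  qed
  with JM gM[of 1] show ?thesis using that by simp
qed

text \<open>
  The type below is the residue ring of a polynomial ring modulo a prime ideal. A type cannot depend
  on an ideal that is obtained inside a proof, so the ideal is fixed once and for all: it is a prime
  ideal modulo which two Sylvester cubics with equal Hessians fail to be proportional, as long as
  there is one.
\<close>

definition bad_prime :: "('v, 'a::field_char_0) mpoly set \<Rightarrow> bool" where
  "bad_prime P \<longleftrightarrow> prime_ideal P \<and> (\<exists>z z'. zdet z \<noteq> 0 \<and> (\<forall>i. z None i \<noteq> 0) \<and>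
     (\<forall>\<epsilon>. (\<forall>i. \<epsilon> i = 1 \<or> \<epsilon> i = - 1) \<longrightarrow> 1 + (\<Sum>i\<in>UNIV. of_int (\<epsilon> i) * z None i ^ 3) \<noteq> 0) \<and>
     zdet z' \<notin> P \<and> (\<forall>i. z' None i \<notin> P) \<and>
     (\<forall>m. lookup (hess (sylvester z')) m - Const (lookup (hess (sylvester z)) m) \<in> P) \<and>
     (\<exists>m n. lookup (sylvester z') m * Const (lookup (sylvester z) n)
        - lookup (sylvester z') n * Const (lookup (sylvester z) m) \<notin> P))"

text \<open>Without a bad prime the choice falls back on the ideal of the origin, which is prime as
  well, so the quotient is a domain in either case.\<close>

definition bad_prime_choice :: "('v, 'a::field_char_0) mpoly set" where
  "bad_prime_choice = (if \<exists>P :: ('v, 'a) mpoly set. bad_prime P then SOME P. bad_prime P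
     else {p. eval p (\<lambda>_. 0) = 0})"

lemma prime_bad_prime_choice: "prime_ideal (bad_prime_choice :: ('v, 'a::field_char_0) mpoly set)"
proof (cases "\<exists>P :: ('v, 'a) mpoly set. bad_prime P")
  case True
  then have "bad_prime (bad_prime_choice :: ('v, 'a) mpoly set)"
    by (simp add: bad_prime_choice_def someI_ex)
  then show ?thesis by (simp add: bad_prime_def)
next
  case False
  then show ?thesis
    by (simp add: bad_prime_choice_def prime_ideal_def ring_ideal_def eval_simps)
qed

lemmas bad_prime_choice_ideal = prime_bad_prime_choice[unfolded prime_ideal_def, THEN conjunct1]

lemma Const_notin_prime:
  assumes "prime_ideal P" "c \<noteq> (0::'a::field)"
  shows "Const c \<notin> P"
proof
  assume "Const c \<in> P"
  moreover have "ring_ideal P" using assms by (simp add: prime_ideal_def)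
  ultimately have "Const (inverse c) * Const c \<in> P" by (intro ring_idealD(3))
  then show False using assms by (simp add: mult_single prime_ideal_def)
qed

\<comment> \<open>The residue ring modulo the chosen prime\<close>
quotient_type (overloaded) ('v, 'a) residue_ring = "('v, 'a::field_char_0) mpoly"
  / "\<lambda>p q. p - q \<in> bad_prime_choice"
proof (rule equivpI)
  note id = ring_idealD[OF bad_prime_choice_ideal]
  show "reflp (\<lambda>p q :: ('v, 'a) mpoly. p - q \<in> bad_prime_choice)"
    by (simp add: reflp_def id(1))
  show "symp (\<lambda>p q :: ('v, 'a) mpoly. p - q \<in> bad_prime_choice)"
    using id(4) by (fastforce simp: symp_def)
  show "transp (\<lambda>p q :: ('v, 'a) mpoly. p - q \<in> bad_prime_choice)"
    using id(2) by (fastforce simp: transp_def)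
qed

instantiation residue_ring :: (type, field_char_0) idom
begin

lift_definition zero_residue_ring :: "('a, 'b) residue_ring" is 0 .

lift_definition one_residue_ring :: "('a, 'b) residue_ring" is 1 .

lift_definition plus_residue_ring :: "('a, 'b) residue_ring \<Rightarrow> ('a, 'b) residue_ring \<Rightarrow> ('a, 'b) residue_ring"
  is "(+)"
proof -
  fix p p' q q' :: "('a, 'b) mpoly"
  assume "p - p' \<in> bad_prime_choice" "q - q' \<in> bad_prime_choice"
  from ring_idealD(2)[OF bad_prime_choice_ideal this]
  show "p + q - (p' + q') \<in> bad_prime_choice" by (simp add: algebra_simps)
qed

lift_definition minus_residue_ring :: "('a, 'b) residue_ring \<Rightarrow> ('a, 'b) residue_ring \<Rightarrow> ('a, 'b) residue_ring"
  is "(-)"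
proof -
  fix p p' q q' :: "('a, 'b) mpoly"
  assume "p - p' \<in> bad_prime_choice" "q - q' \<in> bad_prime_choice"
  from ring_idealD(5)[OF bad_prime_choice_ideal this]
  show "p - q - (p' - q') \<in> bad_prime_choice" by (simp add: algebra_simps)
qed

lift_definition uminus_residue_ring :: "('a, 'b) residue_ring \<Rightarrow> ('a, 'b) residue_ring"
  is uminus
proof -
  fix p p' :: "('a, 'b) mpoly"
  assume "p - p' \<in> bad_prime_choice"
  from ring_idealD(4)[OF bad_prime_choice_ideal this]
  show "- p - - p' \<in> bad_prime_choice" by simp
qed

lift_definition times_residue_ring :: "('a, 'b) residue_ring \<Rightarrow> ('a, 'b) residue_ring \<Rightarrow> ('a, 'b) residue_ring"
  is "(*)"
proof -
  fix p p' q q' :: "('a, 'b) mpoly"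
  assume "p - p' \<in> bad_prime_choice" "q - q' \<in> bad_prime_choice"
  then have "q * (p - p') + p' * (q - q') \<in> bad_prime_choice"
    by (intro ring_idealD(2,3)[OF bad_prime_choice_ideal])
  then show "p * q - p' * q' \<in> bad_prime_choice" by (simp add: algebra_simps)
qed

instance
proof
  have 0: "0 \<in> (bad_prime_choice :: ('a, 'b) mpoly set)" by (rule ring_idealD(1)[OF bad_prime_choice_ideal])
  fix a b c :: "('a, 'b) residue_ring"
  show "a * b * c = a * (b * c)" by transfer (simp add: 0 mult.assoc)
  show "a * b = b * a" by transfer (simp add: 0 mult.commute)
  show "1 * a = a" by transfer (simp add: 0)
  show "a + b + c = a + (b + c)" by transfer (simp add: 0 add.assoc)
  show "a + b = b + a" by transfer (simp add: 0 add.commute)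
  show "0 + a = a" by transfer (simp add: 0)
  show "- a + a = 0" by transfer (simp add: 0)
  show "a - b = a + - b" by transfer (simp add: 0)
  show "(a + b) * c = a * c + b * c" by transfer (simp add: 0 distrib_right)
  show "a * (b + c) = a * b + a * c" by transfer (simp add: 0 distrib_left)
  show "0 * a = 0" "a * 0 = 0" by (transfer, simp add: 0)+
  show "(0 :: ('a, 'b) residue_ring) \<noteq> 1"
  proof transfer
    have "1 \<notin> (bad_prime_choice :: ('a, 'b) mpoly set)"
      using prime_bad_prime_choice[where 'v = 'a and 'a = 'b] by (simp add: prime_ideal_def)
    then show "0 - 1 \<notin> (bad_prime_choice :: ('a, 'b) mpoly set)"
      using ring_idealD(4)[OF bad_prime_choice_ideal, of "0 - 1"] by auto
  qed
  show "a \<noteq> 0 \<Longrightarrow> b \<noteq> 0 \<Longrightarrow> a * b \<noteq> 0"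
  proof transfer
    fix p q :: "('a, 'b) mpoly"
    assume "p - 0 \<notin> bad_prime_choice" "q - 0 \<notin> bad_prime_choice"
    then show "p * q - 0 \<notin> bad_prime_choice"
      using prime_bad_prime_choice[where 'v = 'a and 'a = 'b] unfolding prime_ideal_def by auto
  qed
qed

end

definition residue :: "('v, 'a::field_char_0) mpoly \<Rightarrow> ('v, 'a) residue_ring" where
  "residue = abs_residue_ring"

lemma residue_eq_0_iff: "residue p = 0 \<longleftrightarrow> p \<in> bad_prime_choice"
  by (simp add: residue_def zero_residue_ring_def residue_ring.abs_eq_iff)

lemma ring_hom_residue: "ring_hom residue"
  by (simp add: ring_hom_def residue_def one_residue_ring_def plus_residue_ring.abs_eq
      times_residue_ring.abs_eq)

instance residue_ring :: (type, field_char_0) ring_char_0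
proof
  show "inj (of_nat :: nat \<Rightarrow> ('a, 'b) residue_ring)"
  proof (rule injI, rule ccontr)
    fix m n :: nat assume mn: "(of_nat m :: ('a, 'b) residue_ring) = of_nat n" "m \<noteq> n"
    let ?h = "\<lambda>c. residue (Const c :: ('a, 'b) mpoly)"
    have h: "ring_hom ?h" by (rule ring_hom_comp[OF ring_hom_residue ring_hom_Const])
    have "?h (of_nat m - of_nat n) = 0"
      by (simp only: ring_hom_diff[OF h] ring_hom_of_nat[OF h] mn(1)) simp
    moreover have "of_nat m - of_nat n \<noteq> (0::'b)" using mn(2) by simp
    ultimately show False
      using Const_notin_prime[OF prime_bad_prime_choice] by (simp only: residue_eq_0_iff) blast
  qed
qed

instance fract :: ("{idom, ring_char_0}") field_char_0
proof
  have "(of_nat n :: 'a fract) = to_fract (of_nat n)" for n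
    by (induction n) simp_all
  then show "inj (of_nat :: nat \<Rightarrow> 'a fract)" by (simp add: inj_def)
qed

lemma ring_hom_to_fract: "ring_hom to_fract"
  by (simp add: ring_hom_def)

text \<open>If there were a bad prime, the chosen ideal would be one. Over the fraction field of its
  residue ring the images of \<open>z\<close> and \<open>z'\<close> meet all hypotheses of
  \<open>sylvester_unique\<close>: elements outside the ideal become nonzero, and congruences become
  equalities. Proportional cubics have vanishing minors, against the last clause of
  \<open>bad_prime\<close>.\<close>

theorem no_bad_prime: "\<not> bad_prime (P :: ('v, 'a::field_char_0) mpoly set)"
proof
  assume "bad_prime P"
  then have "\<exists>P :: ('v, 'a) mpoly set. bad_prime P" by (rule exI)
  then have "bad_prime (bad_prime_choice :: ('v, 'a) mpoly set)"
    by (simp add: bad_prime_choice_def someI_ex)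
  then show False
    unfolding bad_prime_def
  proof (elim conjE exE)
    fix z :: "4 option \<Rightarrow> 4 \<Rightarrow> 'a" and z' :: "4 option \<Rightarrow> 4 \<Rightarrow> ('v, 'a) mpoly" and m n
    assume z: "zdet z \<noteq> 0" "\<forall>i. z None i \<noteq> 0"
      "\<forall>\<epsilon>. (\<forall>i. \<epsilon> i = 1 \<or> \<epsilon> i = - 1) \<longrightarrow> 1 + (\<Sum>i\<in>UNIV. of_int (\<epsilon> i) * z None i ^ 3) \<noteq> 0"
      and z': "zdet z' \<notin> bad_prime_choice" "\<forall>i. z' None i \<notin> bad_prime_choice"
      and H: "\<forall>m. lookup (hess (sylvester z')) m - Const (lookup (hess (sylvester z)) m) \<in> bad_prime_choice"
      and F: "lookup (sylvester z') m * Const (lookup (sylvester z) n)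
          - lookup (sylvester z') n * Const (lookup (sylvester z) m) \<notin> bad_prime_choice"
    define h where "h p = to_fract (residue p)" for p :: "('v, 'a) mpoly"
    define g where "g c = h (Const c)" for c
    have h: "ring_hom h" unfolding h_def by (rule ring_hom_comp[OF ring_hom_to_fract ring_hom_residue])
    have g: "ring_hom g" unfolding g_def by (rule ring_hom_comp[OF h ring_hom_Const])
    have h0: "h p = 0 \<longleftrightarrow> p \<in> bad_prime_choice" for p by (simp add: h_def residue_eq_0_iff)
    have g0: "g c = 0 \<longleftrightarrow> c = 0" for c
      using Const_notin_prime[OF prime_bad_prime_choice, of c] ring_hom_0[OF g]
      by (metis g_def h0)
    define y where "y = (\<lambda>m v. g (z m v))"
    define y' where "y' = (\<lambda>m v. h (z' m v))"
    have Ly: "lookup (sylvester y) k = g (lookup (sylvester z) k)" for k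
      using lookup_map_coeffs[of g "sylvester z" k, OF ring_hom_0[OF g]] by (simp add: y_def
          sylvester_hom[OF g])
    have Ly': "lookup (sylvester y') k = h (lookup (sylvester z') k)" for k
      using lookup_map_coeffs[of h "sylvester z'" k, OF ring_hom_0[OF h]] by (simp add: y'_def
          sylvester_hom[OF h])
    have "\<exists>\<theta>. sylvester y' = Const \<theta> * sylvester y"
    proof (rule sylvester_unique)
      show "zdet y \<noteq> 0" unfolding y_def zdet_hom[OF g, symmetric] g0 by (rule z(1))
      show "zdet y' \<noteq> 0" unfolding y'_def zdet_hom[OF h, symmetric] h0 by (rule z'(1))
      show "y None i \<noteq> 0" "y' None i \<noteq> 0" for i by (simp_all add: y_def y'_def g0 h0 z(2) z'(2))
      show "1 + (\<Sum>i\<in>UNIV. of_int (\<epsilon> i) * y None i ^ 3) \<noteq> 0" if "\<And>i. \<epsilon> i = 1 \<or> \<epsilon> i = - 1" for \<epsilon>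
      proof -
        have "1 + (\<Sum>i\<in>UNIV. of_int (\<epsilon> i) * y None i ^ 3) = g (1 + (\<Sum>i\<in>UNIV. of_int (\<epsilon> i) * z None i ^ 3))"
          by (simp add: y_def ring_hom_simps[OF g])
        with z(3)[rule_format, of \<epsilon>] that show ?thesis by (simp add: g0)
      qed
      show "hess (sylvester y') = hess (sylvester y)"
      proof (rule poly_mapping_eqI)
        fix k
        have "lookup (hess (sylvester y')) k = h (lookup (hess (sylvester z')) k)"
          using lookup_map_coeffs[of h "hess (sylvester z')" k, OF ring_hom_0[OF h]]
          by (simp add: map_coeffs_hess[OF h] sylvester_hom[OF h] y'_def)
        also have "\<dots> = g (lookup (hess (sylvester z)) k)"
          using H[rule_format, of k] by (simp add: g_def ring_hom_diff[OF h] flip: h0)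
        also have "\<dots> = lookup (hess (sylvester y)) k"
          using lookup_map_coeffs[of g "hess (sylvester z)" k, OF ring_hom_0[OF g]]
          by (simp add: map_coeffs_hess[OF g] sylvester_hom[OF g] y_def)
        finally show "lookup (hess (sylvester y')) k = lookup (hess (sylvester y)) k" .
      qed
    qed
    then obtain \<theta> where "sylvester y' = Poly_Mapping.map ((*) \<theta>) (sylvester y)"
      by (auto simp: mult_map_scale_conv_mult)
    then have "lookup (sylvester y') k = \<theta> * lookup (sylvester y) k" for k
      by (simp add: Poly_Mapping.map.rep_eq when_def)
    then have "h (lookup (sylvester z') m * Const (lookup (sylvester z) n)
          - lookup (sylvester z') n * Const (lookup (sylvester z) m)) = 0"
      by (simp add: ring_hom_simps[OF h] flip: Ly' g_def) (simp add: Ly)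
    with F h0 show False by blast
  qed
qed

section \<open>Descent to a subfield\<close>

definition subfield :: "'a::field set \<Rightarrow> bool" where
  "subfield L \<longleftrightarrow> 1 \<in> L \<and> (\<forall>x\<in>L. \<forall>y\<in>L. x - y \<in> L \<and> x * y \<in> L) \<and> (\<forall>x\<in>L. inverse x \<in> L)"

lemma subfieldD:
  assumes L: "subfield L"
  shows "1 \<in> L" "0 \<in> L" "x \<in> L \<Longrightarrow> y \<in> L \<Longrightarrow> x - y \<in> L" "x \<in> L \<Longrightarrow> y \<in> L \<Longrightarrow> x * y \<in> L"
    "x \<in> L \<Longrightarrow> inverse x \<in> L" "x \<in> L \<Longrightarrow> - x \<in> L" "x \<in> L \<Longrightarrow> y \<in> L \<Longrightarrow> x + y \<in> L"
    "of_nat n \<in> L" "x \<in> L \<Longrightarrow> x ^ n \<in> L"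
proof -
  show 1: "1 \<in> L" and diff: "x \<in> L \<Longrightarrow> y \<in> L \<Longrightarrow> x - y \<in> L" and mult: "x \<in> L \<Longrightarrow> y \<in> L \<Longrightarrow> x * y \<in> L"
    and "x \<in> L \<Longrightarrow> inverse x \<in> L" for x y using L by (auto simp: subfield_def)
  show 0: "0 \<in> L" using diff[OF 1 1] by simp
  show neg: "x \<in> L \<Longrightarrow> - x \<in> L" for x using diff[OF 0, of x] by simp
  show add: "x \<in> L \<Longrightarrow> y \<in> L \<Longrightarrow> x + y \<in> L" for x y using diff[of x "- y"] neg[of y] by simp
  show "of_nat n \<in> L" by (induction n) (auto simp: 0 1 add)
  show "x \<in> L \<Longrightarrow> x ^ n \<in> L" by (induction n) (auto simp: 1 mult)
qed

definition linear_over :: "'a::field set \<Rightarrow> ('a \<Rightarrow> 'a) \<Rightarrow> bool" where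
  "linear_over L f \<longleftrightarrow> (\<forall>x y. f (x + y) = f x + f y) \<and> (\<forall>c\<in>L. \<forall>x. f (c * x) = c * f x)"

lemma linear_overD:
  assumes "linear_over L f"
  shows "f (x + y) = f x + f y" "c \<in> L \<Longrightarrow> f (c * x) = c * f x" "f 0 = 0"
proof -
  show *: "f (x + y) = f x + f y" "c \<in> L \<Longrightarrow> f (c * x) = c * f x" for x y c
    using assms by (auto simp: linear_over_def)
  have "f 0 + f 0 = f 0 + 0" using *(1)[of 0 0] by (simp only: add_0_right)
  then show "f 0 = 0" by (simp only: add_left_cancel)
qed

lemma linear_over_sum: "linear_over L f \<Longrightarrow> f (sum g A) = (\<Sum>a\<in>A. f (g a))"
  by (induction A rule: infinite_finite_induct) (simp_all add: linear_overD)

text \<open>A complement of \<open>L\<close> is found as a subspace that is maximal among those not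
  containing \<open>1\<close>. Each \<open>v\<close> is then congruent to exactly one element of
  \<open>L\<close>, and this element is the value of the retraction.\<close>

lemma exists_retraction:
  fixes L :: "'a::field set"
  assumes L: "subfield L"
  obtains f where "linear_over L f" "f 1 = 1" "\<And>x. f x \<in> L"
proof -
  define A where "A = {S. 0 \<in> S \<and> 1 \<notin> S \<and> (\<forall>x\<in>S. \<forall>y\<in>S. x + y \<in> S) \<and> (\<forall>c\<in>L. \<forall>x\<in>S. c * x \<in> S)}"
  have "\<exists>M\<in>A. \<forall>X\<in>A. M \<subseteq> X \<longrightarrow> X = M"
  proof (rule subset_Zorn_nonempty)
    show "A \<noteq> {}" by (auto simp: A_def intro!: exI[of _ "{0}"])
  next
    fix C assume C: "C \<noteq> {}" "subset.chain A C"
    then have CA: "\<And>I. I \<in> C \<Longrightarrow> I \<in> A" and lin: "\<And>I I'. I \<in> C \<Longrightarrow> I' \<in> C \<Longrightarrow> I \<subseteq> I' \<or> I' \<subseteq> I"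
      by (auto simp: subset.chain_def subset_chain_def)
    have add: "x + y \<in> \<Union>C" if "x \<in> \<Union>C" "y \<in> \<Union>C" for x y
    proof -
      from that obtain I I' where "I \<in> C" "x \<in> I" "I' \<in> C" "y \<in> I'" by blast
      with lin[of I I'] CA[of I] CA[of I'] show ?thesis unfolding A_def by blast
    qed
    moreover have "c * x \<in> \<Union>C" if "c \<in> L" "x \<in> \<Union>C" for x c
      using that CA unfolding A_def by blast
    moreover have "0 \<in> \<Union>C" "1 \<notin> \<Union>C" using C(1) CA unfolding A_def by blast+
    ultimately show "\<Union>C \<in> A" unfolding A_def by blast
  qed
  then obtain M where M: "M \<in> A" and max: "\<And>X. X \<in> A \<Longrightarrow> M \<subseteq> X \<Longrightarrow> X = M" by blast
  have M0: "0 \<in> M" and M1: "1 \<notin> M" and Madd: "\<And>x y. x \<in> M \<Longrightarrow> y \<in> M \<Longrightarrow> x + y \<in> M"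
    and Mmult: "\<And>c x. c \<in> L \<Longrightarrow> x \<in> M \<Longrightarrow> c * x \<in> M"
    using M by (auto simp: A_def)
  have Mdiff: "x - y \<in> M" if "x \<in> M" "y \<in> M" for x y
    using Madd[OF that(1) Mmult[OF subfieldD(6)[OF L subfieldD(1)[OF L]] that(2)]] by simp
  have ex: "\<exists>c\<in>L. v - c \<in> M" for v
  proof (cases "v \<in> M")
    case True
    then show ?thesis using subfieldD(2)[OF L] by (intro bexI[of _ 0]) auto
  next
    case False
    define X where "X = {m + c * v | m c. m \<in> M \<and> c \<in> L}"
    have "M \<subseteq> X"
    proof
      fix m assume "m \<in> M"
      moreover have "m = m + 0 * v" by simp
      ultimately show "m \<in> X" unfolding X_def using subfieldD(2)[OF L] by blast
    qed
    moreover have "v \<in> X"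
    proof -
      have "v = 0 + 1 * v" by simp
      then show ?thesis unfolding X_def using M0 subfieldD(1)[OF L] by blast
    qed
    ultimately have "X \<notin> A" using max[of X] False by blast
    moreover have "0 \<in> X" using M0 \<open>M \<subseteq> X\<close> by blast
    moreover have "x + y \<in> X" if xy: "x \<in> X" "y \<in> X" for x y
    proof -
      from xy obtain m c m' c' where "x = m + c * v" "y = m' + c' * v" "m \<in> M" "c \<in> L" "m' \<in> M" "c' \<in> L"
        by (auto simp: X_def)
      then have "x + y = (m + m') + (c + c') * v" "m + m' \<in> M" "c + c' \<in> L"
        by (auto simp: algebra_simps Madd subfieldD(7)[OF L])
      then show ?thesis unfolding X_def by blast
    qed
    moreover have "d * x \<in> X" if d: "d \<in> L" and x: "x \<in> X" for d x
    proof -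
      from x obtain m c where "x = m + c * v" "m \<in> M" "c \<in> L" by (auto simp: X_def)
      then have "d * x = d * m + (d * c) * v" "d * m \<in> M" "d * c \<in> L"
        using d by (auto simp: algebra_simps Mmult subfieldD(4)[OF L])
      then show ?thesis unfolding X_def by blast
    qed
    ultimately have "1 \<in> X" unfolding A_def by blast
    then obtain m c where mc: "1 = m + c * v" "m \<in> M" "c \<in> L" by (auto simp: X_def)
    have c: "c \<noteq> 0" using mc M1 by auto
    \<comment> \<open>Enlarging \<open>M\<close> by \<open>v\<close> captured
      \<open>1 = m + c * v\<close>, so \<open>v\<close> is congruent to
      \<open>inverse c\<close>.\<close>
    have "v - inverse c = inverse c * (c * v - 1)" using c by (simp add: right_diff_distrib)
    also have "c * v - 1 = - m" unfolding mc(1) by simp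
    finally have "v - inverse c = - inverse c * m" by simp
    then have "v - inverse c \<in> M" using Mmult[of "- inverse c" m] mc L by (simp add: subfieldD)
    then show ?thesis using mc(3) L by (auto simp: subfieldD)
  qed
  have uniq: "c = c'" if "c \<in> L" "c' \<in> L" "v - c \<in> M" "v - c' \<in> M" for c c' v
  proof (rule ccontr)
    assume "c \<noteq> c'"
    moreover have "c' - c \<in> M" using Mdiff[OF that(3,4)] by simp
    then have "inverse (c' - c) * (c' - c) \<in> M" using that L by (intro Mmult) (auto simp: subfieldD)
    ultimately show False using M1 by simp
  qed
  from ex obtain f where f: "\<And>v. f v \<in> L" "\<And>v. v - f v \<in> M" by metis
  have "f (x + y) = f x + f y" for x y
    using Madd[OF f(2)[of x] f(2)[of y]] f L
    by (intro uniq[of _ _ "x + y"]) (auto simp: subfieldD algebra_simps)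
  moreover have "f (c * x) = c * f x" if "c \<in> L" for c x
    using Mmult[OF that f(2)[of x]] f L that
    by (intro uniq[of _ _ "c * x"]) (auto simp: subfieldD algebra_simps)
  moreover have "f 1 = 1"
    using f M0 L by (intro uniq[of _ _ 1]) (auto simp: subfieldD)
  ultimately show ?thesis using f(1) that[of f] by (simp add: linear_over_def)
qed

section \<open>Commutators of functionals with multiplication by a field element\<close>

definition twist :: "'a::field \<Rightarrow> ('a \<Rightarrow> 'a) \<Rightarrow> 'a \<Rightarrow> 'a" where
  "twist t f = (\<lambda>v. f (t * v) - t * f v)"

lemma linear_over_twist: "linear_over L f \<Longrightarrow> linear_over L (twist t f)"
  by (simp add: linear_over_def twist_def algebra_simps)

lemma linear_over_twist_power: "linear_over L f \<Longrightarrow> linear_over L ((twist t ^^ n) f)"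
  by (induction n) (simp_all add: linear_over_twist)

definition coeffs_in :: "'a::zero set \<Rightarrow> 'a poly \<Rightarrow> bool" where
  "coeffs_in L p \<longleftrightarrow> (\<forall>i. coeff p i \<in> L)"

text \<open>Each further twist contributes one factor \<open>- t\<close>, while the values of
  \<open>f\<close> stay in \<open>L\<close>. Vanishing of an iterated twist is therefore an
  algebraic equation for \<open>t\<close>, and if \<open>f 1 = 1\<close> it is nontrivial because
  its leading coefficient at \<open>v = 1\<close> is a sign.\<close>

lemma twist_power_poly:
  assumes L: "subfield L" and f: "\<And>v. f v \<in> L"
  shows "\<exists>p. coeffs_in L p \<and> degree p \<le> n \<and> coeff p n = (- 1) ^ n * f v \<and> (twist t ^^ n) f v = poly p t"
proof (induction n arbitrary: v)
  case 0
  show ?case by (intro exI[of _ "[:f v:]"]) (auto simp: coeffs_in_def f coeff_pCons subfieldD(2)[OF L]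
      split: nat.split)
next
  case (Suc n)
  from Suc[of "t * v"] obtain p where p: "coeffs_in L p" "degree p \<le> n" "(twist t ^^ n) f (t * v) = poly p t"
    by blast
  from Suc[of v] obtain q where q: "coeffs_in L q" "degree q \<le> n" "coeff q n = (- 1) ^ n * f v"
    "(twist t ^^ n) f v = poly q t" by blast
  have "coeffs_in L (p - pCons 0 q)"
    using p(1) q(1) L by (auto simp: coeffs_in_def coeff_pCons subfieldD split: nat.split)
  moreover have "degree (p - pCons 0 q) \<le> Suc n"
    using p(2) q(2) by (intro degree_diff_le) (auto simp: degree_pCons_eq_if)
  moreover have "coeff (p - pCons 0 q) (Suc n) = (- 1) ^ Suc n * f v"
    using p(2) q(3) by (simp add: coeff_eq_0)
  moreover have "(twist t ^^ Suc n) f v = poly (p - pCons 0 q) t"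
    by (simp add: twist_def[of t "(twist t ^^ n) f"] p(3) q(4))
  ultimately show ?case by blast
qed

text \<open>Separability in characteristic zero: the derivative of a polynomial of least degree with
  root \<open>t\<close> is nonzero and of smaller degree, hence cannot vanish at
  \<open>t\<close>.\<close>

lemma minimal_polynomial_simple_root:
  fixes t :: "'a::field_char_0"
  assumes L: "subfield L" and p: "coeffs_in L p" "p \<noteq> 0" "poly p t = 0"
  obtains m where "coeffs_in L m" "poly m t = 0" "poly (pderiv m) t \<noteq> 0"
proof -
  define Q where "Q m \<longleftrightarrow> coeffs_in L m \<and> m \<noteq> 0 \<and> poly m t = 0" for m
  have "Q p" using p by (simp add: Q_def)
  then obtain m where m: "Q m" and min: "\<And>q. Q q \<Longrightarrow> degree m \<le> degree q"
    using ex_has_least_nat[of Q p degree] by blast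
  have "degree m \<noteq> 0"
  proof
    assume "degree m = 0"
    then obtain c where "m = [:c:]" by (rule degree_eq_zeroE)
    with m show False by (simp add: Q_def)
  qed
  then have d: "pderiv m \<noteq> 0" "degree (pderiv m) < degree m"
    by (simp_all add: pderiv_eq_0_iff degree_pderiv)
  have "coeffs_in L (pderiv m)"
    using m L by (auto simp: coeffs_in_def coeff_pderiv Q_def intro!: subfieldD simp del: of_nat_Suc)
  then have "poly (pderiv m) t \<noteq> 0" using min[of "pderiv m"] d by (auto simp: Q_def)
  with m show ?thesis using that by (auto simp: Q_def)
qed

text \<open>
  \<open>twist t\<close> is the action of \<open>1 \<otimes> t - t \<otimes> 1\<close> on functionals. Since the extension is separable, this
  element of \<open>K \<otimes>\<^sub>L K\<close> cannot be nilpotent without being zero.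
\<close>

theorem twist_nilpotent:
  fixes t :: "'a::field_char_0"
  assumes L: "subfield L" and f: "linear_over L f" "f 1 = 1" "\<And>v. f v \<in> L"
    and nil: "(twist t ^^ N) f = (\<lambda>_. 0)"
  shows "t \<in> L"
proof -
  obtain p where "coeffs_in L p" "coeff p N = (- 1) ^ N" "poly p t = 0"
    using twist_power_poly[where f = f and n = N and v = 1 and t = t, OF L f(3)] nil f(2) by auto
  then have p: "coeffs_in L p" "p \<noteq> 0" "poly p t = 0" by auto
  obtain m where m: "coeffs_in L m" "poly m t = 0" "poly (pderiv m) t \<noteq> 0"
    by (rule minimal_polynomial_simple_root[OF L p])
  define n where "n = (LEAST n. (twist t ^^ n) f = (\<lambda>_. 0))"
  have n: "(twist t ^^ n) f = (\<lambda>_. 0)" unfolding n_def by (rule LeastI) (rule nil)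
  have min: "(twist t ^^ k) f \<noteq> (\<lambda>_. 0)" if "k < n" for k
    using not_less_Least[OF that[unfolded n_def]] .
  have "n \<noteq> 0"
  proof
    assume "n = 0"
    with n have "f 1 = 0" by simp
    with f(2) show False by simp
  qed
  moreover have "n < 2"
  proof (rule ccontr)
    assume "\<not> n < 2"
    then obtain k where k: "n = Suc (Suc k)" by (metis add_2_eq_Suc le_Suc_ex not_less)
    \<comment> \<open>If at least two twists are needed, the last nonzero iterate
      \<open>\<kappa>\<close> commutes with \<open>t\<close>, and its predecessor
      \<open>\<rho>\<close> obeys a Leibniz rule with \<open>\<kappa>\<close> as correction term.
      Applied to the powers in \<open>m\<close> this gives
      \<open>m(t) \<rho> + m'(t) \<kappa> = 0\<close>. As \<open>t\<close> is a simple root,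
      \<open>\<kappa>\<close> vanishes, a contradiction.\<close>
    define \<rho> where "\<rho> = (twist t ^^ k) f"
    define \<kappa> where "\<kappa> = twist t \<rho>"
    have \<rho>lin: "linear_over L \<rho>" unfolding \<rho>_def by (rule linear_over_twist_power[OF f(1)])
    have "twist t \<kappa> = (\<lambda>_. 0)" using n by (simp add: k \<kappa>_def \<rho>_def)
    then have \<kappa>: "\<kappa> (t * v) = t * \<kappa> v" for v by (simp add: twist_def fun_eq_iff)
    have \<kappa>_pow: "\<kappa> (t ^ i * v) = t ^ i * \<kappa> v" for i v
      by (induction i) (simp_all add: \<kappa> mult.assoc)
    have \<rho>: "\<rho> (t * v) = t * \<rho> v + \<kappa> v" for v by (simp add: \<kappa>_def twist_def)
    have \<rho>_pow: "\<rho> (t ^ i * v) = t ^ i * \<rho> v + of_nat i * t ^ (i - 1) * \<kappa> v" for i v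
    proof (induction i)
      case (Suc i)
      have "\<rho> (t ^ Suc i * v) = t * \<rho> (t ^ i * v) + \<kappa> (t ^ i * v)" by (simp add: mult.assoc \<rho>)
      also have "\<dots> = t ^ Suc i * \<rho> v + of_nat (Suc i) * t ^ i * \<kappa> v"
        unfolding Suc \<kappa>_pow by (cases i) (simp_all add: algebra_simps)
      finally show ?case by simp
    qed simp
    have "pderiv m = (\<Sum>i\<le>degree m. Polynomial.monom (of_nat i * coeff m i) (i - 1))"
      by (subst (1) poly_as_sum_of_monoms[symmetric])
        (simp add: higher_pderiv_sum[of 1, simplified] pderiv_monom)
    then have dm: "poly (pderiv m) t = (\<Sum>i\<le>degree m. coeff m i * (of_nat i * t ^ (i - 1)))"
      by (simp add: poly_sum poly_monom mult_ac)
    have "\<kappa> v = 0" for v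
    proof -
      have "0 = \<rho> (poly m t * v)" using linear_overD(3)[OF \<rho>lin] by (simp add: m(2))
      also have "\<dots> = (\<Sum>i\<le>degree m. \<rho> (coeff m i * (t ^ i * v)))"
        by (simp add: poly_altdef sum_distrib_right mult.assoc linear_over_sum[OF \<rho>lin])
      also have "\<dots> = (\<Sum>i\<le>degree m. coeff m i * (t ^ i * \<rho> v + of_nat i * t ^ (i - 1) * \<kappa> v))"
        using m(1) by (intro sum.cong refl) (simp add: coeffs_in_def linear_overD(2)[OF \<rho>lin] \<rho>_pow)
      also have "\<dots> = poly m t * \<rho> v + poly (pderiv m) t * \<kappa> v"
        unfolding dm poly_altdef[of m] by (simp add: sum_distrib_right sum.distrib distrib_left mult.assoc)
      finally show ?thesis using m(2,3) by simp
    qed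
    then have "(twist t ^^ Suc k) f = (\<lambda>_. 0)" by (simp add: \<kappa>_def \<rho>_def fun_eq_iff)
    with min[of "Suc k"] k show False by simp
  qed
  ultimately have "n = 1" by simp
  then have "f (t * v) = t * f v" for v using n by (simp add: twist_def fun_eq_iff)
  \<comment> \<open>A retraction that commutes with \<open>t\<close> sends \<open>t = t * 1\<close>
    to \<open>t\<close> itself, and its values lie in \<open>L\<close>.\<close>
  from this[of 1] f(2) f(3)[of t] show ?thesis by simp
qed

text \<open>
  Sends \<open>\<Sum> c\<^sub>m X\<^sup>m\<close> to \<open>\<Sum> c\<^sub>m f (z\<^sup>m v)\<close>; these functionals detect vanishing in \<open>K \<otimes>\<^sub>L K\<close>, where \<open>X\<close>
  stands for \<open>1 \<otimes> z\<close>.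
\<close>

definition slice :: "('a \<Rightarrow> 'a) \<Rightarrow> ('v \<Rightarrow> 'a::field) \<Rightarrow> 'a \<Rightarrow> ('v, 'a) mpoly \<Rightarrow> 'a" where
  "slice f z v q = (\<Sum>m\<in>keys q. lookup q m * f (monom_eval m z * v))"

context
  fixes L :: "'a::field_char_0 set" and f :: "'a \<Rightarrow> 'a" and z :: "'v \<Rightarrow> 'a"
  assumes L: "subfield L" and f: "linear_over L f" "f 1 = 1" "\<And>v. f v \<in> L"
begin

lemma slice_superset:
  assumes "finite A" "keys q \<subseteq> A"
  shows "slice f z v q = (\<Sum>m\<in>A. lookup q m * f (monom_eval m z * v))"
  unfolding slice_def using assms by (intro sum.mono_neutral_left) (auto simp: in_keys_iff)

lemma slice_add: "slice f z v (p + q) = slice f z v p + slice f z v q"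
proof -
  let ?A = "keys p \<union> keys q"
  have "slice f z v (p + q) = (\<Sum>m\<in>?A. lookup (p + q) m * f (monom_eval m z * v))"
    by (rule slice_superset) (auto simp: Poly_Mapping.keys_add)
  then show ?thesis
    by (simp add: slice_superset[of ?A p] slice_superset[of ?A q] lookup_add distrib_right sum.distrib)
qed

lemma slice_0 [simp]: "slice f z v 0 = 0"
  by (simp add: slice_def)

lemma slice_single: "slice f z v (single m a) = a * f (monom_eval m z * v)"
  using slice_superset[of "{m}" "single m a" v] by simp

lemma slice_single_mult:
  "slice f z v (single m a * q) = a * slice f z (monom_eval m z * v) q"
  by (induction q rule: poly_mapping_single_induct)
    (simp_all add: slice_add slice_single mult_single monom_eval_add algebra_simps)

lemma slice_uminus: "slice f z v (- q) = - slice f z v q"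
  using slice_add[of v q "- q"] by (simp add: eq_neg_iff_add_eq_0 add.commute)

lemma slice_add_arg: "slice f z (v + w) q = slice f z v q + slice f z w q"
  by (simp add: slice_def distrib_left linear_overD(1)[OF f(1)] sum.distrib)

lemma slice_mult_arg: "c \<in> L \<Longrightarrow> slice f z (c * v) q = c * slice f z v q"
  by (simp add: slice_def mult.left_commute[of _ c] linear_overD(2)[OF f(1)] sum_distrib_left)

lemma slice_zero_arg: "slice f z 0 q = 0"
  by (simp add: slice_def linear_overD(3)[OF f(1)])

text \<open>A polynomial over \<open>L\<close> represents \<open>1 \<otimes> p(z)\<close>, since its
  coefficients may be moved from one tensor factor to the other; so it acts by multiplying the
  argument \<open>v\<close>.\<close>

lemma slice_mult:
  assumes "\<And>m. lookup p m \<in> L"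
  shows "slice f z v (p * q) = slice f z (eval p z * v) q"
proof -
  have sum_l: "slice f z v ((\<Sum>m\<in>A. g m) * q) = (\<Sum>m\<in>A. slice f z v (g m * q))" for A :: "'v monomial set" and g
    by (induction A rule: infinite_finite_induct) (simp_all add: slice_add distrib_right)
  have sum_r: "slice f z (\<Sum>m\<in>A. g m) q = (\<Sum>m\<in>A. slice f z (g m) q)" for A :: "'v monomial set" and g
    by (induction A rule: infinite_finite_induct) (simp_all add: slice_add_arg slice_zero_arg)
  have "slice f z v (p * q) = (\<Sum>m\<in>keys p. lookup p m * slice f z (monom_eval m z * v) q)"
    by (subst poly_mapping_sum_singles[of p]) (simp only: sum_l slice_single_mult)
  also have "\<dots> = slice f z (eval p z * v) q"
    unfolding eval_eq_evalh evalh_def sum_distrib_right sum_r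
    by (intro sum.cong refl) (simp add: mult.assoc slice_mult_arg assms)
  finally show ?thesis .
qed

text \<open>Letting \<open>v\<close> vary makes the common kernel an ideal, because multiplication
  by a monomial only changes \<open>v\<close>.\<close>

lemma ring_ideal_slice: "ring_ideal {q. \<forall>v. slice f z v q = 0}"
proof -
  have "slice f z v (r * q) = 0" if q: "\<forall>v. slice f z v q = 0" for r q v
    by (induction r rule: poly_mapping_single_induct) (simp_all add: distrib_right slice_add
        slice_single_mult q)
  then show ?thesis by (auto simp: ring_ideal_def slice_add)
qed

end

text \<open>As \<open>eval (\<Phi> j) z\<close> lies in \<open>L\<close>, it may pass to the other
  tensor factor, which makes \<open>\<Phi> j\<close> congruent to a constant modulo
  \<open>J\<close>. The element \<open>w * D\<close> is not nilpotent modulo \<open>J\<close>, for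
  otherwise \<open>twist_nilpotent\<close> would put the ratio into \<open>L\<close>; so some prime
  ideal over \<open>J\<close> contains neither \<open>w\<close> nor \<open>D\<close>.\<close>

theorem descent_prime_ideal:
  fixes L :: "'a::field_char_0 set" and z :: "'v \<Rightarrow> 'a"
  assumes L: "subfield L"
    and coeffs: "\<And>m. lookup A m \<in> L" "\<And>m. lookup B m \<in> L" "\<And>m. lookup w m \<in> L"
      "\<And>j m. lookup (\<Phi> j) m \<in> L"
    and \<Phi>: "\<And>j. eval (\<Phi> j) z \<in> L"
    and w: "eval w z \<noteq> 0" and B: "eval B z \<noteq> 0" and t: "eval A z / eval B z \<notin> L"
  obtains P where "prime_ideal P" "\<And>j. \<Phi> j - Const (eval (\<Phi> j) z) \<in> P" "w \<notin> P"
    "A * Const (eval B z) - B * Const (eval A z) \<notin> P"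
proof -
  obtain f where f: "linear_over L f" "f 1 = 1" "\<And>v. f v \<in> L" by (rule exists_retraction[OF L]) blast
  note sl = slice_add[OF L f, of z] slice_uminus[OF L f, of z] slice_single[OF L f, of z]
    slice_single_mult[OF L f, of z] slice_mult[OF L f, of _ z]
  define J where "J = {q. \<forall>v. slice f z v q = 0}"
  have J: "ring_ideal J" unfolding J_def by (rule ring_ideal_slice[OF L f])
  define D where "D = A * Const (eval B z) - B * Const (eval A z)"
  define t where "t = eval A z / eval B z"
  have A: "eval A z = t * eval B z" using B by (simp add: t_def)
  \<comment> \<open>Up to the factor \<open>eval B z\<close>, multiplication by \<open>D\<close> is
    a twist by \<open>t\<close>, because \<open>A(z) = t B(z)\<close>.\<close>
  have D: "slice f z v (D * q) = eval B z * (slice f z (eval A z * v) q - t * slice f z (eval B z * v)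
      q)" for v q
  proof -
    have "D * q = Const (eval B z) * (A * q) + - (Const (eval A z) * (B * q))" by (simp add: D_def
        algebra_simps)
    then have "slice f z v (D * q) = eval B z * slice f z (eval A z * v) q - eval A z * slice f z (eval
        B z * v) q"
      by (simp only: sl(1,2,4) slice_mult[OF L f coeffs(1)] slice_mult[OF L f coeffs(2)] monom_eval_0
          mult_1_left) simp
    then show ?thesis by (simp add: A algebra_simps)
  qed
  have Dn: "slice f z v (D ^ n) = eval B z ^ n * (twist t ^^ n) f (eval B z ^ n * v)" for n v
  proof (induction n arbitrary: v)
    case 0
    show ?case using sl(3)[of v 0 1] by simp
  next
    case (Suc n)
    show ?case
      by (simp add: D Suc A) (simp add: twist_def[of t "(twist t ^^ n) f"] right_diff_distrib mult_ac)
  qed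
  have "(w * D) ^ n \<notin> J" for n
  proof
    assume "(w * D) ^ n \<in> J"
    then have 0: "slice f z v (w ^ n * D ^ n) = 0" for v by (simp add: J_def power_mult_distrib)
    have wn: "slice f z v (w ^ n * q) = slice f z (eval w z ^ n * v) q" for v q
    proof (induction n arbitrary: v)
      case (Suc n)
      have "slice f z v (w ^ Suc n * q) = slice f z v (w * (w ^ n * q))" by (simp add: mult.assoc)
      also have "\<dots> = slice f z (eval w z * v) (w ^ n * q)" by (rule slice_mult[OF L f coeffs(3)])
      also have "\<dots> = slice f z (eval w z ^ n * (eval w z * v)) q" by (rule Suc)
      finally show ?case by (simp only: power_Suc2 mult.assoc)
    qed simp
    have "(twist t ^^ n) f = (\<lambda>_. 0)"
    proof
      fix v
      \<comment> \<open>The argument is divided in advance by the powers of \<open>B(z)\<close> and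
        \<open>w(z)\<close> that the multiplications by \<open>D\<close> and \<open>w\<close>
        introduce.\<close>
      have "(twist t ^^ n) f (eval B z ^ n * (eval w z ^ n * (v / (eval B z * eval w z) ^ n))) = 0"
        using 0[of "v / (eval B z * eval w z) ^ n"] B unfolding wn Dn by simp
      then show "(twist t ^^ n) f v = 0" using B w by (simp add: power_mult_distrib)
    qed
    then show False using twist_nilpotent[OF L f] assms(9) by (auto simp: t_def)
  qed
  from exists_prime_ideal[OF J this] obtain P where P: "prime_ideal P" "J \<subseteq> P" "w * D \<notin> P" by blast
  have id: "ring_ideal P" using P(1) by (simp add: prime_ideal_def)
  have "\<Phi> j - Const (eval (\<Phi> j) z) \<in> J" for j
  proof -
    have "slice f z v (\<Phi> j + - Const (eval (\<Phi> j) z)) = 0" for v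
    proof -
      have one: "slice f z u 1 = f u" for u using sl(3)[of u 0 1] by simp
      have "slice f z v (\<Phi> j) = eval (\<Phi> j) z * f v"
        using slice_mult[OF L f coeffs(4)[of j], of z v 1] by (simp add: one linear_overD(2)[OF f(1) \<Phi>])
      then show ?thesis by (simp only: sl(1-3)) simp
    qed
    then show ?thesis by (simp add: J_def)
  qed
  moreover have "w \<notin> P" "D \<notin> P"
    using P(3) ring_idealD(3)[OF id, of D w] ring_idealD(3)[OF id, of w D] by (auto simp: mult.commute)
  ultimately show ?thesis using that[of P] P(1,2) by (auto simp: D_def)
qed

section \<open>Vanishing of polynomials\<close>

lemma monom_eval_mult: "monom_eval m (\<lambda>v. x v * y v) = monom_eval m x * monom_eval m y"
  by (simp add: monom_eval_def power_mult_distrib prod.distrib)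

lemma monom_eval_separates:
  assumes "m \<noteq> n"
  obtains x :: "'v \<Rightarrow> 'a::field_char_0" where "monom_eval m x \<noteq> monom_eval n x"
proof -
  from assms obtain v where v: "lookup m v \<noteq> lookup n v"
    by (meson poly_mapping_eqI)
  define x :: "'v \<Rightarrow> 'a" where "x = (\<lambda>w. if w = v then 2 else 1)"
  have "monom_eval k x = 2 ^ lookup k v" for k
  proof -
    have "monom_eval k x = (\<Prod>w\<in>insert v (keys k). x w ^ lookup k w)"
      by (rule monom_eval_superset) auto
    also have "\<dots> = (\<Prod>w\<in>{v}. x w ^ lookup k w)"
      by (rule prod.mono_neutral_right) (auto simp: x_def)
    finally show ?thesis by (simp add: x_def)
  qed
  moreover have "(2::'a) ^ i \<noteq> 2 ^ j" if "i \<noteq> j" for i j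
  proof
    assume "(2::'a) ^ i = 2 ^ j"
    then have "(of_nat (2 ^ i) :: 'a) = of_nat (2 ^ j)" by simp
    then show False using that by (simp only: of_nat_eq_iff) simp
  qed
  ultimately show ?thesis using v that[of x] by metis
qed

text \<open>Dedekind's argument: distinct monomials are distinct multiplicative characters.\<close>

lemma monomials_independent:
  fixes c :: "'v monomial \<Rightarrow> 'a::field_char_0"
  assumes "finite A" "\<And>x. (\<Sum>m\<in>A. c m * monom_eval m x) = 0" "m \<in> A"
  shows "c m = 0"
  using assms
proof (induction A arbitrary: c m rule: finite_induct)
  case (insert a B)
  have B: "c n = 0" if n: "n \<in> B" for n
  proof -
    from n insert.hyps have "n \<noteq> a" by auto
    then obtain y :: "'v \<Rightarrow> 'a" where y: "monom_eval n y \<noteq> monom_eval a y" by (rule monom_eval_separates)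
    have "(\<Sum>m\<in>B. c m * (monom_eval m y - monom_eval a y) * monom_eval m x) = 0" for x
    proof -
      have "(\<Sum>m\<in>insert a B. c m * monom_eval m (\<lambda>v. y v * x v)) -
          monom_eval a y * (\<Sum>m\<in>insert a B. c m * monom_eval m x) = 0"
        by (simp only: insert.prems(1)) simp
      then show ?thesis
        using insert.hyps by (simp add: monom_eval_mult sum_distrib_left sum_subtractf algebra_simps)
    qed
    from insert.IH[OF this n] y show ?thesis by simp
  qed
  then have "c a * monom_eval a (\<lambda>_. 1) = 0"
    using insert.prems(1)[of "\<lambda>_. 1"] insert.hyps by simp
  with B insert.prems(2) show ?case by (auto simp: monom_eval_def)
qed simp

lemma eval_nonzero:
  fixes p :: "('v, 'a::field_char_0) mpoly"
  assumes "p \<noteq> 0"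
  obtains x where "eval p x \<noteq> 0"
proof (rule ccontr)
  assume "\<not> thesis"
  with that have 0: "(\<Sum>m\<in>keys p. lookup p m * monom_eval m x) = 0" for x
    by (auto simp: eval_eq_evalh evalh_def)
  have "lookup p m = 0" if "m \<in> keys p" for m
    using monomials_independent[OF _ 0 that] by simp
  then have "p = 0" by (subst poly_mapping_sum_singles) simp
  with assms show False by simp
qed

lemma ring_hom_pCons: "ring_hom (\<lambda>c. [:c:])"
  by (simp add: ring_hom_def one_pCons)

lemma ring_hom_poly: "ring_hom (\<lambda>p. poly p s)"
  by (simp add: ring_hom_def)

lemma poly_evalh:
  fixes s :: "'a::comm_ring_1"
  shows "poly (evalh (\<lambda>c. [:c:]) p y) s = eval p (\<lambda>v. poly (y v) s)"
  using ring_hom_of_evalh[OF ring_hom_poly[of s], of "\<lambda>c. [:c:]" p y] by (simp add: eval_eq_evalh)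

text \<open>On the line through \<open>x\<close> and \<open>y\<close> both polynomials are nonzero,
  as \<open>s = 0\<close> and \<open>s = 1\<close> show, and hence so is their product. A line keeps
  the new point inside every linear subspace that contains \<open>x\<close> and
  \<open>y\<close>.\<close>

lemma common_nonzero:
  fixes p q :: "('v, 'a::field_char_0) mpoly"
  assumes "eval p x \<noteq> 0" "eval q y \<noteq> 0"
  obtains s where "eval p (\<lambda>v. x v + s * (y v - x v)) \<noteq> 0" "eval q (\<lambda>v. x v + s * (y v - x v)) \<noteq> 0"
proof -
  define P where "P r = evalh (\<lambda>c. [:c:]) r (\<lambda>v. [:x v, y v - x v:])" for r :: "('v, 'a) mpoly"
  have P: "poly (P r) s = eval r (\<lambda>v. x v + s * (y v - x v))" for r s
    by (simp add: P_def poly_evalh)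
  have "P p \<noteq> 0" using P[of p 0] assms(1) by auto
  moreover have "P q \<noteq> 0" using P[of q 1] assms(2) by auto
  ultimately have "P p * P q \<noteq> 0" by simp
  then obtain s where "poly (P p * P q) s \<noteq> 0" using poly_all_0_iff_0 by blast
  then show ?thesis using that[of s] by (simp add: P)
qed

text \<open>Monomials with a variable outside \<open>J\<close> are discarded too. They contribute
  nothing at points that vanish outside \<open>J\<close>, and what remains lies in
  \<open>forms J e\<close>.\<close>

definition hcomp :: "'v set \<Rightarrow> nat \<Rightarrow> ('v, 'a::comm_ring_1) mpoly \<Rightarrow> ('v, 'a) mpoly" where
  "hcomp J e p = (\<Sum>m\<in>keys p \<inter> monomials J e. single m (lookup p m))"

lemma hcomp_forms: "hcomp J e p \<in> forms J e"
  unfolding hcomp_def by (intro forms_sum forms_single) auto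

lemma eval_hcomp:
  fixes p :: "('v, 'a::comm_ring_1) mpoly"
  assumes y: "\<And>v. v \<notin> J \<Longrightarrow> y v = 0" and N: "\<And>m. m \<in> keys p \<Longrightarrow> mdegree m \<le> N"
  shows "eval p (\<lambda>v. s * y v) = (\<Sum>e\<le>N. s ^ e * eval (hcomp J e p) y)"
proof -
  have *: "(\<Sum>e\<le>N. if m \<in> monomials J e then s ^ e * (c * monom_eval m y) else 0) = c * monom_eval m (\<lambda>v.
      s * y v)"
    if m: "m \<in> keys p" for m c
  proof (cases "keys m \<subseteq> J")
    case True
    then have "(\<Sum>e\<le>N. if m \<in> monomials J e then s ^ e * (c * monom_eval m y) else 0) =
        (\<Sum>e\<le>N. if e = mdegree m then s ^ e * (c * monom_eval m y) else 0)"
      by (intro sum.cong) (auto simp: monomials_def)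
    also have "\<dots> = s ^ mdegree m * (c * monom_eval m y)" using N[OF m] by simp
    finally show ?thesis
      using True monom_eval_scale[of m J "mdegree m" s y] by (simp add: monomials_def mult_ac)
  next
    case False
    then obtain v where "v \<in> keys m" "v \<notin> J" by blast
    then have "monom_eval m (\<lambda>v. s * y v) = 0"
      unfolding monom_eval_def using y by (intro prod_zero) (auto simp: in_keys_iff zero_power intro!:
          bexI[of _ v])
    with False show ?thesis by (simp add: monomials_def)
  qed
  have "(\<Sum>e\<le>N. s ^ e * eval (hcomp J e p) y) =
      (\<Sum>e\<le>N. \<Sum>m\<in>keys p. if m \<in> monomials J e then s ^ e * (lookup p m * monom_eval m y) else 0)"
    by (simp add: hcomp_def eval_simps sum_distrib_left sum.inter_restrict if_distrib[of "\<lambda>p. eval p y"]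
      if_distrib[of "\<lambda>x. _ * x"] cong: if_cong)
  also have "\<dots> = (\<Sum>m\<in>keys p. lookup p m * monom_eval m (\<lambda>v. s * y v))"
    by (subst sum.swap) (simp add: *)
  finally show ?thesis by (simp add: eval_eq_evalh evalh_def)
qed

lemma mdegree_bound: obtains N where "\<And>m. m \<in> keys p \<Longrightarrow> mdegree m \<le> N"
  by (meson finite_keys finite_imageI Max_ge imageI)

section \<open>Density of Sylvester cubics\<close>

lemma range_linear_form:
  "linear_form a + linear_form b = linear_form (\<lambda>v. a v + b v)"
  "Const c * linear_form a = linear_form (\<lambda>v. c * a v)"
  "- linear_form a = linear_form (\<lambda>v. - a v)"
  "Var w = linear_form (\<lambda>v. if v = w then 1 else 0)"
  by (simp_all add: linear_form_def sum.distrib distrib_right sum_distrib_left single_add mult_single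
      single_uminus
    sum_negf[symmetric] mult.assoc if_distrib[of "\<lambda>x. single _ x"]
    if_distrib[of "\<lambda>x. x * _"] cong: if_cong)

lemma linear_form_eq_sum: "linear_form (\<lambda>v. 1) = (\<Sum>v\<in>UNIV. Var v)"
  by (simp add: linear_form_def)

lemma cubic_monomial_cases:
  fixes m :: "4 monomial"
  assumes "m \<in> monomials UNIV 3"
  obtains i j where "m = single i 2 + single j 1"
  | q where "m = (\<Sum>i\<in>UNIV - {q}. single i 1)"
proof (cases "\<exists>i. lookup m i \<ge> 2")
  case True
  then obtain i where i: "lookup m i \<ge> 2" by blast
  define n where "n = m - single i 2"
  have m: "m = single i 2 + n"
    using i by (intro poly_mapping_eqI) (auto simp: n_def lookup_add lookup_minus lookup_single when_def)
  have "mdegree n = 1" using assms unfolding m by (simp add: monomials_def mdegree_add)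
  then have s: "(\<Sum>v\<in>UNIV. lookup n v) = 1" by (simp add: mdegree_UNIV)
  then obtain j where j: "lookup n j \<noteq> 0" by (metis sum.neutral zero_neq_one)
  have "lookup n j + (\<Sum>v\<in>UNIV - {j}. lookup n v) = 1"
    using s by (simp add: sum.remove[of UNIV j])
  then have "lookup n j = 1" "(\<Sum>v\<in>UNIV - {j}. lookup n v) = 0" using j by linarith+
  then have "n = single j 1"
    by (intro poly_mapping_eqI) (auto simp: lookup_single when_def)
  with m that(1) show ?thesis by blast
next
  case False
  then have le: "lookup m i \<le> 1" for i by (metis Suc_1 not_less_eq_eq One_nat_def)
  have s: "(\<Sum>v\<in>UNIV. lookup m v) = 3" using assms by (simp add: monomials_def mdegree_UNIV)
  define Z where "Z = {v. lookup m v = 0}"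
  have "(\<Sum>v\<in>UNIV. lookup m v) = (\<Sum>v\<in>UNIV. if v \<in> Z then 0 else 1)"
  proof (rule sum.cong)
    fix v
    show "lookup m v = (if v \<in> Z then 0 else 1)"
      using le[of v] by (cases "lookup m v") (auto simp: Z_def)
  qed simp
  also have "\<dots> = card (UNIV - Z)" by (simp add: sum.If_cases Compl_eq_Diff_UNIV)
  finally have "card (UNIV - Z) = 3" using s by simp
  then have "card Z = 1" using card_Diff_subset[of Z UNIV] card_mono[of UNIV Z] by simp
  then obtain q where q: "Z = {q}" by (auto simp: card_1_singleton_iff)
  have "m = (\<Sum>i\<in>UNIV - {q}. single i 1)"
  proof (rule poly_mapping_eqI)
    fix v
    have "lookup (\<Sum>i\<in>UNIV - {q}. single i (1::nat)) v = (if v = q then 0 else 1)"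
      by (simp add: lookup_sum lookup_single when_def)
    also have "\<dots> = lookup m v"
    proof -
      have "lookup m v = 0 \<longleftrightarrow> v = q"
        using arg_cong[OF q, of "\<lambda>S. v \<in> S"] by (simp add: Z_def)
      then show ?thesis using le[of v] by (cases "lookup m v") auto
    qed
    finally show "lookup m v = lookup (\<Sum>i\<in>UNIV - {q}. single i 1) v" by simp
  qed
  with that(2) show ?thesis by blast
qed

text \<open>
  The tangent space of the family of Sylvester cubics at \<open>\<Sum> x\<^sub>i\<^sup>3 - (\<Sum> x\<^sub>i)\<^sup>3\<close> consists of the cubics
  \<open>\<Sum> x\<^sub>i\<^sup>2 p\<^sub>i + (\<Sum> x\<^sub>i)\<^sup>2 q\<close> with linear forms \<open>p\<^sub>i\<close> and \<open>q\<close>, that is, of all cubics.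
\<close>

lemma tangent_space:
  fixes g :: "(4, 'a::field_char_0) mpoly"
  assumes "g \<in> forms UNIV 3"
  obtains p q where "g = (\<Sum>i\<in>UNIV. (Var i)\<^sup>2 * linear_form (p i)) + (linear_form (\<lambda>_. 1))\<^sup>2 * linear_form q"
proof -
  define \<sigma> :: "(4, 'a) mpoly" where "\<sigma> = linear_form (\<lambda>_. 1)"
  define X :: "4 \<Rightarrow> (4, 'a) mpoly" where "X i = Var i" for i
  define T where "T = {(\<Sum>i\<in>UNIV. (X i)\<^sup>2 * linear_form (p i)) + \<sigma>\<^sup>2 * linear_form q | p q. True}"
  have TI: "(\<Sum>i\<in>UNIV. (X i)\<^sup>2 * linear_form (p i)) + \<sigma>\<^sup>2 * linear_form q \<in> T" for p q
    unfolding T_def by blast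
  have l0: "linear_form (\<lambda>_. 0) = (0 :: (4, 'a) mpoly)" by (simp add: linear_form_def)
  have add: "f + h \<in> T" if "f \<in> T" "h \<in> T" for f h
  proof -
    from that obtain p q p' q' where
      f: "f = (\<Sum>i\<in>UNIV. (X i)\<^sup>2 * linear_form (p i)) + \<sigma>\<^sup>2 * linear_form q" and
      h: "h = (\<Sum>i\<in>UNIV. (X i)\<^sup>2 * linear_form (p' i)) + \<sigma>\<^sup>2 * linear_form q'" by (auto simp: T_def)
    have "f + h = (\<Sum>i\<in>UNIV. (X i)\<^sup>2 * linear_form (\<lambda>v. p i v + p' i v)) + \<sigma>\<^sup>2 * linear_form (\<lambda>v. q v + q' v)"
      unfolding f h range_linear_form(1)[symmetric] by (simp add: distrib_left sum.distrib algebra_simps)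
    then show ?thesis by (simp only: TI)
  qed
  have scale: "Const c * f \<in> T" if "f \<in> T" for c f
  proof -
    from that obtain p q where
      f: "f = (\<Sum>i\<in>UNIV. (X i)\<^sup>2 * linear_form (p i)) + \<sigma>\<^sup>2 * linear_form q" by (auto simp: T_def)
    have "Const c * f = (\<Sum>i\<in>UNIV. (X i)\<^sup>2 * linear_form (\<lambda>v. c * p i v)) + \<sigma>\<^sup>2 * linear_form (\<lambda>v. c * q v)"
      unfolding f range_linear_form(2)[symmetric] by (simp add: distrib_left sum_distrib_left algebra_simps)
    then show ?thesis by (simp only: TI)
  qed
  have sq: "(X i)\<^sup>2 * linear_form a \<in> T" for i a
  proof -
    have "linear_form (\<lambda>v. if j = i then a v else 0) = (if j = i then linear_form a else 0)" for j
      by (simp add: l0)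
    then have "(\<Sum>j\<in>UNIV. (X j)\<^sup>2 * linear_form (\<lambda>v. if j = i then a v else 0)) + \<sigma>\<^sup>2 * linear_form (\<lambda>_. 0) =
        (X i)\<^sup>2 * linear_form a"
      by (simp add: l0 if_distrib[of "\<lambda>x. _ * x"] cong: if_cong)
    then show ?thesis using TI[of "\<lambda>j v. if j = i then a v else 0" "\<lambda>_. 0"] by simp
  qed
  have \<sigma>sq: "\<sigma>\<^sup>2 * linear_form a \<in> T" for a
    using TI[of "\<lambda>_ _. 0" a] by (simp add: l0)
  have "single m c \<in> T" if "m \<in> monomials UNIV 3" for m and c :: 'a
    using that
  proof (cases rule: cubic_monomial_cases)
    case (1 i j)
    have "single m c = Const c * ((X i)\<^sup>2 * X j)"
      by (simp add: X_def 1 mult_single power2_eq_square numeral_2_eq_2 flip: single_add)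
    also have "\<dots> \<in> T"
      unfolding X_def[of j] by (subst range_linear_form(4)) (intro scale sq)
    finally show ?thesis .
  next
    case (2 q)
    define \<tau> where "\<tau> = (\<Sum>i\<in>UNIV - {q}. X i)"
    have \<sigma>: "\<sigma> = X q + \<tau>"
      using sum.remove[of UNIV q X] by (simp add: \<sigma>_def \<tau>_def linear_form_eq_sum X_def)
    have "card (UNIV - {q}) = 3" by simp
    then obtain a b c' where abc: "UNIV - {q} = {a, b, c'}" "a \<noteq> b" "a \<noteq> c'" "b \<noteq> c'"
      by (metis card_3_iff)
    have \<tau>': "\<tau> = X a + X b + X c'" using abc by (simp add: \<tau>_def add.assoc)
    define e :: "4 \<Rightarrow> 4 \<Rightarrow> 'a" where "e i v = (if v = i then 1 else 0)" for i v
    have e: "X i = linear_form (e i)" for i unfolding X_def e_def by (rule range_linear_form(4))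
    have "Const r * \<tau> + Const s * X i = linear_form (\<lambda>v. r * (e a v + e b v + e c' v) + s * e i v)" for r s i
      unfolding \<tau>' e range_linear_form(1,2) ..
    then have lin: "\<exists>l. Const r * \<tau> + Const s * X i = linear_form l" for r s i by blast
    \<comment> \<open>Up to multiples of squares of variables, \<open>6abc\<close> is the cube of
      \<open>\<tau> = a + b + c\<close>. This cube in turn equals
      \<open>\<sigma>^2 (\<tau> - 2 x_q) + x_q^2 (3 \<tau> + 2 x_q)\<close>, because
      \<open>\<sigma> = x_q + \<tau>\<close>.\<close>
    have 6: "6 * (X a * X b * X c') = \<sigma>\<^sup>2 * (\<tau> - 2 * X q) + (X q)\<^sup>2 * (3 * \<tau> + 2 * X q) +
        ((X a)\<^sup>2 * (- 3 * \<tau> + 2 * X a) + (X b)\<^sup>2 * (- 3 * \<tau> + 2 * X b) + (X c')\<^sup>2 * (- 3 * \<tau> + 2 * X c'))"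
      unfolding \<sigma> \<tau>' by (simp add: algebra_simps power2_eq_square)
    have lin': "\<exists>l. r * \<tau> + s * X i = linear_form l" if "r = Const r'" "s = Const s'" for r s r' s' i
      using lin that by simp
    have "\<sigma>\<^sup>2 * (\<tau> - 2 * X q) \<in> T"
      using lin'[of 1 1 "- 2" "- 2" q] \<sigma>sq by (auto simp: single_uminus)
    moreover have "(X i)\<^sup>2 * (- 3 * \<tau> + 2 * X i) \<in> T" for i
      using lin'[of "- 3" "- 3" 2 2 i] sq by (auto simp: single_uminus)
    moreover have "(X i)\<^sup>2 * (3 * \<tau> + 2 * X i) \<in> T" for i
      using lin'[of 3 3 2 2 i] sq by auto
    ultimately have "6 * (X a * X b * X c') \<in> T" unfolding 6 by (intro add)
    then have "Const (c / 6) * (6 * (X a * X b * X c')) \<in> T" by (rule scale)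
    also have "Const (c / 6) * (6 * (X a * X b * X c')) = Const (c / 6) * Const 6 * (X a * X b * X c')"
      by (simp add: mult.assoc)
    also have "Const (c / 6) * Const 6 = (Const c :: (4, 'a) mpoly)" by (simp only: mult_single) simp
    also have "Const c * (X a * X b * X c') = single m c"
      using abc by (simp add: X_def 2 mult_single add.assoc)
    finally show ?thesis .
  qed
  then have "(\<Sum>m\<in>keys g. single m (lookup g m)) \<in> T"
  proof -
    have "0 \<in> T" using scale[of "\<sigma>\<^sup>2 * linear_form (\<lambda>_. 0)" 0] \<sigma>sq by simp
    have "(\<Sum>m\<in>A. single m (lookup g m)) \<in> T" if "finite A" "A \<subseteq> keys g" for A
      using that
    proof (induction A)
      case (insert m A)
      then have "m \<in> monomials UNIV 3" using assms by (auto simp: forms_def)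
      with insert \<open>\<And>m c. m \<in> monomials UNIV 3 \<Longrightarrow> single m c \<in> T\<close> show ?case by (simp add: add)
    qed (simp add: \<open>0 \<in> T\<close>)
    then show ?thesis by simp
  qed
  then have "g \<in> T" using poly_mapping_sum_singles[of g] by simp
  then show ?thesis using that by (auto simp: T_def X_def \<sigma>_def)
qed

lemma lookup_Const_mult: "lookup (Const c * p) m = c * lookup p m"
  for c :: "'a::comm_ring_1"
  unfolding mult_map_scale_conv_mult[symmetric] by (simp add: Poly_Mapping.map.rep_eq when_def)

lemma map_coeffs_linear_form:
  assumes "ring_hom h"
  shows "map_coeffs h (linear_form a) = linear_form (\<lambda>v. h (a v))"
  by (simp add: linear_form_def ring_hom_simps[OF ring_hom_map_coeffs[OF assms]]
    map_coeffs_single[of h, OF ring_hom_0[OF assms]] ring_hom_1[OF assms])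

definition base_point :: "4 option \<Rightarrow> 4 \<Rightarrow> 'a::comm_ring_1" where
  "base_point m v = (case m of None \<Rightarrow> 1 | Some i \<Rightarrow> if i = v then 1 else 0)"

lemma coef_base_point:
  "coef base_point None v = - 1" "coef base_point (Some i) v = (if i = v then 1 else 0)"
  by (simp_all add: base_point_def)

text \<open>The data move away from the base point with a velocity that is solved from the
  presentation of \<open>g\<close> in \<open>tangent_space\<close>; everything beyond first order is
  left in \<open>r\<close>.\<close>

lemma sylvester_curve:
  fixes g :: "(4, 'a::field_char_0) mpoly"
  assumes "g \<in> forms UNIV 3"
  obtains Z r where "\<And>m. lookup (sylvester Z) m =
    pCons (lookup (sylvester base_point) m) (pCons (lookup g m) (r m))"
proof -
  obtain p q where g: "g = (\<Sum>i\<in>UNIV. (Var i)\<^sup>2 * linear_form (p i)) + (linear_form (\<lambda>_. 1))\<^sup>2 * linear_form q"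
    by (rule tangent_space[OF assms])
  \<comment> \<open>The derivative of a cube contributes the factor \<open>3\<close>.\<close>
  define P where "P i v = p i v / 3" for i v
  \<comment> \<open>To first order the fifth form changes by
    \<open>- 2 * e v - (\<Sum>i\<in>UNIV. P i v)\<close>, the \<open>2\<close> coming from the
    square in \<open>coef\<close>; this is made equal to \<open>q v / 3\<close>.\<close>
  define e where "e v = (- q v / 3 - (\<Sum>i\<in>UNIV. P i v)) / 2" for v
  define Z where "Z m v = (case m of None \<Rightarrow> [:1, e v:] | Some i \<Rightarrow> [:if i = v then 1 else 0, P i v:])" for m v
  define R where "R v = - (\<Sum>i\<in>UNIV. [:(e i)\<^sup>2:] * [:if i = v then 1 else 0, P i v:] + [:2 * e i:] * [:P
      i v:])" for v
  define h :: "'a \<Rightarrow> 'a poly" where "h c = [:c:]" for c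
  define S :: "(4, 'a poly) mpoly" where "S = Const [:0, 1:]"
  have h: "ring_hom h" unfolding h_def by (rule ring_hom_pCons)
  note mh = ring_hom_simps[OF ring_hom_map_coeffs[OF h]] map_coeffs_linear_form[OF h]
  have None: "coef Z None v = [:- 1:] + [:0, 1:] * [:q v / 3:] + [:0, 0, 1:] * R v" for v
  proof -
    have split: "- (\<Sum>i\<in>UNIV. U i + s * V i + s' * W i) = - ((\<Sum>i\<in>UNIV. U i) + s * (\<Sum>i\<in>UNIV. V i)) + s' *
        - (\<Sum>i\<in>UNIV. W i)"
      for U V W :: "4 \<Rightarrow> 'a poly" and s s' by (simp add: sum.distrib sum_distrib_left)
    have "coef Z None v = - (\<Sum>i\<in>UNIV. [:1, e i:]\<^sup>2 * [:if i = v then 1 else 0, P i v:])"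
      by (simp add: Z_def)
    also have "\<dots> = - (\<Sum>i\<in>UNIV. [:if i = v then 1 else 0:] + [:0, 1:] * [:2 * e i * (if i = v then 1 else
        0) + P i v:] +
        [:0, 0, 1:] * ([:(e i)\<^sup>2:] * [:if i = v then 1 else 0, P i v:] + [:2 * e i:] * [:P i v:]))"
      by (intro arg_cong[where f = uminus] sum.cong refl) (simp add: power2_eq_square algebra_simps)
    also have "\<dots> = - (h (\<Sum>i\<in>UNIV. if i = v then 1 else 0) +
        [:0, 1:] * h (\<Sum>i\<in>UNIV. 2 * e i * (if i = v then 1 else 0) + P i v)) + [:0, 0, 1:] * R v"
      unfolding ring_hom_sum[OF h] R_def split by (simp only: h_def)
    also have "(\<Sum>i\<in>UNIV. if i = v then 1 else 0) = (1::'a)" by simp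
    also have "(\<Sum>i\<in>UNIV. 2 * e i * (if i = v then 1 else 0) + P i v) = 2 * e v + (\<Sum>i\<in>UNIV. P i v)"
      by (simp add: sum.distrib if_distrib[of "\<lambda>x. _ * x"] cong: if_cong)
    also have "\<dots> = - q v / 3"
    proof -
      have "2 * e v = - q v / 3 - (\<Sum>i\<in>UNIV. P i v)" by (simp only: e_def times_divide_eq_right) (rule
          nonzero_mult_div_cancel_left, simp)
      then show ?thesis by simp
    qed
    finally show ?thesis by (simp add: h_def)
  qed
  have S2: "S\<^sup>2 = Const [:0, 0, 1:]" by (simp add: S_def power2_eq_square mult_single)
  have lS: "S * linear_form a = linear_form (\<lambda>v. [:0, 1:] * a v)" and
    lS2: "S\<^sup>2 * linear_form a = linear_form (\<lambda>v. [:0, 0, 1:] * a v)" for a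
    unfolding S2 unfolding S_def by (rule range_linear_form(2))+
  have lf: "linear_form (coef Z None) = map_coeffs h (linear_form (\<lambda>_. - 1)) +
      S * map_coeffs h (linear_form (\<lambda>v. q v / 3)) + S\<^sup>2 * linear_form R"
    unfolding mh lS lS2 range_linear_form(1) by (intro arg_cong[where f = linear_form] ext) (simp only:
        None h_def)
  have lf': "linear_form (coef Z (Some i)) = map_coeffs h (Var i) +
      S * map_coeffs h (linear_form (P i)) + S\<^sup>2 * 0" for i
    unfolding range_linear_form(4) mh lS range_linear_form(1) mult_zero_right add_0_right
    by (intro arg_cong[where f = linear_form] ext) (auto simp: Z_def h_def)
  have cube: "\<exists>r. (a + S * b + S\<^sup>2 * c) ^ 3 = a ^ 3 + S * (3 * a\<^sup>2 * b) + S\<^sup>2 * r" for a b c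
    by (rule exI[of _ "3 * a\<^sup>2 * c + 3 * a * (b + S * c)\<^sup>2 + S * (b + S * c) ^ 3"])
      (simp add: power2_eq_square power3_eq_cube algebra_simps)
  obtain r0 where r0: "linear_form (coef Z None) ^ 3 = map_coeffs h (linear_form (\<lambda>_. - 1)) ^ 3 +
      S * (3 * (map_coeffs h (linear_form (\<lambda>_. - 1)))\<^sup>2 * map_coeffs h (linear_form (\<lambda>v. q v / 3))) +
          S\<^sup>2 * r0"
    unfolding lf using cube by blast
  have "\<exists>r. linear_form (coef Z (Some i)) ^ 3 = map_coeffs h (Var i) ^ 3 +
      S * (3 * (map_coeffs h (Var i))\<^sup>2 * map_coeffs h (linear_form (P i))) + S\<^sup>2 * r" for i
    unfolding lf' by (rule cube)
  then obtain r1 where r1: "\<And>i. linear_form (coef Z (Some i)) ^ 3 = map_coeffs h (Var i) ^ 3 +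
      S * (3 * (map_coeffs h (Var i))\<^sup>2 * map_coeffs h (linear_form (P i))) + S\<^sup>2 * r1 i" by metis
  have f0: "sylvester base_point = linear_form (\<lambda>_. - 1) ^ 3 + (\<Sum>i\<in>UNIV. (Var i) ^ 3 :: (4, 'a) mpoly)"
  proof -
    have 1: "coef base_point None = (\<lambda>_. - 1 :: 'a)" "coef base_point (Some i) = (\<lambda>v. if v = i then 1
        else 0 :: 'a)" for i
      by (auto simp: base_point_def)
    show ?thesis unfolding sylvester_def sum_option 1 range_linear_form(4) ..
  qed
  have g': "g = 3 * (linear_form (\<lambda>_. - 1))\<^sup>2 * linear_form (\<lambda>v. q v / 3) + (\<Sum>i\<in>UNIV. 3 * (Var i)\<^sup>2 *
      linear_form (P i))"
  proof -
    have 3: "3 * (a * linear_form (\<lambda>v. b v / 3)) = a * linear_form b" for a and b :: "4 \<Rightarrow> 'a"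
    proof -
      have "3 * linear_form (\<lambda>v. b v / 3) = linear_form b"
        using range_linear_form(2)[of "3::'a" "\<lambda>v. b v / 3"] by simp
      then show ?thesis by (simp add: mult.left_commute[of 3])
    qed
    have "linear_form (\<lambda>_. - 1 :: 'a) = - linear_form (\<lambda>_. 1)" by (simp add: range_linear_form(3))
    then show ?thesis unfolding g P_def by (simp add: mult.assoc 3)
  qed
  have "sylvester Z = map_coeffs h (sylvester base_point) + S * map_coeffs h g + S\<^sup>2 * (r0 + (\<Sum>i\<in>UNIV. r1 i))"
    unfolding sylvester_def[of Z] sum_option r0 r1 f0 g'
    by (simp add: ring_hom_simps[OF ring_hom_map_coeffs[OF h]] sum.distrib sum_distrib_left
        sum_distrib_right algebra_simps)
  then have "lookup (sylvester Z) m = pCons (lookup (sylvester base_point) m)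
      (pCons (lookup g m) (lookup (r0 + (\<Sum>i\<in>UNIV. r1 i)) m))" for m
    unfolding S2 by (simp add: lookup_add S_def lookup_Const_mult lookup_map_coeffs[of h, OF
        ring_hom_0[OF h]] h_def)
  then show ?thesis by (rule that)
qed

text \<open>
  Expand \<open>\<Psi>\<close> at the base point. On a curve of Sylvester cubics with tangent vector \<open>g\<close>, the lowest
  homogeneous component of the expansion contributes the lowest power of the parameter, so it vanishes
  at \<open>g\<close>; and every cubic \<open>g\<close> occurs as a tangent vector.
\<close>

theorem sylvester_dense:
  fixes \<Psi> :: "(4 monomial, 'a::field_char_0) mpoly"
  assumes zero: "\<And>z. eval \<Psi> (lookup (sylvester z)) = 0" and f: "f \<in> forms UNIV 3"
  shows "eval \<Psi> (lookup f) = 0"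
proof -
  define J :: "4 monomial set" where "J = monomials UNIV 3"
  define f0 :: "(4, 'a) mpoly" where "f0 = sylvester base_point"
  define \<Psi>' where "\<Psi>' = evalh Const \<Psi> (\<lambda>m. Var m + Const (lookup f0 m))"
  have \<Psi>': "eval \<Psi>' y = eval \<Psi> (\<lambda>m. y m + lookup f0 m)" for y
    by (simp add: \<Psi>'_def ring_hom_of_evalh[OF ring_hom_eval] eval_simps) (simp add: eval_eq_evalh)
  obtain N where N: "\<And>m. m \<in> keys \<Psi>' \<Longrightarrow> mdegree m \<le> N" using mdegree_bound by blast
  \<comment> \<open>Strong induction on the degree, for all \<open>g\<close> at once: along the
    curve with tangent vector \<open>g\<close> the components of degree below \<open>d\<close>
    vanish identically, so \<open>s ^ d\<close> can be divided out, and the constant term that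
    remains is the component of degree \<open>d\<close> at \<open>g\<close>.\<close>
  have "eval (hcomp J d \<Psi>') (lookup g) = 0" if "g \<in> forms UNIV 3" for d g
    using that
  proof (induction d arbitrary: g rule: less_induct)
    case (less d)
    show ?case
    proof (cases "d \<le> N")
      case False
      then have "keys \<Psi>' \<inter> monomials J d = {}" using N by (fastforce simp: monomials_def)
      then show ?thesis by (simp add: hcomp_def eval_def)
    next
      case True
      obtain Z r where Z: "\<And>m. lookup (sylvester Z) m =
          pCons (lookup f0 m) (pCons (lookup g m) (r m))"
        using sylvester_curve[OF less.prems] unfolding f0_def by metis
      define Y where "Y m = pCons (lookup g m) (r m)" for m
      define E where "E e = evalh (\<lambda>c. [:c:]) (hcomp J e \<Psi>') Y" for e
      have E: "poly (E e) s = eval (hcomp J e \<Psi>') (\<lambda>m. poly (Y m) s)" for e s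
        by (simp add: E_def poly_evalh)
      have Y0: "Y m = 0" if "m \<notin> J" for m
      proof -
        have "lookup (sylvester Z) m = 0" using that sylvester_forms[of Z] by (auto simp: J_def dest: formsD)
        then show ?thesis by (simp add: Z Y_def)
      qed
      have "E e = 0" if e: "e < d" for e
      proof -
        \<comment> \<open>Every value of \<open>Y\<close> along the curve is again the coefficient
          vector of a cubic, so the induction hypothesis applies to it.\<close>
        have "poly (E e) s = 0" for s
        proof -
          define G where "G = (\<Sum>m\<in>J. single m (poly (Y m) s))"
          have G: "lookup G = (\<lambda>m. poly (Y m) s)"
            using Y0 finite_monomials[of 3, where 'v = 4]
            by (auto simp: G_def J_def lookup_sum lookup_single when_def fun_eq_iff sum.delta)
          have "G \<in> forms UNIV 3" unfolding G_def J_def by (intro forms_sum forms_single)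
          from less.IH[OF e this] show ?thesis by (simp add: E G)
        qed
        then show ?thesis using poly_all_0_iff_0 by blast
      qed
      then have low: "(\<Sum>e<d. Polynomial.monom 1 e * E e) = 0" by simp
      have "poly (\<Sum>e\<le>N. Polynomial.monom 1 e * E e) s = 0" for s
      proof -
        have hs: "ring_hom (\<lambda>p. poly p s)" by (rule ring_hom_poly)
        have "poly (\<Sum>e\<le>N. Polynomial.monom 1 e * E e) s = eval \<Psi>' (\<lambda>m. s * poly (Y m) s)"
          using Y0 by (subst eval_hcomp[of J, OF _ N]) (simp_all add: poly_sum poly_monom E)
        also have "\<dots> = eval \<Psi> (\<lambda>m. poly (lookup (sylvester Z) m) s)"
          by (simp add: \<Psi>' Z Y_def add.commute)
        also have "(\<lambda>m. poly (lookup (sylvester Z) m) s) = lookup (sylvester (\<lambda>m v. poly (Z m v) s))"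
          by (simp add: fun_eq_iff lookup_map_coeffs flip: sylvester_hom[OF hs])
        finally show ?thesis by (simp add: zero)
      qed
      then have "(\<Sum>e\<le>N. Polynomial.monom 1 e * E e) = 0" using poly_all_0_iff_0 by blast
      moreover have "{..N} = {..<d} \<union> {d..N}" using True by auto
      ultimately have "(\<Sum>e\<in>{d..N}. Polynomial.monom 1 e * E e) = 0"
        using low sum.union_disjoint[of "{..<d}" "{d..N}" "\<lambda>e. Polynomial.monom 1 e * E e"]
        by (simp add: disjoint_iff)
      moreover have "(\<Sum>e\<in>{d..N}. Polynomial.monom 1 e * E e) =
          Polynomial.monom 1 d * (\<Sum>e\<in>{d..N}. Polynomial.monom 1 (e - d) * E e)"
        unfolding sum_distrib_left by (intro sum.cong refl) (simp add: mult_monom flip: mult.assoc)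
      ultimately have "(\<Sum>e\<in>{d..N}. Polynomial.monom 1 (e - d) * E e) = 0" by (simp add: monom_eq_0_iff)
      then have "poly (\<Sum>e\<in>{d..N}. Polynomial.monom 1 (e - d) * E e) 0 = 0" by simp
      moreover have "poly (\<Sum>e\<in>{d..N}. Polynomial.monom 1 (e - d) * E e) 0 = (\<Sum>e\<in>{d}. poly (E e) 0)"
        unfolding poly_sum using True
        by (intro sum.mono_neutral_cong_right) (auto simp: poly_monom zero_power)
      ultimately have "poly (E d) 0 = 0" by simp
      then show ?thesis by (simp add: E Y_def)
    qed
  qed
  moreover have "f - f0 \<in> forms UNIV 3" unfolding f0_def by (intro forms_diff f sylvester_forms)
  ultimately have "eval (hcomp J e \<Psi>') (lookup (f - f0)) = 0" for e by blast
  moreover have "lookup (f - f0) m = 0" if "m \<notin> J" for m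
    using that \<open>f - f0 \<in> forms UNIV 3\<close> by (auto simp: J_def dest: formsD)
  ultimately have "eval \<Psi>' (\<lambda>m. 1 * lookup (f - f0) m) = 0"
    by (subst eval_hcomp[of J, OF _ N]) simp_all
  then show ?thesis by (simp add: \<Psi>' lookup_minus)
qed

section \<open>The coefficients of a Sylvester cubic in terms of its Hessian\<close>

lemma lookup_sylvester_hom:
  assumes "ring_hom h"
  shows "h (lookup (sylvester z) k) = lookup (sylvester (\<lambda>m v. h (z m v))) k"
  by (simp add: lookup_map_coeffs[of h, OF ring_hom_0[OF assms]] flip: sylvester_hom[OF assms])

lemma lookup_hess_sylvester_hom:
  assumes "ring_hom h"
  shows "h (lookup (hess (sylvester z)) k) = lookup (hess (sylvester (\<lambda>m v. h (z m v)))) k"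
  by (simp add: lookup_map_coeffs[of h, OF ring_hom_0[OF assms]]
    flip: sylvester_hom[OF assms] map_coeffs_hess[OF assms])

lemma zdet_base_point: "zdet base_point = (1::'a::comm_ring_1)"
proof -
  have "(\<chi> i v. base_point (Some i) v) = (mat 1 :: 'a ^ 4 ^ 4)"
    by (simp add: mat_def base_point_def vec_eq_iff)
  then show ?thesis by (simp add: zdet_def det_I)
qed

lemma subfield_fractions:
  fixes A :: "'a::idom set"
  assumes A: "1 \<in> A" "\<And>x y. x \<in> A \<Longrightarrow> y \<in> A \<Longrightarrow> x - y \<in> A" "\<And>x y. x \<in> A \<Longrightarrow> y \<in> A \<Longrightarrow> x * y \<in> A"
  shows "subfield {to_fract a / to_fract b | a b. a \<in> A \<and> b \<in> A \<and> b \<noteq> 0}" (is "subfield ?L")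
proof -
  have I: "to_fract a / to_fract b \<in> ?L" if "a \<in> A" "b \<in> A" "b \<noteq> 0" for a b using that by blast
  have 0: "0 \<in> A" using A(2)[OF A(1) A(1)] by simp
  show ?thesis
    unfolding subfield_def
  proof (intro conjI ballI)
    show "1 \<in> ?L" using I[OF A(1) A(1)] by simp
  next
    fix x y assume "x \<in> ?L" "y \<in> ?L"
    then obtain a b c d where x: "x = to_fract a / to_fract b" "a \<in> A" "b \<in> A" "b \<noteq> 0"
      and y: "y = to_fract c / to_fract d" "c \<in> A" "d \<in> A" "d \<noteq> 0" by blast
    have "x - y = to_fract (a * d - c * b) / to_fract (b * d)"
      unfolding x(1) y(1) using x(4) y(4) by (simp add: diff_frac_eq)
    then show "x - y \<in> ?L" using I[of "a * d - c * b" "b * d"] x y A by simp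
    have "x * y = to_fract (a * c) / to_fract (b * d)" unfolding x(1) y(1) by simp
    then show "x * y \<in> ?L" using I[of "a * c" "b * d"] x y A by simp
  next
    fix x assume "x \<in> ?L"
    then obtain a b where x: "x = to_fract a / to_fract b" "a \<in> A" "b \<in> A" "b \<noteq> 0" by blast
    show "inverse x \<in> ?L"
    proof (cases "a = 0")
      case True
      then show ?thesis using I[OF 0 A(1)] x by simp
    next
      case False
      then show ?thesis using I[of b a] x by (simp add: inverse_eq_divide)
    qed
  qed
qed

text \<open>Only ratios of coefficients can be recovered; the coefficient of this monomial serves as
  their denominator.\<close>

abbreviation cube1 :: "4 monomial" where
  "cube1 \<equiv> single 1 3"

lemma sylvester_cube1_nonzero:
  obtains z :: "4 option \<Rightarrow> 4 \<Rightarrow> 'a::field_char_0" where "lookup (sylvester z) cube1 \<noteq> 0"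
proof -
  define z :: "4 option \<Rightarrow> 4 \<Rightarrow> 'a" where "z m v = (if m = Some 1 \<and> v = 1 then 1 else 0)" for m v
  have "linear_form (coef z m) = (if m = Some 1 then linear_form (\<lambda>v. if v = 1 then 1 else 0) else 0)" for m
  proof (cases m)
    case None
    have "coef z None = (\<lambda>v. 0)" by (auto simp: z_def fun_eq_iff)
    with None show ?thesis by (simp add: linear_form_def)
  next
    case (Some i)
    then have "coef z m = (if m = Some 1 then (\<lambda>v. if v = 1 then 1 else 0) else (\<lambda>v. 0))"
      by (auto simp: z_def fun_eq_iff)
    then show ?thesis by (auto simp: linear_form_def)
  qed
  then have "sylvester z = linear_form (\<lambda>v. if v = 1 then 1 else 0) ^ 3"
    by (simp add: sylvester_def sum_option if_distrib[of "\<lambda>x. x ^ 3"] cong: if_cong)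
  also have "\<dots> = Var 1 ^ 3" by (simp only: range_linear_form(4))
  also have "\<dots> = single cube1 1"
    by (simp add: power3_eq_cube mult_single numeral_3_eq_3 flip: single_add)
  finally show ?thesis using that[of z] by simp
qed

text \<open>For the generic data \<open>zK\<close> the ratio of the two coefficients lies in the
  field \<open>L\<close> generated by the coefficients of the Hessian, since otherwise
  \<open>descent_prime_ideal\<close> would produce a bad prime. Cleared of denominators this is an
  identity between polynomials in the data, which specialises to every \<open>z\<close>.\<close>

theorem sylvester_rational:
  fixes \<nu> :: "4 monomial"
  obtains p q :: "(4 monomial, 'a::field_char_0) mpoly" and z0
  where "eval q (lookup (hess (sylvester z0))) \<noteq> 0"
    "\<And>z. eval q (lookup (hess (sylvester z))) * lookup (sylvester z) \<nu> =
       eval p (lookup (hess (sylvester z))) * lookup (sylvester z) cube1"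
proof -
  \<comment> \<open>Numbering the data makes the variables linearly ordered; the polynomial ring is
    then an integral domain and has a fraction field.\<close>
  obtain enc :: "4 option \<times> 4 \<Rightarrow> nat" where enc: "inj enc"
    using finite_imp_inj_to_nat_seg[of "UNIV :: (4 option \<times> 4) set"] by auto
  define X :: "4 option \<Rightarrow> 4 \<Rightarrow> (nat, 'a) mpoly" where "X = (\<lambda>m v. Var (enc (m, v)))"
  define \<phi> where "\<phi> = lookup (hess (sylvester X))"
  define ev where "ev z r = eval r (\<lambda>n. case_prod z (inv enc n))" for z :: "4 option \<Rightarrow> 4 \<Rightarrow> 'a" and r
  have ev: "ring_hom (ev z)" for z unfolding ev_def by (rule ring_hom_eval)
  have evX: "(\<lambda>m v. ev z (X m v)) = z" for z
    by (simp add: ev_def X_def eval_Var[simplified] enc)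
  define A where "A = range (\<lambda>p. evalh Const p \<phi>)"
  have h: "ring_hom (\<lambda>p. evalh Const p \<phi>)" by (rule ring_hom_evalh[OF ring_hom_Const])
  have A: "1 \<in> A" "x \<in> A \<Longrightarrow> y \<in> A \<Longrightarrow> x - y \<in> A" "x \<in> A \<Longrightarrow> y \<in> A \<Longrightarrow> x * y \<in> A" for x y
    unfolding A_def by (metis (no_types, lifting) rangeE rangeI ring_hom_simps(1-6)[OF h])+
  define L where "L = {to_fract a / to_fract b | a b. a \<in> A \<and> b \<in> A \<and> b \<noteq> 0}"
  have L: "subfield L" unfolding L_def by (rule subfield_fractions[OF A])
  have LI: "to_fract a \<in> L" if "a \<in> A" for a
  proof -
    have "to_fract a = to_fract a / to_fract 1" by simp
    then show ?thesis unfolding L_def using that A(1) one_neq_zero by blast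
  qed
  define \<iota> where "\<iota> c = to_fract (Const c :: (nat, 'a) mpoly)" for c
  have \<iota>: "ring_hom \<iota>" unfolding \<iota>_def by (rule ring_hom_comp[OF ring_hom_to_fract ring_hom_Const])
  have \<iota>L: "\<iota> c \<in> L" for c
    unfolding \<iota>_def by (rule LI) (auto simp: A_def image_iff evalh_Const[OF ring_hom_Const] intro!:
        exI[of _ "Const c"])
  define zK where "zK = (\<lambda>m v. to_fract (X m v))"
  define Xk :: "4 option \<Rightarrow> 4 \<Rightarrow> (4 option \<times> 4, 'a) mpoly" where "Xk = (\<lambda>m v. Var (m, v))"
  \<comment> \<open>A second copy of the generic data, now as variables over the field that contains
    \<open>zK\<close>.\<close>
  define XK :: "4 option \<Rightarrow> 4 \<Rightarrow> (4 option \<times> 4, (nat, 'a) mpoly fract) mpoly" where "XK = (\<lambda>m v. Var (m, v))"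
  note m\<iota> = ring_hom_map_coeffs[OF \<iota>]
  have XK: "XK = (\<lambda>m v. map_coeffs \<iota> (Xk m v))"
    by (simp add: XK_def Xk_def map_coeffs_single[of \<iota>, OF ring_hom_0[OF \<iota>]] ring_hom_1[OF \<iota>])
  have coeffs: "lookup (map_coeffs \<iota> r) m \<in> L" for r :: "(4 option \<times> 4, 'a) mpoly" and m
    by (simp add: lookup_map_coeffs[of \<iota>, OF ring_hom_0[OF \<iota>]] \<iota>L)
  define evK where "evK r = eval r (case_prod zK)" for r
  have evK: "ring_hom evK" unfolding evK_def by (rule ring_hom_eval)
  have evXK: "(\<lambda>m v. evK (XK m v)) = zK" by (simp add: evK_def XK_def eval_Var[simplified])
  \<comment> \<open>A polynomial is nonzero as soon as one specialisation of it is.\<close>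
  have zK_nonzero: "to_fract r \<noteq> 0" if "ev z r \<noteq> 0" for z r
    using that ring_hom_0[OF ev[of z]] by auto
  have det: "zdet zK \<noteq> 0"
    unfolding zK_def zdet_hom[OF ring_hom_to_fract, symmetric]
    by (rule zK_nonzero[of base_point]) (simp only: zdet_hom[OF ev] evX zdet_base_point, simp)
  have nz: "zK None i \<noteq> 0" for i
    unfolding zK_def by (rule zK_nonzero[of base_point]) (use fun_cong[OF fun_cong[OF evX]] in \<open>simp
        add: base_point_def\<close>)
  have general: "1 + (\<Sum>i\<in>UNIV. of_int (\<epsilon> i) * zK None i ^ 3) \<noteq> 0" if \<epsilon>: "\<forall>i. \<epsilon> i = 1 \<or> \<epsilon> i = - 1" for \<epsilon>
  proof -
    have "1 + (\<Sum>i\<in>UNIV. of_int (\<epsilon> i) * zK None i ^ 3) = to_fract (1 + (\<Sum>i\<in>UNIV. of_int (\<epsilon> i) * X None i ^ 3))"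
      by (simp add: zK_def ring_hom_simps[OF ring_hom_to_fract] del: to_fract_add to_fract_mult)
    also have "\<dots> \<noteq> 0"
    proof (rule zK_nonzero[of base_point])
      have X1: "ev base_point (X None i) = 1" for i
        using fun_cong[OF fun_cong[OF evX[of base_point]], of None i] by (simp add: base_point_def)
      have "ev base_point (1 + (\<Sum>i\<in>UNIV. of_int (\<epsilon> i) * X None i ^ 3)) = of_int (1 + (\<Sum>i\<in>UNIV. \<epsilon> i))"
        by (simp add: ring_hom_simps[OF ev] X1)
      \<comment> \<open>At the base point the expression is one plus four signs, an odd number and
        so never zero.\<close>
      moreover have "odd (1 + (\<Sum>i\<in>UNIV. \<epsilon> i))"
      proof -
        have "odd (\<epsilon> i)" for i using \<epsilon>[rule_format, of i] by auto
        then show ?thesis by (simp add: sum_4)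
      qed
      ultimately show "ev base_point (1 + (\<Sum>i\<in>UNIV. of_int (\<epsilon> i) * X None i ^ 3)) \<noteq> 0"
        by (metis of_int_eq_0_iff even_zero)
    qed
    finally show ?thesis .
  qed
  have B0: "lookup (sylvester zK) cube1 \<noteq> 0"
  proof -
    obtain z :: "4 option \<Rightarrow> 4 \<Rightarrow> 'a" where z: "lookup (sylvester z) cube1 \<noteq> 0"
      by (rule sylvester_cube1_nonzero)
    show ?thesis
      unfolding zK_def lookup_sylvester_hom[OF ring_hom_to_fract, symmetric]
      by (rule zK_nonzero[of z]) (simp only: lookup_sylvester_hom[OF ev] evX z, simp)
  qed
  \<comment> \<open>One element collects everything that must stay nonzero modulo the prime.\<close>
  define w where "w = zdet XK * (\<Prod>i\<in>UNIV. XK None i)"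
  have "lookup (sylvester zK) \<nu> / lookup (sylvester zK) cube1 \<in> L"
  proof (rule ccontr)
    assume t: "lookup (sylvester zK) \<nu> / lookup (sylvester zK) cube1 \<notin> L"
    have evF: "eval (lookup (sylvester XK) k) (case_prod zK) = lookup (sylvester zK) k" for k
      using lookup_sylvester_hom[OF evK, of XK k] unfolding evXK by (simp add: evK_def)
    have evH: "eval (lookup (hess (sylvester XK)) k) (case_prod zK) = lookup (hess (sylvester zK)) k" for k
      using lookup_hess_sylvester_hom[OF evK, of XK k] unfolding evXK by (simp add: evK_def)
    have "eval w (case_prod zK) = zdet zK * (\<Prod>i\<in>UNIV. zK None i)"
      using zdet_hom[OF evK, of XK] fun_cong[OF fun_cong[OF evXK]] unfolding evXK
      by (simp add: w_def evK_def eval_simps)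
    then have w0: "eval w (case_prod zK) \<noteq> 0" using det nz by simp
    have "lookup (hess (sylvester zK)) j \<in> L" for j
    proof -
      have "\<phi> j \<in> A" unfolding A_def by (rule range_eqI[of _ _ "Var j"]) (simp only: evalh_Var[OF
          ring_hom_Const])
      from LI[OF this] show ?thesis by (simp add: \<phi>_def zK_def lookup_hess_sylvester_hom[OF
          ring_hom_to_fract])
    qed
    then obtain P where P: "prime_ideal P"
      "\<And>j. lookup (hess (sylvester XK)) j - Const (lookup (hess (sylvester zK)) j) \<in> P"
      "w \<notin> P" "lookup (sylvester XK) \<nu> * Const (lookup (sylvester zK) cube1)
        - lookup (sylvester XK) cube1 * Const (lookup (sylvester zK) \<nu>) \<notin> P"
      using descent_prime_ideal[OF L, of "lookup (sylvester XK) \<nu>" "lookup (sylvester XK) cube1"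
          w "lookup (hess (sylvester XK))" "case_prod zK"] w0 B0 t
      unfolding evF evH
      using coeffs unfolding XK w_def
      by (auto simp flip: lookup_sylvester_hom[OF m\<iota>] lookup_hess_sylvester_hom[OF m\<iota>] zdet_hom[OF m\<iota>]
        ring_hom_prod[OF m\<iota>] ring_hom_mult[OF m\<iota>])
    have id: "ring_ideal P" using P(1) by (simp add: prime_ideal_def)
    have "zdet XK \<notin> P" using P(3) ring_idealD(3)[OF id, of "zdet XK" "\<Prod>i\<in>UNIV. XK None i"] by (auto
        simp: w_def mult.commute)
    moreover have "XK None i \<notin> P" for i
    proof
      assume "XK None i \<in> P"
      then have "zdet XK * (\<Prod>j\<in>UNIV - {i}. XK None j) * XK None i \<in> P" by (rule ring_idealD(3)[OF id])
      with P(3) show False by (simp add: w_def prod.remove[of UNIV i] mult_ac)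
    qed
    ultimately have "bad_prime P"
      unfolding bad_prime_def using P det nz general by (intro conjI exI[of _ zK] exI[of _ XK]) blast+
    with no_bad_prime show False by blast
  qed
  then obtain a b where ab: "lookup (sylvester zK) \<nu> / lookup (sylvester zK) cube1 = to_fract a / to_fract b"
    "a \<in> A" "b \<in> A" "b \<noteq> 0" unfolding L_def by blast
  from ab(2,3) obtain p q where pq: "a = evalh Const p \<phi>" "b = evalh Const q \<phi>" by (auto simp: A_def)
  have "to_fract (b * lookup (sylvester X) \<nu>) = to_fract (a * lookup (sylvester X) cube1)"
    using ab(1,4) B0 unfolding zK_def lookup_sylvester_hom[OF ring_hom_to_fract, symmetric] by (simp
        add: field_simps)
  then have eq: "b * lookup (sylvester X) \<nu> = a * lookup (sylvester X) cube1"
    by (simp only: to_fract_eq_iff)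
  have ev_evalh: "ev z (evalh Const r \<phi>) = eval r (lookup (hess (sylvester z)))" for z r
    unfolding ring_hom_of_evalh[OF ev] \<phi>_def lookup_hess_sylvester_hom[OF ev] evX
    by (simp add: ev_def eval_Const eval_eq_evalh[of r])
  obtain x where x: "eval b x \<noteq> 0" by (rule eval_nonzero[OF ab(4)])
  define z0 where "z0 = (\<lambda>m v. x (enc (m, v)))"
  show ?thesis
  proof (rule that[of q z0 p])
    have hx: "ring_hom (\<lambda>r. eval r x)" by (rule ring_hom_eval)
    have "(\<lambda>m v. eval (X m v) x) = z0" by (simp add: X_def z0_def eval_Var[simplified])
    then have "eval b x = eval q (lookup (hess (sylvester z0)))"
      unfolding pq ring_hom_of_evalh[OF hx] \<phi>_def lookup_hess_sylvester_hom[OF hx]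
      by (simp add: eval_Const eval_eq_evalh[of q])
    with x show "eval q (lookup (hess (sylvester z0))) \<noteq> 0" by simp
  next
    fix z
    have "ev z (b * lookup (sylvester X) \<nu>) = ev z (a * lookup (sylvester X) cube1)"
      by (simp only: eq)
    then show "eval q (lookup (hess (sylvester z))) * lookup (sylvester z) \<nu> =
       eval p (lookup (hess (sylvester z))) * lookup (sylvester z) cube1"
      by (simp add: ring_hom_mult[OF ev] lookup_sylvester_hom[OF ev] evX pq ev_evalh)
  qed
qed

section \<open>Recovering a cubic from its Hessian\<close>

lemma forms_evalh:
  fixes p :: "('v, 'a::comm_ring_1) mpoly" and y :: "'v \<Rightarrow> ('w, 'a) mpoly"
  assumes p: "p \<in> forms J d" and y: "\<And>v. v \<in> J \<Longrightarrow> y v \<in> forms J' e"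
  shows "evalh Const p y \<in> forms J' (d * e)"
  unfolding evalh_def
proof (rule forms_sum)
  fix m assume m: "m \<in> keys p"
  have "monom_eval m y \<in> forms J' (\<Sum>v\<in>keys m. lookup m v * e)"
    unfolding monom_eval_def using m p
    by (intro forms_prod forms_power y) (auto simp: forms_def monomials_def)
  also have "(\<Sum>v\<in>keys m. lookup m v * e) = d * e"
    using m p by (auto simp: forms_def monomials_def mdegree_def simp flip: sum_distrib_right)
  finally show "Const (lookup p m) * monom_eval m y \<in> forms J' (d * e)"
    using forms_mult[OF forms_Const] by fastforce
qed

lemma eval_evalh_Const: "eval (evalh Const p y) x = eval p (\<lambda>v. eval (y v) x)"
  for p :: "('v, 'a::comm_ring_1) mpoly"
  by (simp add: ring_hom_of_evalh[OF ring_hom_eval] eval_Const) (simp add: eval_eq_evalh)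

section \<open>The Hessian as a polynomial map in the coefficients of a form\<close>

definition generic_form :: "nat \<Rightarrow> ('n::finite, ('n monomial, 'a::comm_ring_1) mpoly) mpoly" where
  "generic_form d = (\<Sum>m\<in>monomials UNIV d. single m (Var m))"

definition hess_coeff :: "nat \<Rightarrow> 'n::finite monomial \<Rightarrow> ('n monomial, 'a::comm_ring_1) mpoly" where
  "hess_coeff d k = lookup (hess (generic_form d)) k"

lemma eval_hess_coeff:
  fixes f :: "('n::finite, 'a::comm_ring_1) mpoly"
  assumes "f \<in> forms UNIV d"
  shows "eval (hess_coeff d k) (lookup f) = lookup (hess f) k"
proof -
  let ?h = "\<lambda>p :: ('n monomial, 'a) mpoly. eval p (lookup f)"
  have h: "ring_hom ?h" by (rule ring_hom_eval)
  have "map_coeffs ?h (generic_form d) = (\<Sum>m\<in>monomials UNIV d. single m (lookup f m))"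
    by (simp add: generic_form_def ring_hom_sum[OF ring_hom_map_coeffs[OF h]]
      map_coeffs_single[of ?h, OF ring_hom_0[OF h]] eval_Var[simplified])
  also have "\<dots> = (\<Sum>m\<in>keys f. single m (lookup f m))"
    using assms finite_monomials by (intro sum.mono_neutral_right) (auto simp: forms_def in_keys_iff)
  also have "\<dots> = f" by (rule poly_mapping_sum_singles[symmetric])
  finally have "map_coeffs ?h (generic_form d) = f" .
  then show ?thesis
    unfolding hess_coeff_def using lookup_map_coeffs[of ?h "hess (generic_form d)" k, OF ring_hom_0[OF h]]
    by (simp add: map_coeffs_hess[OF h])
qed

text \<open>The sets \<open>H c\<close> measure only the degree in the indeterminate coefficients.
  Differentiation preserves it, so the entries of the Hessian matrix have degree one and the
  determinant has the degree given by its size.\<close>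

lemma hess_coeff_forms: "(hess_coeff d k :: ('n::finite monomial, 'a::comm_ring_1) mpoly) \<in> forms
    (monomials UNIV d) CARD('n)"
proof -
  let ?J = "monomials (UNIV :: 'n set) d"
  define H :: "nat \<Rightarrow> ('n, ('n monomial, 'a) mpoly) mpoly set" where
    "H c = {f. \<forall>m. lookup f m \<in> forms ?J c}" for c
  have add: "f + g \<in> H c" if "f \<in> H c" "g \<in> H c" for f g c
    using that by (auto simp: H_def lookup_add intro: forms_add)
  have zero: "0 \<in> H c" for c by (simp add: H_def)
  have sum: "(\<And>a. a \<in> A \<Longrightarrow> f a \<in> H c) \<Longrightarrow> sum f A \<in> H c" for f c and A :: "'i set"
    by (induction A rule: infinite_finite_induct) (auto intro: add zero)
  have single: "single m p \<in> H c" if "p \<in> forms ?J c" for m p c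
    using that by (auto simp: H_def lookup_single when_def)
  have mult: "f * g \<in> H (c + c')" if "f \<in> H c" "g \<in> H c'" for f g c c'
  proof -
    have "f * g = (\<Sum>m\<in>keys f. \<Sum>n\<in>keys g.
        single (m + n) (lookup f m * lookup g n))"
      by (subst poly_mapping_sum_singles[of f], subst poly_mapping_sum_singles[of g])
        (simp add: sum_product mult_single)
    also have "\<dots> \<in> H (c + c')"
      using that by (intro sum single forms_mult) (auto simp: H_def)
    finally show ?thesis .
  qed
  have one: "1 \<in> H 0"
    using single[of 1 0 0] forms_1[of ?J] by simp
  have prod: "finite A \<Longrightarrow> (\<And>a. a \<in> A \<Longrightarrow> f a \<in> H (c a)) \<Longrightarrow> prod f A \<in> H (sum c A)" for f c and A :: "'n set"
    by (induction A rule: finite_induct) (auto simp: one intro: mult)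
  have pd: "pdiff v f \<in> H c" if "f \<in> H c" for v f c
    using that by (auto simp: H_def lookup_pdiff simp del: of_nat_Suc of_nat_add intro!: forms_of_nat_mult)
  have "generic_form d \<in> H 1"
    unfolding generic_form_def by (intro sum single forms_Var)
  then have e: "pdiff i (pdiff j (generic_form d)) \<in> H 1" for i j by (intro pd)
  have "hess (generic_form d :: ('n, ('n monomial, 'a) mpoly) mpoly) \<in> H CARD('n)"
    unfolding hess_def det_def
  proof (rule sum)
    fix p :: "'n \<Rightarrow> 'n"
    have "(\<Prod>i\<in>UNIV. (\<chi> i j. pdiff i (pdiff j (generic_form d))) $ i $ p i) \<in> H (\<Sum>i\<in>(UNIV :: 'n set). 1)"
      by (intro prod) (simp_all add: e[simplified])
    moreover have "of_int (sign p) \<in> H 0"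
      using single[of "of_int (sign p)" 0 0] forms_Const[of "of_int (sign p)" ?J] by simp
    ultimately show "of_int (sign p) * (\<Prod>i\<in>UNIV. (\<chi> i j. pdiff i (pdiff j (generic_form d))) $ i $ p i)
        \<in> H CARD('n)"
      using mult[of "of_int (sign p)" 0 _ "CARD('n)"] by simp
  qed
  then show ?thesis by (simp add: H_def hess_coeff_def)
qed

text \<open>Irreducibility of an affine space in elementary form: \<open>V\<close> may be any set
  closed under lines, such as the coefficient vectors of forms of a fixed degree.\<close>

lemma common_nonzero_family:
  fixes p :: "'i \<Rightarrow> ('v, 'a::field_char_0) mpoly"
  assumes "finite I" "V \<noteq> {}" "\<And>i. i \<in> I \<Longrightarrow> \<exists>x\<in>V. eval (p i) x \<noteq> 0"
    and V: "\<And>x y s. x \<in> V \<Longrightarrow> y \<in> V \<Longrightarrow> (\<lambda>v. x v + s * (y v - x v)) \<in> V"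
  shows "\<exists>x\<in>V. \<forall>i\<in>I. eval (p i) x \<noteq> 0"
  using assms(1,3)
proof (induction I rule: finite_induct)
  case empty
  then show ?case using assms(2) by blast
next
  case (insert i I)
  then obtain x where x: "x \<in> V" "\<forall>i\<in>I. eval (p i) x \<noteq> 0" by auto
  from insert.prems obtain y where y: "y \<in> V" "eval (p i) y \<noteq> 0" by blast
  have "eval (\<Prod>i\<in>I. p i) x \<noteq> 0" using x insert.hyps by (simp add: eval_simps)
  from common_nonzero[OF this y(2)] obtain s where s:
    "eval (\<Prod>i\<in>I. p i) (\<lambda>v. x v + s * (y v - x v)) \<noteq> 0" "eval (p i) (\<lambda>v. x v + s * (y v - x v)) \<noteq> 0" .
  then show ?case
    using V[OF x(1) y(1), of s] insert.hyps by (intro bexI[of _ "\<lambda>v. x v + s * (y v - x v)"]) (auto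
        simp: eval_simps)
qed

lemma common_nonzero_forms:
  fixes p :: "'i \<Rightarrow> ('n::finite monomial, 'a::field_char_0) mpoly"
  assumes "finite I" "\<And>i. i \<in> I \<Longrightarrow> \<exists>f\<in>forms UNIV d. eval (p i) (lookup f) \<noteq> 0"
  obtains f where "f \<in> forms UNIV d" "\<And>i. i \<in> I \<Longrightarrow> eval (p i) (lookup f) \<noteq> 0"
proof -
  let ?V = "lookup ` (forms UNIV d :: ('n, 'a) mpoly set)"
  have "\<exists>x\<in>?V. \<forall>i\<in>I. eval (p i) x \<noteq> 0"
  proof (rule common_nonzero_family)
    show "?V \<noteq> {}" using forms_0 by blast
    show "\<exists>x\<in>?V. eval (p i) x \<noteq> 0" if "i \<in> I" for i using assms(2)[OF that] by blast
    fix x y s assume "x \<in> ?V" "y \<in> ?V"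
    then obtain f g where fg: "f \<in> forms UNIV d" "x = lookup f" "g \<in> forms UNIV d" "y = lookup g"
      by blast
    have "lookup (f + Const s * (g - f)) = (\<lambda>v. x v + s * (y v - x v))"
      using fg by (simp add: fun_eq_iff lookup_add lookup_Const_mult lookup_minus)
    moreover have "f + Const s * (g - f) \<in> forms UNIV d"
      using forms_mult[OF forms_Const forms_diff[OF fg(3,1)], of s] fg(1) by (intro forms_add) simp_all
    ultimately show "(\<lambda>v. x v + s * (y v - x v)) \<in> ?V" by (metis imageI)
  qed (rule assms(1))
  then show ?thesis using that by blast
qed

lemma hess_nonzero: "\<exists>f\<in>forms UNIV 3. hess (f :: (4, 'a::field_char_0) mpoly) \<noteq> 0"
proof
  show "sylvester base_point \<in> (forms UNIV 3 :: (4, 'a) mpoly set)" by (rule sylvester_forms)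
  define y where "y = lvals (base_point :: 4 option \<Rightarrow> 4 \<Rightarrow> 'a) (\<lambda>_. 1)"
  have y: "y None = - 4" "y (Some i) = 1" for i
    unfolding y_def lvals_def coef_base_point by simp_all
  have r: "relc (base_point :: 4 option \<Rightarrow> 4 \<Rightarrow> 'a) m = 1" for m by (cases m) (simp_all add: base_point_def)
  have 1: "UNIV - {None} = range (Some :: 4 \<Rightarrow> _)" and
    2: "UNIV - {Some i} = insert None (Some ` (UNIV - {i}))" for i :: 4
    by (auto simp: UNIV_option_conv)
  \<comment> \<open>One term is \<open>1\<close>, and each of the other four is
    \<open>- 4\<close>.\<close>
  have "syl (relc base_point) y = - 15"
    unfolding syl_def sum_option r 1 2 by (simp add: prod.reindex y)
  then have "eval (hess (sylvester (base_point :: 4 option \<Rightarrow> 4 \<Rightarrow> 'a))) (\<lambda>_. 1) = 6 ^ 4 * - 15"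
    by (simp add: eval_hess_sylvester zdet_base_point y_def)
  moreover have "eval (0 :: (4, 'a) mpoly) (\<lambda>_. 1) = 0" by (simp add: eval_simps)
  ultimately show "hess (sylvester base_point :: (4, 'a) mpoly) \<noteq> 0" by auto
qed

lemma hess_Const_mult:
  fixes f :: "('n::finite, 'a::field) mpoly"
  shows "hess (Const c * f) = Const (c ^ CARD('n)) * hess f"
proof (cases "c = 0")
  case True
  have "pdiff i (pdiff j (0 :: ('n, 'a) mpoly)) = 0" for i j by (simp add: pdiff_0)
  then have "hess (0 :: ('n, 'a) mpoly) = det (0 :: ('n, 'a) mpoly ^ 'n ^ 'n)"
    unfolding hess_def by (intro arg_cong[where f = det]) (simp add: vec_eq_iff)
  also have "\<dots> = 0" by (simp add: det_def zero_power)
  finally show ?thesis using True by (simp add: zero_power)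
next
  case False
  then show ?thesis using hess_scale[of c f] by (simp add: mult_map_scale_conv_mult)
qed

text \<open>Density extends the identity of \<open>sylvester_rational\<close> to all cubics.
  Replacing \<open>f\<close> by \<open>s * f\<close> multiplies the Hessian by \<open>s ^ 4\<close>
  and the coefficients of \<open>f\<close> by \<open>s\<close>, so comparing powers of
  \<open>s\<close> isolates the homogeneous components of \<open>p\<close> and
  \<open>q\<close>.\<close>

lemma cubic_rational_coeff:
  fixes \<nu> :: "4 monomial"
  obtains e and p q :: "(4 monomial, 'a::field_char_0) mpoly" and f0
  where "p \<in> forms (monomials UNIV 4) e" "q \<in> forms (monomials UNIV 4) e"
    "\<And>f. f \<in> forms UNIV 3 \<Longrightarrow> eval q (lookup (hess f)) * lookup f \<nu> =
      eval p (lookup (hess f)) * lookup f cube1"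
    "f0 \<in> forms UNIV 3" "eval q (lookup (hess f0)) \<noteq> 0"
proof -
  let ?J = "monomials (UNIV :: 4 set) 4"
  obtain p q :: "(4 monomial, 'a) mpoly" and z0 where z0: "eval q (lookup (hess (sylvester z0))) \<noteq> 0"
    and eq: "\<And>z. eval q (lookup (hess (sylvester z))) * lookup (sylvester z) \<nu> =
       eval p (lookup (hess (sylvester z))) * lookup (sylvester z) cube1"
    by (rule sylvester_rational[of \<nu>]) blast
  define \<Psi> where "\<Psi> = evalh Const q (hess_coeff 3) * Var \<nu> - evalh Const p (hess_coeff 3) * Var cube1"
  have \<Psi>: "eval \<Psi> (lookup f) = eval q (lookup (hess f)) * lookup f \<nu> -
      eval p (lookup (hess f)) * lookup f cube1" if "f \<in> forms UNIV 3" for f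
    by (simp add: \<Psi>_def eval_simps eval_evalh_Const eval_hess_coeff[OF that])
  have all: "eval q (lookup (hess f)) * lookup f \<nu> =
      eval p (lookup (hess f)) * lookup f cube1" if "f \<in> forms UNIV 3" for f
    using sylvester_dense[of \<Psi>, OF _ that] \<Psi>[OF that] eq \<Psi>[OF sylvester_forms] by simp
  obtain N1 where N1: "\<And>m. m \<in> keys p \<Longrightarrow> mdegree m \<le> N1" using mdegree_bound by blast
  obtain N2 where N2: "\<And>m. m \<in> keys q \<Longrightarrow> mdegree m \<le> N2" using mdegree_bound by blast
  define N where "N = max N1 N2"
  have N: "m \<in> keys p \<Longrightarrow> mdegree m \<le> N" "m \<in> keys q \<Longrightarrow> mdegree m \<le> N" for m
    using N1[of m] N2[of m] by (auto simp: N_def)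
  have supp: "lookup (hess f) m = 0" if "f \<in> forms UNIV 3" "m \<notin> ?J" for m and f :: "(4, 'a) mpoly"
    using forms_hess[of f 1] that by (auto dest: formsD simp: numeral_3_eq_3)
  have comp: "eval (hcomp ?J e q) (lookup (hess f)) * lookup f \<nu> =
      eval (hcomp ?J e p) (lookup (hess f)) * lookup f cube1"
    if f: "f \<in> forms UNIV 3" and e: "e \<le> N" for f e
  proof -
    let ?y = "lookup (hess f)"
    define c where "c e = eval (hcomp ?J e q) ?y * lookup f \<nu> - eval (hcomp ?J e p) ?y * lookup f cube1" for e
    have "poly (\<Sum>e\<le>N. Polynomial.monom (c e) (4 * e + 1)) s = 0" for s
    proof -
      have "Const s * f \<in> forms UNIV 3" using forms_mult[OF forms_Const f, of s] by simp
      from all[OF this] have "eval q (\<lambda>m. s ^ 4 * ?y m) * (s * lookup f \<nu>) =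
          eval p (\<lambda>m. s ^ 4 * ?y m) * (s * lookup f cube1)"
        by (simp add: hess_Const_mult lookup_Const_mult[abs_def])
      then have "(\<Sum>e\<le>N. (s ^ 4) ^ e * eval (hcomp ?J e q) ?y) * (s * lookup f \<nu>) =
          (\<Sum>e\<le>N. (s ^ 4) ^ e * eval (hcomp ?J e p) ?y) * (s * lookup f cube1)"
        using eval_hcomp[of ?J ?y q N "s ^ 4", OF supp[OF f] N(2)] eval_hcomp[of ?J ?y p N "s ^ 4", OF
            supp[OF f] N(1)]
        by simp
      moreover have "(\<Sum>e\<le>N. c e * ((s ^ 4) ^ e * s)) =
          (\<Sum>e\<le>N. (s ^ 4) ^ e * eval (hcomp ?J e q) ?y) * (s * lookup f \<nu>) -
          (\<Sum>e\<le>N. (s ^ 4) ^ e * eval (hcomp ?J e p) ?y) * (s * lookup f cube1)"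
        unfolding c_def sum_distrib_right sum_subtractf[symmetric] by (intro sum.cong refl) (simp add:
            algebra_simps)
      ultimately have "(\<Sum>e\<le>N. c e * ((s ^ 4) ^ e * s)) = 0" by simp
      then show ?thesis by (simp add: poly_sum poly_monom mult_ac flip: power_mult)
    qed
    then have "(\<Sum>e\<le>N. Polynomial.monom (c e) (4 * e + 1)) = 0" using poly_all_0_iff_0 by blast
    then have "coeff (\<Sum>e\<le>N. Polynomial.monom (c e) (4 * e + 1)) (4 * e + 1) = 0" by simp
    then have "c e = 0" using e by (simp add: coeff_sum)
    then show ?thesis by (simp add: c_def)
  qed
  have "(\<Sum>e\<le>N. 1 ^ e * eval (hcomp ?J e q) (lookup (hess (sylvester z0)))) \<noteq> 0"
    using eval_hcomp[of ?J _ q N 1, OF supp[OF sylvester_forms[of z0]] N(2)] z0 by simp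
  then obtain e where "e \<le> N" "eval (hcomp ?J e q) (lookup (hess (sylvester z0))) \<noteq> 0"
    by (metis (mono_tags, lifting) atMost_iff mult_zero_right sum.neutral)
  with comp show ?thesis
    using that[OF hcomp_forms hcomp_forms _ sylvester_forms] by blast
qed

theorem cubic_rational:
  obtains e and R :: "4 monomial \<Rightarrow> (4 monomial, 'a::field_char_0) mpoly" and f0
  where "\<And>\<nu>. R \<nu> \<in> forms (monomials UNIV 4) e"
    "\<And>f \<nu>. f \<in> forms UNIV 3 \<Longrightarrow> eval (R cube1) (lookup (hess f)) * lookup f \<nu> =
      eval (R \<nu>) (lookup (hess f)) * lookup f cube1"
    "f0 \<in> forms UNIV 3" "eval (R cube1) (lookup (hess f0)) \<noteq> 0"
    "lookup f0 cube1 \<noteq> 0" "hess f0 \<noteq> 0"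
proof -
  let ?J3 = "monomials (UNIV :: 4 set) 3" and ?J4 = "monomials (UNIV :: 4 set) 4"
  have "\<exists>e p q f0. p \<in> forms ?J4 e \<and> q \<in> forms ?J4 e \<and>
    (\<forall>f\<in>forms UNIV 3. eval q (lookup (hess f)) * lookup f \<nu> =
      eval p (lookup (hess f)) * lookup f cube1) \<and>
    f0 \<in> forms UNIV 3 \<and> eval q (lookup (hess f0)) \<noteq> (0::'a)" for \<nu>
    by (rule cubic_rational_coeff[of \<nu>]) blast
  then obtain e p q g where pq: "\<And>\<nu>. p \<nu> \<in> forms ?J4 (e \<nu>)" "\<And>\<nu>. q \<nu> \<in> forms ?J4 (e \<nu>)"
    and eq: "\<And>\<nu> f. f \<in> forms UNIV 3 \<Longrightarrow> eval (q \<nu>) (lookup (hess f)) * lookup f \<nu> =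
      eval (p \<nu>) (lookup (hess f)) * lookup f cube1"
    and g: "\<And>\<nu>. g \<nu> \<in> forms UNIV 3" "\<And>\<nu>. eval (q \<nu>) (lookup (hess (g \<nu>))) \<noteq> (0::'a)"
    by metis
  have fin: "finite ?J3" by (rule finite_monomials)
  define D where "D = (\<Prod>\<kappa>\<in>?J3. q \<kappa>)"
  \<comment> \<open>All ratios are brought to the common denominator \<open>D\<close>. At
    \<open>cube1\<close> the ratio is \<open>1\<close>, hence the entry \<open>D\<close> itself;
    outside the cubic monomials the coefficients vanish.\<close>
  define R where "R \<nu> = (if \<nu> = cube1 then D else if \<nu> \<in> ?J3 then p \<nu> * (\<Prod>\<kappa>\<in>?J3 - {\<nu>}. q \<kappa>) else 0)" for \<nu>
  have "R \<nu> \<in> forms ?J4 (\<Sum>\<kappa>\<in>?J3. e \<kappa>)" for \<nu>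
  proof -
    have "D \<in> forms ?J4 (\<Sum>\<kappa>\<in>?J3. e \<kappa>)" unfolding D_def by (intro forms_prod fin pq)
    moreover have "p \<nu> * (\<Prod>\<kappa>\<in>?J3 - {\<nu>}. q \<kappa>) \<in> forms ?J4 (\<Sum>\<kappa>\<in>?J3. e \<kappa>)" if "\<nu> \<in> ?J3"
      unfolding sum.remove[OF fin that, of e] by (intro forms_mult pq forms_prod) (use fin pq in auto)
    ultimately show ?thesis by (simp add: R_def)
  qed
  moreover have "eval (R cube1) (lookup (hess f)) * lookup f \<nu> =
      eval (R \<nu>) (lookup (hess f)) * lookup f cube1" if f: "f \<in> forms UNIV 3" for f \<nu>
  proof -
    consider "\<nu> = cube1" | "\<nu> \<noteq> cube1" "\<nu> \<in> ?J3" | "\<nu> \<notin> ?J3" "\<nu> \<noteq> cube1" by blast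
    then show ?thesis
    proof cases
      case 2
      have "D = q \<nu> * (\<Prod>\<kappa>\<in>?J3 - {\<nu>}. q \<kappa>)" unfolding D_def using fin 2(2) by (rule prod.remove)
      with 2 eq[OF f, of \<nu>] show ?thesis by (simp add: R_def eval_simps mult_ac)
    next
      case 3
      then have "lookup f \<nu> = 0" using f by (auto dest: formsD)
      with 3 show ?thesis by (simp add: R_def eval_simps)
    qed simp
  qed
  moreover have "\<exists>f\<in>forms UNIV 3. eval (R cube1) (lookup (hess f)) \<noteq> 0 \<and>
      lookup f cube1 \<noteq> 0 \<and> hess f \<noteq> 0"
  proof -
    obtain h0 :: "(4, 'a) mpoly" where h0: "h0 \<in> forms UNIV 3" "hess h0 \<noteq> 0" using hess_nonzero by blast
    then obtain j where j: "lookup (hess h0) j \<noteq> 0" by (metis lookup_zero poly_mapping_eqI)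
    \<comment> \<open>Three kinds of conditions share one index type. The monomial \<open>0\<close>
      is not cubic, so \<open>Some 0\<close> is free for the condition on the coefficient at
      \<open>cube1\<close>.\<close>
    define P where "P i = (case i of None \<Rightarrow> hess_coeff 3 j | Some \<kappa> \<Rightarrow> if \<kappa> = 0 then Var cube1
      else evalh Const (q \<kappa>) (hess_coeff 3))" for i
    obtain z :: "4 option \<Rightarrow> 4 \<Rightarrow> 'a" where z: "lookup (sylvester z) cube1 \<noteq> 0"
      by (rule sylvester_cube1_nonzero)
    have evq: "eval (evalh Const r (hess_coeff 3)) (lookup f) = eval r (lookup (hess f))"
      if "f \<in> forms UNIV 3" for r and f :: "(4, 'a) mpoly"
      by (simp add: eval_evalh_Const eval_hess_coeff[OF that])
    have "\<exists>f\<in>forms UNIV 3. eval (P i) (lookup f) \<noteq> 0" for i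
    proof (cases i)
      case None
      then show ?thesis using h0 j by (intro bexI[of _ h0]) (simp_all add: P_def eval_hess_coeff)
    next
      case (Some \<kappa>)
      show ?thesis
      proof (cases "\<kappa> = 0")
        case True
        then show ?thesis using Some z sylvester_forms[of z]
          by (intro bexI[of _ "sylvester z"]) (simp_all add: P_def eval_Var[simplified])
      next
        case False
        then show ?thesis using Some g[of \<kappa>] by (intro bexI[of _ "g \<kappa>"]) (simp_all add: P_def evq)
      qed
    qed
    then obtain f where f: "f \<in> forms UNIV 3" "\<And>i. i \<in> insert None (Some ` insert 0 ?J3) \<Longrightarrow> eval (P i)
        (lookup f) \<noteq> 0"
      using common_nonzero_forms[of "insert None (Some ` insert 0 ?J3)" 3 P] fin by auto
    have "lookup f cube1 \<noteq> 0" using f(2)[of "Some 0"] by (simp add: P_def eval_Var[simplified])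
    moreover have "lookup (hess f) j \<noteq> 0" using f(2)[of None] by (simp add: P_def eval_hess_coeff[OF f(1)])
    then have "hess f \<noteq> 0" by auto
    moreover have "eval (q \<kappa>) (lookup (hess f)) \<noteq> 0" if "\<kappa> \<in> ?J3" for \<kappa>
    proof -
      have "\<kappa> \<noteq> 0" using that by (auto simp: monomials_def)
      with f(2)[of "Some \<kappa>"] that show ?thesis by (simp add: P_def evq[OF f(1)])
    qed
    then have "eval (R cube1) (lookup (hess f)) \<noteq> 0"
      using fin by (simp add: R_def D_def eval_simps)
    ultimately show ?thesis using f(1) by blast
  qed
  ultimately show ?thesis using that by blast
qed

section \<open>The Zariski topology\<close>

lemma proj_self: "a \<in> proj a"
  unfolding proj_def by (auto intro!: exI[of _ 1] poly_mapping_eqI simp: Poly_Mapping.map.rep_eq when_def)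

lemma lookup_scale: "lookup (Poly_Mapping.map ((*) c) a) v = c * lookup a v"
  for c :: "'a::field"
  by (simp add: Poly_Mapping.map.rep_eq when_def)

lemma proj_eqD:
  assumes "proj a = proj b"
  obtains c where "c \<noteq> 0" "\<And>v. lookup a v = c * lookup b v"
proof -
  from assms proj_self[of a] have "a \<in> proj b" by simp
  then show ?thesis using that by (auto simp: proj_def lookup_scale)
qed

lemma proj_eqI:
  assumes "c \<noteq> 0" "\<And>v. lookup a v = c * lookup b v"
  shows "proj a = proj b"
proof -
  have "a = Poly_Mapping.map ((*) c) b" by (rule poly_mapping_eqI) (simp add: assms(2) lookup_scale)
  then show ?thesis using proj_scale[OF assms(1)] by simp
qed

lemma nzvecs_proj:
  assumes "proj a = proj b" "b \<in> nzvecs J" shows "a \<in> nzvecs J"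
proof -
  obtain c where c: "c \<noteq> 0" "\<And>v. lookup a v = c * lookup b v" by (rule proj_eqD[OF assms(1)]) blast
  have "keys a = keys b" using c by (auto simp: in_keys_iff)
  moreover have "a \<noteq> 0"
  proof
    assume "a = 0"
    with c have "b = 0" by (intro poly_mapping_eqI) simp
    with assms(2) show False by (simp add: nzvecs_def)
  qed
  ultimately show ?thesis using assms(2) by (auto simp: nzvecs_def)
qed

lemma proj_mem_basic_open:
  assumes "P \<in> forms J d"
  shows "proj a \<in> basic_open J P \<longleftrightarrow> a \<in> nzvecs J \<and> eval P (lookup a) \<noteq> 0"
proof
  assume "proj a \<in> basic_open J P"
  then obtain b where b: "proj a = proj b" "b \<in> nzvecs J" "eval P (lookup b) \<noteq> 0"
    by (auto simp: basic_open_def)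
  obtain c where c: "c \<noteq> 0" "\<And>v. lookup a v = c * lookup b v" by (rule proj_eqD[OF b(1)]) blast
  then have "lookup a = (\<lambda>v. c * lookup b v)" by blast
  with b(3) c(1) eval_scale[OF assms, of c] nzvecs_proj[OF b(1,2)]
  show "a \<in> nzvecs J \<and> eval P (lookup a) \<noteq> 0" by simp
qed (auto simp: basic_open_def)

lemma openin_basic_open: "P \<in> forms J d \<Longrightarrow> openin (zariski J) (basic_open J P)"
  unfolding zariski_def openin_topology_generated_by_iff by (rule generate_topology_on.Basis) blast

text \<open>Products of forms show that the basic open sets are stable under intersection, so they
  are a basis and not merely a subbasis.\<close>

lemma openin_zariskiD:
  assumes "openin (zariski J) U" "p \<in> U"
  obtains P d where "P \<in> forms J d" "p \<in> basic_open J P" "basic_open J P \<subseteq> U"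
proof -
  have "generate_topology_on {basic_open J P | P d. P \<in> forms J d} U"
    using assms(1) by (simp add: zariski_def openin_topology_generated_by_iff)
  then have "\<forall>p\<in>U. \<exists>P d. P \<in> forms J d \<and> p \<in> basic_open J P \<and> basic_open J P \<subseteq> U"
  proof (induction rule: generate_topology_on.induct)
    case (Int A B)
    show ?case
    proof
      fix p assume "p \<in> A \<inter> B"
      with Int.IH obtain P d Q e where P: "P \<in> forms J d" "p \<in> basic_open J P" "basic_open J P \<subseteq> A"
        and Q: "Q \<in> forms J e" "p \<in> basic_open J Q" "basic_open J Q \<subseteq> B" by blast
      note PQ = forms_mult[OF P(1) Q(1)]
      from P(2) obtain a where a: "p = proj a" by (auto simp: basic_open_def)
      have "basic_open J (P * Q) \<subseteq> basic_open J P \<inter> basic_open J Q"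
        by (auto simp: basic_open_def eval_simps)
      moreover have "p \<in> basic_open J (P * Q)"
        using P(2) Q(2) unfolding a proj_mem_basic_open[OF P(1)] proj_mem_basic_open[OF Q(1)]
            proj_mem_basic_open[OF PQ]
        by (simp add: eval_simps)
      ultimately show "\<exists>P d. P \<in> forms J d \<and> p \<in> basic_open J P \<and> basic_open J P \<subseteq> A \<inter> B"
        using PQ P(3) Q(3) by blast
    qed
  next
    case (UN K)
    then show ?case by blast
  qed blast+
  with assms(2) that show ?thesis by blast
qed

lemma openin_zariskiI:
  assumes "\<And>p. p \<in> U \<Longrightarrow> \<exists>P d. P \<in> forms J d \<and> p \<in> basic_open J P \<and> basic_open J P \<subseteq> U"
  shows "openin (zariski J) U"
proof (subst openin_subopen, intro ballI)
  fix p assume "p \<in> U"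
  from assms[OF this] show "\<exists>T. openin (zariski J) T \<and> p \<in> T \<and> T \<subseteq> U" using openin_basic_open by blast
qed

text \<open>An open set that meets the closure already meets \<open>S\<close>, so irreducibility
  passes from \<open>S\<close> to its closure; for \<open>S\<close> it says that two nonempty basic
  open subsets always intersect.\<close>

lemma proj_variety_closure:
  assumes S: "S \<subseteq> proj_space J" "S \<noteq> {}"
    and meet: "\<And>P d Q e. P \<in> forms J d \<Longrightarrow> Q \<in> forms J e \<Longrightarrow> basic_open J P \<inter> S \<noteq> {} \<Longrightarrow> basic_open J Q \<inter> S \<noteq> {} \<Longrightarrow>
      basic_open J P \<inter> basic_open J Q \<inter> S \<noteq> {}"
  shows "proj_variety J (zariski J closure_of S)"
  unfolding proj_variety_def irreducible_in_def
proof (intro conjI allI impI)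
  let ?T = "zariski J"
  show "closedin ?T (?T closure_of S)" by simp
  show "?T closure_of S \<subseteq> topspace ?T" by (rule closure_of_subset_topspace)
  have sub: "S \<subseteq> ?T closure_of S" using S(1) by (intro closure_of_subset) (simp add: topspace_zariski)
  then show "?T closure_of S \<noteq> {}" using S(2) by blast
  fix A B assume A: "closedin ?T A" and B: "closedin ?T B" and AB: "?T closure_of S \<subseteq> A \<union> B"
  show "?T closure_of S \<subseteq> A \<or> ?T closure_of S \<subseteq> B"
  proof (rule ccontr)
    assume n: "\<not> ?thesis"
    have "\<exists>P d. P \<in> forms J d \<and> basic_open J P \<inter> S \<noteq> {} \<and> basic_open J P \<inter> C = {}"
      if C: "closedin ?T C" "\<not> ?T closure_of S \<subseteq> C" for C
    proof -
      have "\<not> S \<subseteq> C" using C closure_of_minimal by blast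
      then obtain p where p: "p \<in> S" "p \<notin> C" by blast
      then have "p \<in> topspace ?T - C" using S(1) by (auto simp: topspace_zariski)
      moreover have "openin ?T (topspace ?T - C)" using C(1) by (simp add: closedin_def)
      ultimately obtain P d where "P \<in> forms J d" "p \<in> basic_open J P" "basic_open J P \<subseteq> topspace ?T - C"
        by (metis openin_zariskiD)
      with p(1) show ?thesis by blast
    qed
    with A B n obtain P d Q e where "P \<in> forms J d" "basic_open J P \<inter> S \<noteq> {}" "basic_open J P \<inter> A = {}"
      "Q \<in> forms J e" "basic_open J Q \<inter> S \<noteq> {}" "basic_open J Q \<inter> B = {}" by meson
    with meet[of P d Q e] sub AB show False by blast
  qed
qed

lemma nzvecs_forms: "a \<in> nzvecs (monomials UNIV d) \<longleftrightarrow> a \<noteq> 0 \<and> a \<in> forms UNIV d"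
  by (simp add: nzvecs_def forms_def)

lemma nonzero_lookup:
  assumes "a \<in> nzvecs J" obtains v where "v \<in> J" "lookup a v \<noteq> 0"
proof -
  from assms obtain v where "lookup a v \<noteq> 0" by (auto simp: nzvecs_def) (metis lookup_zero poly_mapping_eqI)
  with assms that show ?thesis by (auto simp: nzvecs_def in_keys_iff)
qed

text \<open>The forms \<open>R\<close> come from an existence statement; fixing them as parameters
  allows definitions that depend on them. The cubic \<open>f0\<close> witnesses that the open sets
  below are nonempty.\<close>

locale hessian_inverse =
  fixes R :: "4 monomial \<Rightarrow> (4 monomial, 'k::{alg_closed_field, field_char_0}) mpoly" and e :: nat
    and f0 :: "(4, 'k) mpoly"
  assumes R: "\<And>\<nu>. R \<nu> \<in> forms (monomials UNIV 4) e"
    and RH: "\<And>f \<nu>. f \<in> forms UNIV 3 \<Longrightarrow> eval (R cube1) (lookup (hess f)) * lookup f \<nu> =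
      eval (R \<nu>) (lookup (hess f)) * lookup f cube1"
    and f0: "f0 \<in> forms UNIV 3" "eval (R cube1) (lookup (hess f0)) \<noteq> 0"
    "lookup f0 cube1 \<noteq> 0" "hess f0 \<noteq> 0"
begin

abbreviation "J3 \<equiv> monomials (UNIV :: 4 set) 3"
abbreviation "J4 \<equiv> monomials (UNIV :: 4 set) 4"

definition inv_form :: "(4, 'k) mpoly \<Rightarrow> (4, 'k) mpoly" where
  "inv_form b = (\<Sum>\<nu>\<in>J3. single \<nu> (eval (R \<nu>) (lookup b)))"

text \<open>The representative is arbitrary: the forms \<open>R\<close> have one common degree, so
  another choice only rescales the result.\<close>

definition inv_map :: "(4 monomial, 'k) point \<Rightarrow> (4 monomial, 'k) point" where
  "inv_map q = proj (inv_form (SOME b. q = proj b))"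

lemma hess_forms: "f \<in> forms UNIV 3 \<Longrightarrow> hess f \<in> forms UNIV 4" for f :: "(4, 'k) mpoly"
  using forms_hess[of f 1] by (simp add: numeral_3_eq_3)

lemma hess_nzvecs: "f \<in> forms UNIV 3 \<Longrightarrow> hess f \<noteq> 0 \<Longrightarrow> hess f \<in> nzvecs J4" for f :: "(4, 'k) mpoly"
  by (simp add: nzvecs_forms hess_forms)

lemma inv_form_forms: "inv_form b \<in> forms UNIV 3"
  unfolding inv_form_def by (intro forms_sum forms_single)

lemma lookup_inv_form: "lookup (inv_form b) \<nu> = (if \<nu> \<in> J3 then eval (R \<nu>) (lookup b) else 0)"
  using finite_monomials[of 3, where 'v = 4]
  by (simp add: inv_form_def lookup_sum lookup_single when_def sum.delta)

lemma cube1_in: "cube1 \<in> J3"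
  by (simp add: monomials_def)

lemma inv_map_proj:
  assumes "b \<in> nzvecs J4"
  shows "inv_map (proj b) = proj (inv_form b)"
proof -
  define b' where "b' = (SOME b'. proj b = proj b')"
  have "proj b = proj b'" unfolding b'_def by (rule someI) (rule refl)
  then obtain c where c: "c \<noteq> 0" "\<And>v. lookup b' v = c * lookup b v"
    using proj_eqD[of b' b] by metis
  have "lookup b' = (\<lambda>v. c * lookup b v)" using c(2) by blast
  then have "lookup (inv_form b') \<nu> = c ^ e * lookup (inv_form b) \<nu>" for \<nu>
    by (simp add: lookup_inv_form eval_scale[OF R])
  then have "proj (inv_form b') = proj (inv_form b)" using c(1) by (intro proj_eqI[of "c ^ e"]) auto
  then show ?thesis by (simp add: inv_map_def b'_def)
qed

lemma inv_form_hess: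
  assumes "f \<in> forms UNIV 3"
  shows "Const (eval (R cube1) (lookup (hess f))) * f = Const (lookup f cube1) * inv_form (hess f)"
proof (rule poly_mapping_eqI)
  fix \<nu>
  have "\<nu> \<notin> J3 \<Longrightarrow> lookup f \<nu> = 0" using assms by (auto dest: formsD)
  with RH[OF assms, of \<nu>]
  show "lookup (Const (eval (R cube1) (lookup (hess f))) * f) \<nu> =
      lookup (Const (lookup f cube1) * inv_form (hess f)) \<nu>"
    unfolding lookup_Const_mult lookup_inv_form by (auto simp: mult.commute)
qed

lemma inv_form_hess':
  assumes "f \<in> forms UNIV 3" "lookup f cube1 \<noteq> 0"
  shows "inv_form (hess f) = Const (eval (R cube1) (lookup (hess f)) / lookup f cube1) * f"
proof (rule poly_mapping_eqI)
  fix \<nu>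
  show "lookup (inv_form (hess f)) \<nu> =
      lookup (Const (eval (R cube1) (lookup (hess f)) / lookup f cube1) * f) \<nu>"
    using arg_cong[OF inv_form_hess[OF assms(1)], of "\<lambda>p. lookup p \<nu>"] assms(2)
    unfolding lookup_Const_mult by (simp add: field_simps)
qed

text \<open>The coordinates of the composite of the candidate inverse with the Hessian map. As they
  are forms, their relations on the image extend to the closure \<open>Y\<close>.\<close>

definition HR :: "4 monomial \<Rightarrow> (4 monomial, 'k) mpoly" where
  "HR k = evalh Const (hess_coeff 3 k) R"

lemma HR_forms: "HR k \<in> forms J4 (4 * e)"
  unfolding HR_def using forms_evalh[OF hess_coeff_forms[of 3 k] R] by simp

lemma eval_HR: "eval (HR k) (lookup b) = lookup (hess (inv_form b)) k"
proof -
  have "eval (HR k) (lookup b) = eval (hess_coeff 3 k) (\<lambda>\<nu>. eval (R \<nu>) (lookup b))"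
    by (simp add: HR_def eval_evalh_Const)
  also have "\<dots> = eval (hess_coeff 3 k) (lookup (inv_form b))"
    unfolding eval_eq_evalh[of "hess_coeff 3 k"]
    by (rule evalh_cong[OF _ hess_coeff_forms]) (simp add: lookup_inv_form)
  also have "\<dots> = lookup (hess (inv_form b)) k"
    by (rule eval_hess_coeff[OF inv_form_forms])
  finally show ?thesis .
qed

definition im :: "(4 monomial, 'k) point set" where
  "im = Hess ` hess_domain 3"

lemma mem_hess_domain: "proj f \<in> hess_domain 3 \<longleftrightarrow> f \<in> nzvecs J3 \<and> hess f \<noteq> 0"
  for f :: "(4, 'k) mpoly"
proof
  assume "proj f \<in> hess_domain 3"
  then obtain g :: "(4, 'k) mpoly" where g: "proj f = proj g" "g \<in> nzvecs J3" "hess g \<noteq> 0" by (auto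
      simp: hess_domain_def)
  then obtain c where c: "c \<noteq> 0" "f = Poly_Mapping.map ((*) c) g"
    using proj_self[of f] by (auto simp: proj_def)
  obtain k where "lookup (hess g) k \<noteq> 0" using g(3) by (metis lookup_zero poly_mapping_eqI)
  then have "lookup (hess f) k \<noteq> 0" using c by (simp add: hess_scale lookup_scale)
  then show "f \<in> nzvecs J3 \<and> hess f \<noteq> 0" using nzvecs_proj[OF g(1,2)] by auto
qed (auto simp: hess_domain_def)

lemma mem_imE:
  assumes "p \<in> im"
  obtains f where "f \<in> forms UNIV 3" "hess f \<noteq> 0" "p = proj (hess f)"
  using assms by (auto simp: im_def hess_domain_def nzvecs_forms Hess_proj)

lemma hess_0: "hess (0 :: (4, 'k) mpoly) = 0"
  using hess_Const_mult[of "0::'k" 0] by (simp add: zero_power)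

lemma mem_imI:
  assumes "f \<in> forms UNIV 3" "hess f \<noteq> 0" shows "proj (hess f) \<in> im"
proof -
  have "proj f \<in> hess_domain 3" using assms hess_0 by (auto simp: mem_hess_domain nzvecs_forms)
  then have "Hess (proj f) \<in> im" unfolding im_def by (rule imageI)
  then show ?thesis by (simp add: Hess_proj)
qed

lemma im_subset: "im \<subseteq> proj_space J4"
  by (auto simp: proj_space_def hess_nzvecs elim!: mem_imE)

definition Y :: "(4 monomial, 'k) point set" where
  "Y = zariski J4 closure_of im"

section \<open>Irreducibility of the space of cubics and of the image\<close>

lemma variety_cubics: "proj_variety J3 (hypersurfaces 3 :: (4 monomial, 'k) point set)"
proof -
  have "proj_variety J3 (zariski J3 closure_of (proj_space J3 :: (4 monomial, 'k) point set))"
  proof (rule proj_variety_closure)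
    show "(proj_space J3 :: (4 monomial, 'k) point set) \<noteq> {}"
    proof -
      have "f0 \<in> nzvecs J3" using f0 hess_0 by (auto simp: nzvecs_forms)
      then show ?thesis by (auto simp: proj_space_def)
    qed
    fix P Q :: "(4 monomial, 'k) mpoly" and d d'
    assume P: "P \<in> forms J3 d" and Q: "Q \<in> forms J3 d'"
      and ne: "basic_open J3 P \<inter> proj_space J3 \<noteq> {}" "basic_open J3 Q \<inter> proj_space J3 \<noteq> {}"
    then obtain a b where a: "a \<in> nzvecs J3" "eval P (lookup a) \<noteq> 0"
      and b: "b \<in> nzvecs J3" "eval Q (lookup b) \<noteq> 0" by (auto simp: basic_open_def)
    \<comment> \<open>The third polynomial serves to make the common point a nonzero form.\<close>
    define p where "p i = (if i = (0::nat) then P else if i = 1 then Q else Var cube1)" for i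
    obtain f where f: "f \<in> forms UNIV 3" "\<And>i. i \<in> {0, 1, 2} \<Longrightarrow> eval (p i) (lookup f) \<noteq> 0"
    proof (rule common_nonzero_forms[of "{0, 1, 2}" 3 p])
      fix i :: nat assume "i \<in> {0, 1, 2}"
      then show "\<exists>f\<in>forms UNIV 3. eval (p i) (lookup f) \<noteq> 0"
        using a b f0 by (auto simp: p_def nzvecs_forms eval_Var[simplified])
    qed auto
    have "f \<noteq> 0" using f(2)[of 2] by (auto simp: p_def eval_Var[simplified])
    then have fn: "f \<in> nzvecs J3" using f(1) by (simp add: nzvecs_forms)
    then have "proj f \<in> basic_open J3 P \<inter> basic_open J3 Q \<inter> proj_space J3"
      using f(2)[of 0] f(2)[of 1] by (auto simp: p_def proj_mem_basic_open[OF P] proj_mem_basic_open[OF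
          Q] proj_space_def)
    then show "basic_open J3 P \<inter> basic_open J3 Q \<inter> proj_space J3 \<noteq> {}" by blast
  qed simp
  moreover have "zariski J3 closure_of (proj_space J3) = (proj_space J3 :: (4 monomial, 'k) point set)"
    using closure_of_topspace[of "zariski J3 :: (4 monomial, 'k) point topology"] by (simp add:
        topspace_zariski)
  ultimately show ?thesis by (simp add: hypersurfaces_def)
qed

lemma eval_hess_pullback:
  "f \<in> forms UNIV 3 \<Longrightarrow> eval (evalh Const P (hess_coeff 3)) (lookup f) = eval P (lookup (hess f))"
  for f :: "(4, 'k) mpoly"
  by (simp add: eval_evalh_Const eval_hess_coeff)

lemma pullback_forms: "P \<in> forms J4 d \<Longrightarrow> evalh Const P (hess_coeff 3) \<in> forms J3 (d * 4)"
  for P :: "(4 monomial, 'k) mpoly"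
  using forms_evalh[of P J4 d "hess_coeff 3" J3 4] hess_coeff_forms[where 'n = 4 and 'a = 'k, of 3] by simp

lemma variety_Y: "proj_variety J4 Y"
  unfolding Y_def
proof (rule proj_variety_closure[OF im_subset])
  show "im \<noteq> {}" using mem_imI[OF f0(1,4)] by blast
  fix P Q :: "(4 monomial, 'k) mpoly" and d d'
  assume P: "P \<in> forms J4 d" and Q: "Q \<in> forms J4 d'" and ne: "basic_open J4 P \<inter> im \<noteq> {}" "basic_open J4
      Q \<inter> im \<noteq> {}"
  obtain f where f: "f \<in> forms UNIV 3" "hess f \<noteq> 0" "eval P (lookup (hess f)) \<noteq> 0"
    using ne(1) by (auto simp: proj_mem_basic_open[OF P] elim!: mem_imE)
  obtain g where g: "g \<in> forms UNIV 3" "hess g \<noteq> 0" "eval Q (lookup (hess g)) \<noteq> 0"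
    using ne(2) by (auto simp: proj_mem_basic_open[OF Q] elim!: mem_imE)
  obtain k where k: "lookup (hess f) k \<noteq> 0" using f(2) by (metis lookup_zero poly_mapping_eqI)
  \<comment> \<open>The third polynomial keeps the Hessian of the common point nonzero.\<close>
  define p where "p i = (if i = (0::nat) then evalh Const P (hess_coeff 3) else
    if i = 1 then evalh Const Q (hess_coeff 3) else hess_coeff 3 k)" for i
  obtain h where h: "h \<in> forms UNIV 3" "\<And>i. i \<in> {0, 1, 2} \<Longrightarrow> eval (p i) (lookup h) \<noteq> 0"
  proof (rule common_nonzero_forms[of "{0, 1, 2}" 3 p])
    fix i :: nat assume "i \<in> {0, 1, 2}"
    then show "\<exists>f\<in>forms UNIV 3. eval (p i) (lookup f) \<noteq> 0"
      using f g k by (auto simp: p_def eval_hess_pullback eval_hess_coeff)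
  qed auto
  have "hess h \<noteq> 0" using h(2)[of 2] by (auto simp: p_def eval_hess_coeff[OF h(1)])
  then have "proj (hess h) \<in> basic_open J4 P \<inter> basic_open J4 Q \<inter> im"
    using h(2)[of 0] h(2)[of 1] mem_imI[OF h(1)] hess_nzvecs[OF h(1)]
    by (auto simp: p_def proj_mem_basic_open[OF P] proj_mem_basic_open[OF Q] eval_hess_pullback[OF h(1)])
  then show "basic_open J4 P \<inter> basic_open J4 Q \<inter> im \<noteq> {}" by blast
qed

lemma vanishing_on_Y:
  assumes P: "P \<in> forms J4 d" and van: "\<And>f. f \<in> forms UNIV 3 \<Longrightarrow> eval P (lookup (hess f)) = 0"
    and b: "proj b \<in> Y" "b \<in> nzvecs J4"
  shows "eval P (lookup b) = 0"
proof (rule ccontr)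
  assume "eval P (lookup b) \<noteq> 0"
  then have "proj b \<in> basic_open J4 P" using b(2) by (simp add: proj_mem_basic_open[OF P])
  then obtain q where q: "q \<in> im" "q \<in> basic_open J4 P"
    using b(1) openin_basic_open[OF P] by (auto simp: Y_def in_closure_of)
  then show False using van by (auto simp: proj_mem_basic_open[OF P] elim!: mem_imE)
qed

text \<open>At the Hessian of a cubic with nonzero coefficient at \<open>cube1\<close>,
  \<open>inv_form\<close> returns a multiple of that cubic, so the minors vanish there. A form that
  vanishes at these Hessians vanishes at all Hessians, hence on \<open>Y\<close>.\<close>

lemma hess_inv_form_proportional:
  assumes b: "proj b \<in> Y" "b \<in> nzvecs J4" and ij: "i \<in> J4" "j \<in> J4"
  shows "lookup (hess (inv_form b)) i * lookup b j =
    lookup (hess (inv_form b)) j * lookup b i"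
proof -
  define M where "M = HR i * Var j - HR j * Var i"
  have M: "M \<in> forms J4 (4 * e + 1)"
    unfolding M_def by (intro forms_diff forms_mult HR_forms forms_Var ij)
  have evM: "eval M (lookup b) = lookup (hess (inv_form b)) i * lookup b j -
      lookup (hess (inv_form b)) j * lookup b i" for b
    by (simp add: M_def eval_simps eval_HR)
  have van: "eval M (lookup (hess f)) = 0" if f: "f \<in> forms UNIV 3" for f
  proof (rule ccontr)
    assume ne: "eval M (lookup (hess f)) \<noteq> 0"
    define p where "p i = (if i = (0::nat) then evalh Const M (hess_coeff 3) else Var cube1)" for i
    obtain h where h: "h \<in> forms UNIV 3" "\<And>i. i \<in> {0, 1} \<Longrightarrow> eval (p i) (lookup h) \<noteq> 0"
    proof (rule common_nonzero_forms[of "{0, 1}" 3 p])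
      fix i :: nat assume "i \<in> {0, 1}"
      then show "\<exists>f\<in>forms UNIV 3. eval (p i) (lookup f) \<noteq> 0"
        using f ne f0 by (auto simp: p_def eval_hess_pullback eval_Var[simplified])
    qed auto
    have 0: "eval M (lookup (hess h)) \<noteq> 0" and 1: "lookup h cube1 \<noteq> 0"
      using h(2)[of 0] h(2)[of 1] by (auto simp: p_def eval_hess_pullback[OF h(1)] eval_Var[simplified])
    from 0 show False
      by (simp add: evM inv_form_hess'[OF h(1) 1] hess_Const_mult lookup_Const_mult)
  qed
  from vanishing_on_Y[OF M van b] evM show ?thesis by simp
qed

lemma Hess_inv_form:
  assumes b: "proj b \<in> Y" "b \<in> nzvecs J4" and nz: "hess (inv_form b) \<noteq> 0"
  shows "proj (hess (inv_form b)) = proj b"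
proof -
  let ?h = "lookup (hess (inv_form b))"
  from nz have "hess (inv_form b) \<in> nzvecs J4" by (intro hess_nzvecs inv_form_forms)
  then obtain k where k: "k \<in> J4" "?h k \<noteq> 0" by (rule nonzero_lookup)
  have eq: "?h i * lookup b k = ?h k * lookup b i" if "i \<in> J4" for i
    using hess_inv_form_proportional[OF b that k(1)] .
  obtain j where j: "j \<in> J4" "lookup b j \<noteq> 0" using b(2) by (rule nonzero_lookup)
  have bk: "lookup b k \<noteq> 0" using eq[OF j(1)] j(2) k(2) by auto
  show ?thesis
  proof (rule proj_eqI)
    show "?h k / lookup b k \<noteq> 0" using k bk by simp
    fix i
    show "?h i = ?h k / lookup b k * lookup b i"
    proof (cases "i \<in> J4")
      case True
      with eq[OF this] bk show ?thesis by (simp add: field_simps)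
    next
      case False
      then have "lookup b i = 0" "?h i = 0"
        using b(2) hess_forms[OF inv_form_forms[of b]] by (auto simp: nzvecs_forms dest: formsD)
      then show ?thesis by simp
    qed
  qed
qed

lemma hess_inv_form_hess:
  assumes "f \<in> forms UNIV 3" "lookup f cube1 \<noteq> 0" "eval (R cube1) (lookup (hess f)) \<noteq> 0" "hess f \<noteq> 0"
  shows "hess (inv_form (hess f)) \<noteq> 0"
proof -
  obtain k where "lookup (hess f) k \<noteq> 0" using assms(4) by (metis lookup_zero poly_mapping_eqI)
  then have "lookup (hess (inv_form (hess f))) k \<noteq> 0"
    using assms(2,3) by (simp add: inv_form_hess'[OF assms(1,2)] hess_Const_mult lookup_Const_mult)
  then show ?thesis by auto
qed

section \<open>The cubics that are recovered from their Hessian\<close>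

lemma inv_map_Hess:
  assumes f: "f \<in> forms UNIV 3" "lookup f cube1 \<noteq> 0" "eval (R cube1) (lookup (hess f)) \<noteq> 0" "hess f \<noteq> 0"
  shows "inv_map (Hess (proj f)) = proj f"
proof -
  have "proj (inv_form (hess f)) = proj f"
    unfolding inv_form_hess'[OF f(1,2)] using f
    by (intro proj_eqI[of "eval (R cube1) (lookup (hess f)) / lookup f cube1"])
      (simp_all add: lookup_Const_mult)
  then show ?thesis by (simp add: Hess_proj inv_map_proj[OF hess_nzvecs[OF f(1,4)]])
qed

text \<open>The two conditions on coefficient and denominator make \<open>inv_form (hess f)\<close>
  a nonzero multiple of \<open>f\<close>.\<close>

definition good :: "(4 monomial, 'k) point set" where
  "good = {proj f | f. f \<in> forms UNIV 3 \<and> lookup f cube1 \<noteq> 0 \<and>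
     eval (R cube1) (lookup (hess f)) \<noteq> 0 \<and> hess f \<noteq> 0}"

lemma openin_good: "openin (zariski J3) good"
proof (rule openin_zariskiI)
  fix p assume "p \<in> good"
  then obtain f where f: "p = proj f" "f \<in> forms UNIV 3" "lookup f cube1 \<noteq> 0"
    "eval (R cube1) (lookup (hess f)) \<noteq> 0" "hess f \<noteq> 0" by (auto simp: good_def)
  obtain k where k: "lookup (hess f) k \<noteq> 0" using f(5) by (metis lookup_zero poly_mapping_eqI)
  define P where "P = Var cube1 * (evalh Const (R cube1) (hess_coeff 3) * hess_coeff 3 k)"
  have P: "P \<in> forms J3 (1 + (e * 4 + CARD(4)))"
    unfolding P_def by (intro forms_mult forms_Var cube1_in pullback_forms R hess_coeff_forms)
  have evP: "eval P (lookup g) = lookup g cube1 *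
      (eval (R cube1) (lookup (hess g)) * lookup (hess g) k)" if "g \<in> forms UNIV 3" for g
    by (simp add: P_def eval_simps eval_hess_pullback[OF that] eval_hess_coeff[OF that])
  have "f \<in> nzvecs J3" using f(2,3) by (auto simp: nzvecs_forms)
  then have "p \<in> basic_open J3 P"
    using f k by (simp add: f(1) proj_mem_basic_open[OF P] evP)
  moreover have "basic_open J3 P \<subseteq> good"
  proof
    fix q assume "q \<in> basic_open J3 P"
    then obtain g where g: "q = proj g" "g \<in> nzvecs J3" "eval P (lookup g) \<noteq> 0" by (auto simp: basic_open_def)
    then have g': "g \<in> forms UNIV 3" by (simp add: nzvecs_forms)
    from g(3) have "lookup g cube1 \<noteq> 0" "eval (R cube1) (lookup (hess g)) \<noteq> 0" "hess g \<noteq> 0"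
      by (auto simp: evP[OF g'])
    with g' g(1) show "q \<in> good" by (auto simp: good_def)
  qed
  ultimately show "\<exists>P d. P \<in> forms J3 d \<and> p \<in> basic_open J3 P \<and> basic_open J3 P \<subseteq> good" using P by blast
qed

lemma good_nonempty: "good \<noteq> {}"
  using f0 by (auto simp: good_def)

lemma good_subset: "good \<subseteq> hess_domain 3"
  using hess_0 by (auto simp: good_def mem_hess_domain nzvecs_forms)

text \<open>The cubic \<open>F'\<close> is arbitrary. The condition on \<open>R cube1\<close>
  concerns only the Hessian and so passes to \<open>F'\<close>; given it, a zero coefficient at
  \<open>cube1\<close> would by \<open>RH\<close> annihilate all coefficients of \<open>F'\<close>.
  Hence \<open>inv_map\<close> recovers both cubics from the same quartic.\<close>

lemma good_unique:
  assumes "F \<in> good" "F' \<in> hypersurfaces 3" "Hess F' = Hess F"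
  shows "F' = F"
proof -
  from assms(1) obtain f where f: "F = proj f" "f \<in> forms UNIV 3" "lookup f cube1 \<noteq> 0"
    "eval (R cube1) (lookup (hess f)) \<noteq> 0" "hess f \<noteq> 0" by (auto simp: good_def)
  from assms(2) obtain f' where f': "F' = proj f'" "f' \<in> forms UNIV 3" "f' \<noteq> 0"
    by (auto simp: hypersurfaces_def proj_space_def nzvecs_forms)
  have "proj (hess f') = proj (hess f)" using assms(3) by (simp add: f(1) f'(1) Hess_proj)
  then obtain c where c: "c \<noteq> 0" "\<And>v. lookup (hess f') v = c * lookup (hess f) v"
    by (rule proj_eqD) blast
  then have hf': "lookup (hess f') = (\<lambda>v. c * lookup (hess f) v)" by blast
  then have D': "eval (R cube1) (lookup (hess f')) \<noteq> 0"
    using f(4) c(1) by (simp add: eval_scale[OF R])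
  obtain k where k: "lookup (hess f) k \<noteq> 0" using f(5) by (metis lookup_zero poly_mapping_eqI)
  have h': "hess f' \<noteq> 0"
  proof
    assume "hess f' = 0"
    with c(2)[of k] c(1) k show False by simp
  qed
  have "lookup f' cube1 \<noteq> 0"
  proof
    assume "lookup f' cube1 = 0"
    then have "lookup f' \<nu> = 0" for \<nu> using RH[OF f'(2), of \<nu>] D' by simp
    then have "f' = 0" by (intro poly_mapping_eqI) simp
    with f'(3) show False by simp
  qed
  from inv_map_Hess[OF f'(2) this D' h'] have "F' = inv_map (Hess F')" by (simp only: f'(1))
  also have "\<dots> = inv_map (Hess F)" by (simp only: assms(3))
  also have "\<dots> = F" unfolding f(1) by (rule inv_map_Hess[OF f(2-5)])
  finally show ?thesis .
qed

lemma openin_hess_domain: "openin (zariski J3) (hess_domain 3 :: (4 monomial, 'k) point set)"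
proof (rule openin_zariskiI)
  fix p :: "(4 monomial, 'k) point" assume "p \<in> hess_domain 3"
  then obtain f :: "(4, 'k) mpoly" where f: "p = proj f" "f \<in> nzvecs J3" "hess f \<noteq> 0" by (auto simp:
      hess_domain_def)
  obtain k where k: "lookup (hess f) k \<noteq> 0" using f(3) by (metis lookup_zero poly_mapping_eqI)
  have P: "(hess_coeff 3 k :: (4 monomial, 'k) mpoly) \<in> forms J3 CARD(4)" by (rule hess_coeff_forms)
  have "p \<in> basic_open J3 (hess_coeff 3 k)"
    using f k by (simp add: proj_mem_basic_open[OF P] eval_hess_coeff nzvecs_forms)
  moreover have "basic_open J3 (hess_coeff 3 k :: (4 monomial, 'k) mpoly) \<subseteq> hess_domain 3"
    by (auto simp: basic_open_def mem_hess_domain nzvecs_forms eval_hess_coeff)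
  ultimately show "\<exists>P d. P \<in> forms J3 d \<and> p \<in> basic_open J3 P \<and> basic_open J3 P \<subseteq> hess_domain 3" using P
      by blast
qed

text \<open>\<open>R cube1\<close> is the coordinate of \<open>inv_form\<close> at
  \<open>cube1\<close>; where it does not vanish, the inverse is defined.\<close>

definition dom :: "(4 monomial, 'k) point set" where
  "dom = Y \<inter> basic_open J4 (R cube1)"

lemma Hess_good:
  assumes "p \<in> good" shows "Hess p \<in> dom" "inv_map (Hess p) = p"
proof -
  from assms obtain f where f: "p = proj f" "f \<in> forms UNIV 3" "lookup f cube1 \<noteq> 0"
    "eval (R cube1) (lookup (hess f)) \<noteq> 0" "hess f \<noteq> 0" by (auto simp: good_def)
  have "im \<subseteq> Y" unfolding Y_def by (rule closure_of_subset) (simp add: topspace_zariski im_subset)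
  then show "Hess p \<in> dom"
    using mem_imI[OF f(2,5)] f hess_nzvecs[OF f(2,5)] by (auto simp: dom_def Hess_proj
        proj_mem_basic_open[OF R])
  show "inv_map (Hess p) = p" unfolding f(1) by (rule inv_map_Hess[OF f(2-5)])
qed

section \<open>The Hessian map and its inverse as rational maps, and their composites\<close>

lemma rational_Hess: "rational_map J3 (hypersurfaces 3) J4 Y (hess_domain 3) (Hess :: (4 monomial, 'k)
    point \<Rightarrow> _)"
  unfolding rational_map_def
proof (intro conjI variety_cubics variety_Y)
  have "hypersurfaces 3 = topspace (zariski J3 :: (4 monomial, 'k) point topology)"
    by (simp add: topspace_zariski hypersurfaces_def)
  then show "openin (subtopology (zariski J3) (hypersurfaces 3 :: (4 monomial, 'k) point set))
      (hess_domain 3)"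
    using openin_hess_domain by (simp only: subtopology_topspace)
  show "hess_domain 3 \<noteq> ({} :: (4 monomial, 'k) point set)" using good_nonempty good_subset by blast
  show "Hess ` hess_domain 3 \<subseteq> Y"
    unfolding Y_def im_def[symmetric] by (rule closure_of_subset) (simp add: topspace_zariski im_subset)
  show "morphism_on J3 J4 (hess_domain 3) (Hess :: (4 monomial, 'k) point \<Rightarrow> _)"
    unfolding morphism_on_def
  proof (intro ballI exI conjI impI)
    fix p :: "(4 monomial, 'k) point" assume p: "p \<in> hess_domain 3"
    show "openin (zariski J3) (hess_domain 3 :: (4 monomial, 'k) point set)" by (rule openin_hess_domain)
    show "p \<in> hess_domain 3" by (rule p)
    show "hess_coeff 3 j \<in> forms J3 CARD(4)" for j by (rule hess_coeff_forms)
    fix a :: "(4, 'k) mpoly" assume a: "a \<in> nzvecs J3" "proj a \<in> hess_domain 3 \<inter> hess_domain 3"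
    then have a': "a \<in> forms UNIV 3" "hess a \<noteq> 0" by (auto simp: nzvecs_forms mem_hess_domain)
    show "\<exists>b\<in>nzvecs J4. (\<forall>j\<in>J4. lookup b j = eval (hess_coeff 3 j) (lookup a)) \<and>
        Hess (proj a) = proj b"
      by (intro bexI[of _ "hess a"] conjI ballI Hess_proj hess_nzvecs a') (simp add: eval_hess_coeff a')
  qed
qed

lemma rational_inv: "rational_map J4 Y J3 (hypersurfaces 3) dom inv_map"
  unfolding rational_map_def
proof (intro conjI variety_cubics variety_Y)
  show "openin (subtopology (zariski J4) Y) dom"
    unfolding dom_def openin_subtopology using openin_basic_open[OF R] by blast
  show "dom \<noteq> {}" using Hess_good(1) good_nonempty by blast
  have nz: "inv_form b \<in> nzvecs J3" if "b \<in> nzvecs J4" "proj b \<in> dom" for b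
  proof -
    have "eval (R cube1) (lookup b) \<noteq> 0" using that by (simp add: dom_def proj_mem_basic_open[OF R])
    then have "lookup (inv_form b) cube1 \<noteq> 0" by (simp add: lookup_inv_form cube1_in)
    then show ?thesis using inv_form_forms[of b] by (auto simp: nzvecs_forms)
  qed
  show "inv_map ` dom \<subseteq> hypersurfaces 3"
  proof
    fix F assume "F \<in> inv_map ` dom"
    then obtain b where "b \<in> nzvecs J4" "proj b \<in> dom" "F = inv_map (proj b)" by (auto simp: dom_def
        basic_open_def)
    then show "F \<in> hypersurfaces 3" using nz by (auto simp: inv_map_proj hypersurfaces_def proj_space_def)
  qed
  show "morphism_on J4 J3 dom inv_map"
    unfolding morphism_on_def
  proof (intro ballI exI conjI impI)
    fix p assume p: "p \<in> dom"
    show "openin (zariski J4) (basic_open J4 (R cube1))" by (rule openin_basic_open[OF R])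
    show "p \<in> basic_open J4 (R cube1)" using p by (simp add: dom_def)
    show "R j \<in> forms J4 e" for j by (rule R)
    fix b assume b: "b \<in> nzvecs J4" "proj b \<in> dom \<inter> basic_open J4 (R cube1)"
    show "\<exists>a\<in>nzvecs J3. (\<forall>j\<in>J3. lookup a j = eval (R j) (lookup b)) \<and>
        inv_map (proj b) = proj a"
      using nz b by (intro bexI[of _ "inv_form b"] conjI ballI inv_map_proj) (auto simp: lookup_inv_form)
  qed
qed

lemma birational_Hess:
  "birational_onto_image J3 (hypersurfaces 3) J4 (hess_domain 3) (Hess :: (4 monomial, 'k) point \<Rightarrow> _)"
  unfolding birational_onto_image_def birational_map_def im_def[symmetric] Y_def[symmetric]
proof (intro conjI exI)
  show "rational_map J3 (hypersurfaces 3) J4 Y (hess_domain 3) (Hess :: (4 monomial, 'k) point \<Rightarrow> _)"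
    by (rule rational_Hess)
  show "rational_map J4 Y J3 (hypersurfaces 3) dom inv_map" by (rule rational_inv)
  have top: "hypersurfaces 3 = topspace (zariski J3 :: (4 monomial, 'k) point topology)"
    by (simp add: topspace_zariski hypersurfaces_def)
  show "rational_left_inverse J3 (hypersurfaces 3) (hess_domain 3) Hess dom inv_map"
    unfolding rational_left_inverse_def top subtopology_topspace
    using openin_good good_nonempty good_subset Hess_good by blast
  obtain p where p: "p \<in> good" using good_nonempty by blast
  then obtain f where f: "p = proj f" "f \<in> forms UNIV 3" "lookup f cube1 \<noteq> 0"
    "eval (R cube1) (lookup (hess f)) \<noteq> 0" "hess f \<noteq> 0" by (auto simp: good_def)
  obtain k where k: "lookup (hess (inv_form (hess f))) k \<noteq> 0"
    using hess_inv_form_hess[OF f(2-5)] by (metis lookup_zero poly_mapping_eqI)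
  \<comment> \<open>On \<open>dom\<close> the cubic \<open>inv_map q\<close> could still have
    Hessian zero. A nonzero value of \<open>HR k\<close> puts it into \<open>hess_domain 3\<close>,
    and \<open>Hess_inv_form\<close> becomes applicable.\<close>
  define W where "W = dom \<inter> basic_open J4 (HR k)"
  have "openin (subtopology (zariski J4) Y) W"
  proof -
    have "W = (basic_open J4 (R cube1) \<inter> basic_open J4 (HR k)) \<inter> Y" by (auto simp: W_def dom_def)
    moreover have "openin (zariski J4) (basic_open J4 (R cube1) \<inter> basic_open J4 (HR k))"
      by (intro openin_Int openin_basic_open[OF R] openin_basic_open[OF HR_forms])
    ultimately show ?thesis
      unfolding openin_subtopology by (intro exI[of _ "basic_open J4 (R cube1) \<inter> basic_open J4 (HR k)"] conjI)
  qed
  moreover have "Hess p \<in> W"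
    using Hess_good(1)[OF p] k hess_nzvecs[OF f(2,5)] by (simp add: W_def f(1) Hess_proj
        proj_mem_basic_open[OF HR_forms] eval_HR)
  moreover have "inv_map q \<in> hess_domain 3 \<and> Hess (inv_map q) = q" if q: "q \<in> W" for q
  proof -
    from q obtain b where b: "q = proj b" "b \<in> nzvecs J4" "eval (HR k) (lookup b) \<noteq> 0"
      by (auto simp: W_def basic_open_def)
    have Y: "proj b \<in> Y" using q by (simp add: W_def dom_def b(1))
    have nz: "hess (inv_form b) \<noteq> 0" using b(3) by (auto simp: eval_HR)
    then have "inv_form b \<in> nzvecs J3" using hess_0 inv_form_forms[of b] by (auto simp: nzvecs_forms)
    with nz show ?thesis
      by (simp add: b(1) inv_map_proj[OF b(2)] mem_hess_domain Hess_proj Hess_inv_form[OF Y b(2) nz])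
  qed
  ultimately show "rational_left_inverse J4 Y dom inv_map (hess_domain 3) Hess"
    unfolding rational_left_inverse_def by (intro exI[of _ W]) (auto simp: W_def)
qed

end

theorem theorem6p6:
  shows "birational_onto_image
      (monomials UNIV 3)
      (hypersurfaces 3 :: (4 monomial, 'k::{alg_closed_field, field_char_0}) point set)
      (monomials UNIV 4)
      (hess_domain 3)
      (Hess :: (4 monomial, 'k) point \<Rightarrow> (4 monomial, 'k) point)
    \<and>
    (\<exists>U :: (4 monomial, 'k) point set.
      openin (zariski (monomials UNIV 3)) U \<and> U \<noteq> {} \<and> U \<subseteq> hess_domain 3 \<and>
      (\<forall>F\<in>U. \<forall>F'\<in>hypersurfaces 3. Hess F' = Hess F \<longrightarrow> F' = F))"
proof -
  obtain e and R :: "4 monomial \<Rightarrow> (4 monomial, 'k) mpoly" and f0 where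
    "\<And>\<nu>. R \<nu> \<in> forms (monomials UNIV 4) e"
    "\<And>f \<nu>. f \<in> forms UNIV 3 \<Longrightarrow> eval (R cube1) (lookup (hess f)) * lookup f \<nu> =
      eval (R \<nu>) (lookup (hess f)) * lookup f cube1"
    "f0 \<in> forms UNIV 3" "eval (R cube1) (lookup (hess f0)) \<noteq> 0"
    "lookup f0 cube1 \<noteq> 0" "hess f0 \<noteq> 0"
    by (rule cubic_rational) blast
  then interpret hessian_inverse R e f0 by unfold_locales
  show ?thesis
    using birational_Hess openin_good good_nonempty good_subset good_unique by blast
qed

end
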